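(* Consider the long-memory dynamic factor model of the context, satisfying the conditions Model, Long memory, Pervasiveness, Memory structure (case (a) or (b)) and Idiosyncratic component. Then the Fourier coefficients of $\underline{\mathbf K}_{ni}(\theta)$ satisfy $$\left\|\mathbf K_{ni,h}\right\|=\mathcal O\left(|h|^{2\Delta-1}\right),$$ where $\Delta$ is the difference between the largest and the smallest memory parameter.
   Context: Notation. $\Pi=(-\pi,\pi]$, $\iota$ is the imaginary unit, $L$ the lag operator, $^*$ conjugate transpose, $\|\cdot\|$, $\|\cdot\|_2$ the Euclidean norm of vectors and the operator norm of matrices. The spectral density matrix $\Sigma_Y$ of a zero-mean stationary vector process is defined by $E[Y_tY_{t-h}']=\int_\Pi e^{\iota h\theta}\Sigma_Y(\theta)\,d\theta$. Constants in the conditions and in $\mathcal O(\cdot)$ are independent of $n$ (and of $h$), the bound being for all sufficiently large $n$. Model. $x_{it}=\chi_{it}+\xi_{it}$, $\chi_{it}=\sum_{l=1}^q b_{il}(L)u_{lt}$, $i\in\mathbb N$, $t\in\mathbb Z$, with $q$ fixed. The vector $u_t=(u_{1t},\dots,u_{qt})'$ is orthonormal white noise with finite fourth moments, scaled so that its spectral density matrix is $I_q$. The filters $b_{il}$ may be two-sided and of infinite order, with square summable coefficients. For each $n$, $\xi_t=(\xi_{1t},\dots,\xi_{nt})'$ is zero-mean stationary, $\xi_{it}$ is independent of $u_{l,t-k}$ for all $i,l,t,k$, and $\xi_t=\sum_{m\in\mathbb Z}B_{\xi,m}\epsilon_{t-m}$ with $\epsilon_t$ an $n$-dimensional second-order white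 noise. Put $X_t=(x_{1t},\dots,x_{nt})'$; its spectral density is $\Sigma(\theta)=\Sigma_\chi(\theta)+\Sigma_\xi(\theta)$. Long memory. $b_{il}(L)=(1-L)^{-d_{il}}g_{il}(L)$ with $d_{il}\in[0,1/2)$ and $g_{il}$ a short-memory filter. Put $d=\max_{i,l}d_{il}$, $\tilde d=\min_{i,l}d_{il}$, $\Delta=d-\tilde d$. Pervasiveness. Let $G(\theta)=[g_{il}(e^{-\iota\theta})]_{i\le n,\,l\le q}$ and $S(\theta)=\frac1nG^*(\theta)G(\theta)$. There are constants $0<s^-\le s^+<\infty$ with $s^-I_q\preceq S(\theta)\preceq s^+I_q$ for all $\theta\in\Pi$; $G$ is twice differentiable with $\|G^{(r)}(\theta)\|_2\le C_{G,r}\sqrt n$, $r=1,2$, and $\|G(\theta_2)-G(\theta_1)\|\le\sqrt n\,L_G|\theta_2-\theta_1|$. Memory structure. Either (a) $d_{il}=d_l$ depends only on the factor $l$, so $\Sigma_\chi(\theta)=G(\theta)\,\mathrm{diag}(|1-e^{-\iota\theta}|^{-2d_l})_{l\le q}\,G^*(\theta)$; or (b) $d_{il}=d_i$ depends only on the row $i$, so $\Sigma_\chi(\theta)=D_n(\theta)G(\theta)G^*(\theta)D_n^*(\theta)$ with $D_n(\theta)=\mathrm{diag}((1-e^{-\iota\theta})^{-d_i})_{i\le n}$. Idiosyncratic component. There are constants $\Lambda_\xi^-,\Lambda_\xi^+$ such that all eigenvalues of $\Sigma_\xi(\theta)$ lie in $[\Lambda_\xi^-,\Lambda_\xi^+]$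 for all $\theta\in\Pi$; $\Sigma_\xi$ is twice differentiable, hence Lipschitz, on $\Pi$; and $\sup_{\|v_1\|_2=\dots=\|v_4\|_2=1}|\mathrm{cum}(v_1'\epsilon_t,v_2'\epsilon_t,v_3'\epsilon_t,v_4'\epsilon_t)|$ is bounded. Eigenprojection row. Let $\mathbf p_j(\theta)$ be orthonormal row eigenvectors of $\Sigma(\theta)$ ($\mathbf p_j\Sigma=\lambda_j\mathbf p_j$, $\lambda_1\ge\dots\ge\lambda_n$), $p_{j,i}$ the $i$-th entry; $\underline{\mathbf K}_{ni}(\theta)=\sum_{j=1}^q\overline{p_{j,i}(\theta)}\,\mathbf p_j(\theta)$, and $\mathbf K_{ni,h}=\frac1{2\pi}\int_\Pi\underline{\mathbf K}_{ni}(\theta)e^{-\iota h\theta}d\theta$, $h\in\mathbb Z\setminus\{0\}$. *)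

theory Defs
  imports "HOL-Probability.Probability" "Jordan_Normal_Form.Schur_Decomposition"
begin

unbundle no vec_syntax and no inner_syntax

text \<open>
  Vectors and matrices whose size depends on \<open>n\<close> are those of \<open>Jordan_Normal_Form\<close>.  All indices
  start at \<open>0\<close>: rows \<open>i < n\<close>, factors \<open>l < q\<close>, eigenvalues \<open>j < n\<close>.  A process
  is a function of the component, the time and the sample point; infinitely many components may be
  given, and an \<open>n\<close>-dimensional process consists of those with index below \<open>n\<close>.
\<close>

abbreviation Freq :: "real set" where
  "Freq \<equiv> {-pi<..pi}"

section \<open>Vectors and matrices\<close>

definition eucl_norm :: "'a::real_normed_vector vec \<Rightarrow> real" where
  "eucl_norm v = L2_set (\<lambda>i. norm (v $ i)) {..<dim_vec v}"

definition op_norm :: "complex mat \<Rightarrow> real" where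
  "op_norm A = (SUP v\<in>{v \<in> carrier_vec (dim_col A). eucl_norm v \<le> 1}. eucl_norm (A *\<^sub>v v))"

definition hermitian_mat :: "complex mat \<Rightarrow> bool" where
  "hermitian_mat A \<longleftrightarrow> square_mat A \<and> mat_adjoint A = A"

definition loewner_le :: "complex mat \<Rightarrow> complex mat \<Rightarrow> bool" (infix "\<preceq>" 50) where
  "A \<preceq> B \<longleftrightarrow> dim_row A = dim_row B \<and> dim_col A = dim_col B \<and> hermitian_mat (B - A) \<and>
     (\<forall>v\<in>carrier_vec (dim_row B). 0 \<le> Re (((B - A) *\<^sub>v v) \<bullet>c v))"

text \<open>Differentiability on \<open>Freq\<close> is relative to that interval, hence one-sided at \<open>pi\<close>.\<close>

definition mat_differentiable :: "(real \<Rightarrow> complex mat) \<Rightarrow> bool" where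
  "mat_differentiable F \<longleftrightarrow> (\<forall>\<theta>\<in>Freq. \<forall>i<dim_row (F \<theta>). \<forall>j<dim_col (F \<theta>).
     (\<lambda>s. F s $$ (i, j)) differentiable (at \<theta> within Freq))"

definition mat_deriv :: "(real \<Rightarrow> complex mat) \<Rightarrow> real \<Rightarrow> complex mat" where
  "mat_deriv F \<theta> = mat (dim_row (F \<theta>)) (dim_col (F \<theta>))
     (\<lambda>(i, j). vector_derivative (\<lambda>s. F s $$ (i, j)) (at \<theta> within Freq))"

definition mat_twice_differentiable :: "(real \<Rightarrow> complex mat) \<Rightarrow> bool" where
  "mat_twice_differentiable F \<longleftrightarrow> mat_differentiable F \<and> mat_differentiable (mat_deriv F)"

section \<open>Second-order processes and spectral densities\<close>

type_synonym 'w process = "nat \<Rightarrow> int \<Rightarrow> 'w \<Rightarrow> real"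

definition square_integrable :: "'w measure \<Rightarrow> ('w \<Rightarrow> real) \<Rightarrow> bool" where
  "square_integrable M X \<longleftrightarrow> X \<in> borel_measurable M \<and> integrable M (\<lambda>w. (X w)\<^sup>2)"

definition zero_mean_stationary :: "'w measure \<Rightarrow> nat \<Rightarrow> 'w process \<Rightarrow> bool" where
  "zero_mean_stationary M n Y \<longleftrightarrow>
     (\<forall>i<n. \<forall>t. square_integrable M (Y i t) \<and> (\<integral>w. Y i t w \<partial>M) = 0) \<and>
     (\<forall>i<n. \<forall>j<n. \<forall>t s h.
        (\<integral>w. Y i t w * Y j (t - h) w \<partial>M) = (\<integral>w. Y i s w * Y j (s - h) w \<partial>M))"

definition white_noise :: "'w measure \<Rightarrow> nat \<Rightarrow> 'w process \<Rightarrow> bool" where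
  "white_noise M n e \<longleftrightarrow> zero_mean_stationary M n e \<and>
     (\<forall>i<n. \<forall>j<n. \<forall>t s. t \<noteq> s \<longrightarrow> (\<integral>w. e i t w * e j s w \<partial>M) = 0)"

text \<open>
  There is no factor \<open>1 / (2 * pi)\<close> in this convention.  The integrals determine a spectral
  density only almost everywhere and make it Hermitian almost everywhere; a version that is
  Hermitian at every frequency is taken.
\<close>

definition is_spectral_density ::
    "'w measure \<Rightarrow> nat \<Rightarrow> 'w process \<Rightarrow> (real \<Rightarrow> complex mat) \<Rightarrow> bool" where
  "is_spectral_density M n Y F \<longleftrightarrow> zero_mean_stationary M n Y \<and>
     (\<forall>\<theta>\<in>Freq. F \<theta> \<in> carrier_mat n n \<and> hermitian_mat (F \<theta>)) \<and>
     (\<forall>i<n. \<forall>j<n. set_integrable lborel Freq (\<lambda>\<theta>. F \<theta> $$ (i, j)) \<and>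
        (\<forall>h t. complex_of_real (\<integral>w. Y i t w * Y j (t - h) w \<partial>M) =
           (LINT \<theta>:Freq|lborel. cis (of_int h * \<theta>) * F \<theta> $$ (i, j))))"

text \<open>The two-sided series of the \<open>f k\<close> converges to \<open>Y\<close> in mean square.\<close>

definition has_ms_sum :: "'w measure \<Rightarrow> (int \<Rightarrow> 'w \<Rightarrow> real) \<Rightarrow> ('w \<Rightarrow> real) \<Rightarrow> bool" where
  "has_ms_sum M f Y \<longleftrightarrow> (\<forall>k. square_integrable M (f k)) \<and> square_integrable M Y \<and>
     ((\<lambda>A. \<integral>w. (Y w - (\<Sum>k\<in>A. f k w))\<^sup>2 \<partial>M) \<longlongrightarrow> 0) (finite_subsets_at_top UNIV)"

definition joint_cumulant :: "'w measure \<Rightarrow> nat \<Rightarrow> (nat \<Rightarrow> 'w \<Rightarrow> real) \<Rightarrow> real" where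
  "joint_cumulant M k X = (\<Sum>P | partition_on {..<k} P.
     (-1) ^ (card P - 1) * fact (card P - 1) * (\<Prod>B\<in>P. \<integral>w. (\<Prod>i\<in>B. X i w) \<partial>M))"

section \<open>Filters\<close>

text \<open>The value \<open>g(exp(- \<i> \<theta>))\<close> of the filter \<open>\<Sum>k. g k * L ^ k\<close>.\<close>

definition transfer_fun :: "(int \<Rightarrow> real) \<Rightarrow> real \<Rightarrow> complex" where
  "transfer_fun g \<theta> = (\<Sum>\<^sub>\<infinity>k\<in>UNIV. complex_of_real (g k) * cis (- (of_int k * \<theta>)))"

definition short_memory :: "(int \<Rightarrow> real) \<Rightarrow> bool" where
  "short_memory g \<longleftrightarrow> (\<lambda>k. \<bar>g k\<bar>) summable_on UNIV"

text \<open>The coefficient of \<open>L ^ m\<close> in the binomial series of \<open>(1 - L) powr (- d)\<close>.\<close>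

definition frac_coeff :: "real \<Rightarrow> nat \<Rightarrow> real" where
  "frac_coeff d m = (-1) ^ m * ((- d) gchoose m)"

section \<open>The factor model\<close>

definition factor_model ::
    "'w measure \<Rightarrow> nat \<Rightarrow> (nat \<Rightarrow> nat \<Rightarrow> int \<Rightarrow> real) \<Rightarrow> 'w process \<Rightarrow> 'w process \<Rightarrow> 'w process \<Rightarrow>
     (nat \<Rightarrow> int \<Rightarrow> real mat) \<Rightarrow> (nat \<Rightarrow> 'w process) \<Rightarrow> bool" where
  "factor_model M q b u \<chi> \<xi> B \<epsilon> \<longleftrightarrow> prob_space M \<and> 0 < q \<and>
     white_noise M q u \<and> is_spectral_density M q u (\<lambda>\<theta>. 1\<^sub>m q) \<and>
     (\<forall>l<q. \<forall>t. integrable M (\<lambda>w. u l t w ^ 4)) \<and>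
     (\<forall>i. \<forall>l<q. (\<lambda>k. (b i l k)\<^sup>2) summable_on UNIV) \<and>
     (\<forall>i t. has_ms_sum M (\<lambda>k w. \<Sum>l<q. b i l k * u l (t - k) w) (\<chi> i t)) \<and>
     (\<forall>i. \<forall>l<q. \<forall>t k. prob_space.indep_var M borel (\<xi> i t) borel (u l (t - k))) \<and>
     (\<forall>n. zero_mean_stationary M n \<xi> \<and> white_noise M n (\<epsilon> n) \<and>
        (\<forall>m. B n m \<in> carrier_mat n n) \<and>
        (\<forall>i<n. \<forall>t. has_ms_sum M (\<lambda>m w. \<Sum>j<n. B n m $$ (i, j) * \<epsilon> n j (t - m) w) (\<xi> i t)))"

definition long_memory ::
    "nat \<Rightarrow> (nat \<Rightarrow> nat \<Rightarrow> int \<Rightarrow> real) \<Rightarrow> (nat \<Rightarrow> nat \<Rightarrow> real) \<Rightarrow> (nat \<Rightarrow> nat \<Rightarrow> int \<Rightarrow> real) \<Rightarrow> bool" where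
  "long_memory q b d g \<longleftrightarrow> (\<forall>i. \<forall>l<q. 0 \<le> d i l \<and> d i l < 1 / 2 \<and> short_memory (g i l) \<and>
     (\<forall>k. b i l k = (\<Sum>m. frac_coeff (d i l) m * g i l (k - int m))))"

definition loading_mat :: "nat \<Rightarrow> (nat \<Rightarrow> nat \<Rightarrow> int \<Rightarrow> real) \<Rightarrow> nat \<Rightarrow> real \<Rightarrow> complex mat" where
  "loading_mat q g n \<theta> = mat n q (\<lambda>(i, l). transfer_fun (g i l) \<theta>)"

text \<open>
  The bounds are required for all sufficiently large \<open>n\<close>, with constants not depending on \<open>n\<close>.
  (For \<open>n < q\<close> the positive lower bound cannot hold, the rank of \<open>G\<close> being at most \<open>n\<close>.)
\<close>

definition pervasive_loadings :: "nat \<Rightarrow> (nat \<Rightarrow> nat \<Rightarrow> int \<Rightarrow> real) \<Rightarrow> bool" where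
  "pervasive_loadings q g \<longleftrightarrow> (let G = loading_mat q g in
     (\<exists>s1 s2. 0 < s1 \<and> s1 \<le> s2 \<and> (\<forall>\<^sub>F n in sequentially. \<forall>\<theta>\<in>Freq.
        let S = complex_of_real (1 / real n) \<cdot>\<^sub>m (mat_adjoint (G n \<theta>) * G n \<theta>) in
        complex_of_real s1 \<cdot>\<^sub>m 1\<^sub>m q \<preceq> S \<and> S \<preceq> complex_of_real s2 \<cdot>\<^sub>m 1\<^sub>m q)) \<and>
     (\<forall>n. mat_twice_differentiable (G n)) \<and>
     (\<exists>C1 C2. \<forall>\<^sub>F n in sequentially. \<forall>\<theta>\<in>Freq.
        op_norm (mat_deriv (G n) \<theta>) \<le> C1 * sqrt (real n) \<and>
        op_norm (mat_deriv (mat_deriv (G n)) \<theta>) \<le> C2 * sqrt (real n)) \<and>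
     (\<exists>L. \<forall>\<^sub>F n in sequentially. \<forall>\<theta>1\<in>Freq. \<forall>\<theta>2\<in>Freq.
        op_norm (G n \<theta>2 - G n \<theta>1) \<le> sqrt (real n) * L * \<bar>\<theta>2 - \<theta>1\<bar>))"

text \<open>
  The frequency \<open>0\<close>, where the spectral density of the common component may be infinite, is left out.
\<close>

definition memory_structure ::
    "nat \<Rightarrow> (nat \<Rightarrow> nat \<Rightarrow> real) \<Rightarrow> (nat \<Rightarrow> nat \<Rightarrow> int \<Rightarrow> real) \<Rightarrow> (nat \<Rightarrow> real \<Rightarrow> complex mat) \<Rightarrow> bool" where
  "memory_structure q d g \<Sigma>\<chi> \<longleftrightarrow> (let G = loading_mat q g in
     (\<exists>\<delta>. (\<forall>i. \<forall>l<q. d i l = \<delta> l) \<and>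
        (\<forall>n. \<forall>\<theta>\<in>Freq - {0}. \<Sigma>\<chi> n \<theta> = G n \<theta> *
           mat_diag q (\<lambda>l. complex_of_real (norm (1 - cis (- \<theta>)) powr (- 2 * \<delta> l))) *
           mat_adjoint (G n \<theta>))) \<or>
     (\<exists>\<delta>. (\<forall>i. \<forall>l<q. d i l = \<delta> i) \<and>
        (\<forall>n. \<forall>\<theta>\<in>Freq - {0}.
           let D = mat_diag n (\<lambda>i. (1 - cis (- \<theta>)) powr complex_of_real (- \<delta> i)) in
           \<Sigma>\<chi> n \<theta> = D * G n \<theta> * mat_adjoint (G n \<theta>) * mat_adjoint D)))"

text \<open>
  The fourth moments of \<open>\<epsilon>\<close> are required because the cumulants, as integrals of possibly
  non-integrable functions, would otherwise carry no information.
\<close>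

definition idiosyncratic :: "'w measure \<Rightarrow> (nat \<Rightarrow> 'w process) \<Rightarrow> (nat \<Rightarrow> real \<Rightarrow> complex mat) \<Rightarrow> bool" where
  "idiosyncratic M \<epsilon> \<Sigma>\<xi> \<longleftrightarrow>
     (\<exists>\<Lambda>1 \<Lambda>2. \<forall>\<^sub>F n in sequentially. \<forall>\<theta>\<in>Freq. \<forall>k. eigenvalue (\<Sigma>\<xi> n \<theta>) k \<longrightarrow>
        k \<in> complex_of_real ` {\<Lambda>1..\<Lambda>2}) \<and>
     (\<forall>n. mat_twice_differentiable (\<Sigma>\<xi> n)) \<and>
     (\<exists>L. \<forall>\<^sub>F n in sequentially. \<forall>\<theta>1\<in>Freq. \<forall>\<theta>2\<in>Freq.
        op_norm (\<Sigma>\<xi> n \<theta>2 - \<Sigma>\<xi> n \<theta>1) \<le> L * \<bar>\<theta>2 - \<theta>1\<bar>) \<and>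
     (\<forall>n. \<forall>j<n. \<forall>t. integrable M (\<lambda>w. \<epsilon> n j t w ^ 4)) \<and>
     (\<exists>C. \<forall>\<^sub>F n in sequentially. \<forall>t. \<forall>v :: nat \<Rightarrow> real vec.
        (\<forall>r<4. v r \<in> carrier_vec n \<and> eucl_norm (v r) = 1) \<longrightarrow>
        \<bar>joint_cumulant M 4 (\<lambda>r w. \<Sum>j<n. v r $ j * \<epsilon> n j t w)\<bar> \<le> C)"

section \<open>Eigenprojection rows\<close>

text \<open>The row eigenvector equation \<open>p A = \<lambda> p\<close> is written with the transpose of \<open>A\<close>.\<close>

definition ordered_row_eigenbasis ::
    "nat \<Rightarrow> complex mat \<Rightarrow> (nat \<Rightarrow> real) \<Rightarrow> (nat \<Rightarrow> complex vec) \<Rightarrow> bool" where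
  "ordered_row_eigenbasis n A lam ps \<longleftrightarrow>
     (\<forall>j<n. ps j \<in> carrier_vec n \<and> transpose_mat A *\<^sub>v ps j = complex_of_real (lam j) \<cdot>\<^sub>v ps j) \<and>
     (\<forall>j<n. \<forall>k<n. ps j \<bullet>c ps k = (if j = k then 1 else 0)) \<and>
     (\<forall>j k. j \<le> k \<and> k < n \<longrightarrow> lam k \<le> lam j)"

definition proj_row :: "nat \<Rightarrow> nat \<Rightarrow> (nat \<Rightarrow> complex vec) \<Rightarrow> nat \<Rightarrow> complex vec" where
  "proj_row q n ps i = vec n (\<lambda>m. \<Sum>j<q. cnj (ps j $ i) * ps j $ m)"

definition fourier_coeff_vec :: "nat \<Rightarrow> (real \<Rightarrow> complex vec) \<Rightarrow> int \<Rightarrow> complex vec" where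
  "fourier_coeff_vec n F h = vec n (\<lambda>m.
     complex_of_real (1 / (2 * pi)) * (LINT \<theta>:Freq|lborel. F \<theta> $ m * cis (- (of_int h * \<theta>))))"

end

theory Submission
  imports Defs
begin

text \<open>
  The shift by \<open>\<eta> = pi / \<bar>h\<bar>\<close> changes the sign of \<open>exp (- \<i> h \<theta>)\<close>, so that twice the \<open>h\<close>-th Fourier
  integral of \<open>K\<close> is the integral of \<open>(K \<theta> - K (\<theta> + \<eta>)) * exp (- \<i> h \<theta>)\<close>.  The decay of the
  coefficients is therefore governed by the modulus of continuity of \<open>K\<close>
  (\<open>Fourier_integral_decay\<close>).  Here \<open>K\<close> is a row of the projection \<open>P\<close> on the span of the \<open>q\<close> leading
  eigenvectors.  The rows have norm at most \<open>1\<close>, and this trivial bound is good enough at distance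
  \<open>O(\<eta>)\<close> from the singular frequency \<open>0\<close> and from the ends of the interval.

  Elsewhere the change of \<open>P\<close> is at most the change of the matrix divided by the gap between the
  leading eigenvalues and the others (\<open>eigenproj_perturbation\<close>).  Multiplication of \<open>\<Sigma> \<theta>\<close> by
  the scalar \<open>\<bar>1 - exp (- \<i> \<theta>)\<bar> powr (2 * dmax)\<close> does not affect \<open>P\<close>.  In both memory structures it
  turns the common part into \<open>L L\<^sup>*\<close>, where \<open>L\<close> is the short-memory loading matrix with entries
  multiplied by powers \<open>(1 - exp (- \<i> \<theta>)) powr a\<close> with \<open>0 \<le> a \<le> \<Delta>\<close> (\<open>memory_structure_gram\<close>).  Let
  \<open>t\<close> be the smaller of \<open>\<bar>\<theta>\<bar>\<close> and \<open>\<bar>\<theta>'\<bar>\<close>, for frequencies of equal sign.  Then the normalised matrix changes by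
  \<open>O(n * \<bar>\<theta> - \<theta>'\<bar> * (1 + \<Delta> / t + dmax * t powr (2 * dmax - 1)))\<close>, whereas its gap is at least of
  order \<open>n * t powr (2 * \<Delta>)\<close>: the matrix \<open>L L\<^sup>*\<close> has rank \<open>q\<close>, its nonzero eigenvalues are bounded below by
  pervasiveness, and the idiosyncratic part is bounded (\<open>eigenvalue_lower_bound\<close>,
  \<open>eigenvalue_upper_bound\<close>).  The factor \<open>n\<close> cancels in the quotient, and there remains
  (\<open>eigenprojection_modulus_ordered\<close>, \<open>modulus_power_bound\<close>) a modulus of continuity
  \<open>C * \<bar>\<theta> - \<theta>'\<bar> * t powr (- \<beta>)\<close> with \<open>\<beta> = 1 + 2 * \<Delta>\<close> if \<open>\<Delta> > 0\<close> and some \<open>\<beta> < 1\<close> if \<open>\<Delta> = 0\<close>.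

  Integration of \<open>\<eta> * t powr (- \<beta>)\<close> over \<open>t \<ge> \<eta>\<close> gives \<open>O(\<eta> powr (1 - 2 * \<Delta>))\<close> in both cases
  (\<open>decay_rate\<close>).  The normalisation is essential for \<open>\<Delta> = 0 < dmax\<close>: the same argument for \<open>\<Sigma>\<close>
  itself would give \<open>\<beta> = 1\<close> and a superfluous factor \<open>ln \<bar>h\<bar>\<close>.
\<close>

section \<open>Vectors and matrices as functions of their indices\<close>

text \<open>
  Vectors and matrices are functions of their indices, of which only the values at indices below
  the dimensions count.  The dimensions are arguments of the operations, so that no carrier
  conditions arise and matrices can be written down entrywise.
\<close>

definition dotp :: "nat \<Rightarrow> (nat \<Rightarrow> complex) \<Rightarrow> (nat \<Rightarrow> complex) \<Rightarrow> complex" where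
  "dotp n x y = (\<Sum>i<n. x i * cnj (y i))"

definition vlen :: "nat \<Rightarrow> (nat \<Rightarrow> complex) \<Rightarrow> real" where
  "vlen n x = L2_set (\<lambda>i. cmod (x i)) {..<n}"

definition mapply :: "nat \<Rightarrow> (nat \<Rightarrow> nat \<Rightarrow> complex) \<Rightarrow> (nat \<Rightarrow> complex) \<Rightarrow> nat \<Rightarrow> complex" where
  "mapply m A x = (\<lambda>i. \<Sum>j<m. A i j * x j)"

definition adjm :: "(nat \<Rightarrow> nat \<Rightarrow> complex) \<Rightarrow> nat \<Rightarrow> nat \<Rightarrow> complex" where
  "adjm A = (\<lambda>i j. cnj (A j i))"

definition herm :: "nat \<Rightarrow> (nat \<Rightarrow> nat \<Rightarrow> complex) \<Rightarrow> bool" where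
  "herm n A \<longleftrightarrow> (\<forall>i<n. \<forall>j<n. cnj (A j i) = A i j)"

definition bounded_op :: "nat \<Rightarrow> nat \<Rightarrow> (nat \<Rightarrow> nat \<Rightarrow> complex) \<Rightarrow> real \<Rightarrow> bool" where
  "bounded_op n m A K \<longleftrightarrow> 0 \<le> K \<and> (\<forall>x. vlen n (mapply m A x) \<le> K * vlen m x)"

lemma vlen_sq: "(vlen n x)\<^sup>2 = (\<Sum>i<n. (cmod (x i))\<^sup>2)"
  by (simp add: vlen_def L2_set_def sum_nonneg)

lemma vlen_nonneg [simp]: "0 \<le> vlen n x"
  by (simp add: vlen_def)

lemma dotp_self: "dotp n x x = of_real ((vlen n x)\<^sup>2)"
  unfolding vlen_sq dotp_def of_real_sum complex_norm_square ..

lemma dotp_cnj: "cnj (dotp n x y) = dotp n y x"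
  by (simp add: dotp_def mult.commute)

lemma dotp_cong: "(\<And>i. i < n \<Longrightarrow> x i = x' i) \<Longrightarrow> (\<And>i. i < n \<Longrightarrow> y i = y' i) \<Longrightarrow> dotp n x y = dotp n x' y'"
  by (simp add: dotp_def)

lemma vlen_cong: "(\<And>i. i < n \<Longrightarrow> x i = x' i) \<Longrightarrow> vlen n x = vlen n x'"
  by (simp add: vlen_def L2_set_def)

lemma Cauchy_Schwarz_dotp: "cmod (dotp n x y) \<le> vlen n x * vlen n y"
proof -
  have "cmod (dotp n x y) \<le> (\<Sum>i<n. \<bar>cmod (x i)\<bar> * \<bar>cmod (y i)\<bar>)"
    unfolding dotp_def by (rule order_trans[OF norm_sum]) (simp add: norm_mult)
  also have "\<dots> \<le> vlen n x * vlen n y"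
    unfolding vlen_def by (rule L2_set_mult_ineq)
  finally show ?thesis .
qed

lemma vlen_triangle: "vlen n (\<lambda>i. x i + y i) \<le> vlen n x + vlen n y"
proof -
  have "vlen n (\<lambda>i. x i + y i) \<le> L2_set (\<lambda>i. cmod (x i) + cmod (y i)) {..<n}"
    unfolding vlen_def by (rule L2_set_mono) (auto simp: norm_triangle_ineq)
  also have "\<dots> \<le> vlen n x + vlen n y"
    unfolding vlen_def by (rule L2_set_triangle_ineq)
  finally show ?thesis .
qed

lemma vlen_scale: "vlen n (\<lambda>i. c * x i) = cmod c * vlen n x"
  by (simp add: vlen_def norm_mult L2_set_right_distrib)

lemma vlen_uminus: "vlen n (\<lambda>i. - x i) = vlen n x"
  by (simp add: vlen_def)

lemma vlen_triangle_diff: "vlen n (\<lambda>i. x i - y i) \<le> vlen n x + vlen n y"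
  using vlen_triangle[of n x "\<lambda>i. - y i"] by (simp add: vlen_uminus)

lemma vlen_eq_0_iff: "vlen n x = 0 \<longleftrightarrow> (\<forall>i<n. x i = 0)"
  by (auto simp: vlen_def L2_set_eq_0_iff)

lemma dotp_diff_left: "dotp n (\<lambda>i. x i - y i) z = dotp n x z - dotp n y z"
  and dotp_add_left: "dotp n (\<lambda>i. x i + y i) z = dotp n x z + dotp n y z"
  and dotp_scale_left: "dotp n (\<lambda>i. c * x i) z = c * dotp n x z"
  and dotp_diff_right: "dotp n z (\<lambda>i. x i - y i) = dotp n z x - dotp n z y"
  and dotp_scale_right: "dotp n z (\<lambda>i. c * x i) = cnj c * dotp n z x"
  by (simp_all add: dotp_def algebra_simps sum.distrib sum_subtractf sum_distrib_left)

lemma dotp_sum_left: "dotp n (\<lambda>i. \<Sum>k\<in>K. f k i) z = (\<Sum>k\<in>K. dotp n (f k) z)"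
  and dotp_sum_right: "dotp n z (\<lambda>i. \<Sum>k\<in>K. f k i) = (\<Sum>k\<in>K. dotp n z (f k))"
proof -
  show "dotp n (\<lambda>i. \<Sum>k\<in>K. f k i) z = (\<Sum>k\<in>K. dotp n (f k) z)"
    unfolding dotp_def sum_distrib_right by (rule sum.swap)
  show "dotp n z (\<lambda>i. \<Sum>k\<in>K. f k i) = (\<Sum>k\<in>K. dotp n z (f k))"
    unfolding dotp_def cnj_sum sum_distrib_left by (rule sum.swap)
qed

lemma mapply_adjm: "dotp n (mapply m A x) y = dotp m x (mapply n (adjm A) y)"
proof -
  have "dotp n (mapply m A x) y = (\<Sum>i<n. \<Sum>j<m. A i j * x j * cnj (y i))"
    by (simp add: dotp_def mapply_def sum_distrib_right)
  also have "\<dots> = (\<Sum>j<m. \<Sum>i<n. A i j * x j * cnj (y i))"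
    by (rule sum.swap)
  also have "\<dots> = dotp m x (mapply n (adjm A) y)"
    by (simp add: dotp_def mapply_def adjm_def sum_distrib_left algebra_simps)
  finally show ?thesis .
qed

lemma herm_dotp:
  assumes "herm n A"
  shows "dotp n (mapply n A x) y = dotp n x (mapply n A y)"
proof -
  have "mapply n (adjm A) y i = mapply n A y i" if "i < n" for i
    using assms that by (simp add: mapply_def adjm_def herm_def)
  then show ?thesis
    by (simp add: mapply_adjm cong: dotp_cong)
qed

lemma mapply_diff: "mapply m A (\<lambda>i. x i - y i) = (\<lambda>i. mapply m A x i - mapply m A y i)"
  and mapply_scale: "mapply m A (\<lambda>i. c * x i) = (\<lambda>i. c * mapply m A x i)"
  by (simp_all add: fun_eq_iff mapply_def algebra_simps sum.distrib sum_subtractf sum_distrib_left)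

lemma bounded_opD: "bounded_op n m A K \<Longrightarrow> vlen n (mapply m A x) \<le> K * vlen m x"
  by (simp add: bounded_op_def)

text \<open>
  By duality: \<open>\<parallel>A\<^sup>* y\<parallel>\<^sup>2 = \<langle>A A\<^sup>* y, y\<rangle> \<le> K \<parallel>A\<^sup>* y\<parallel> \<parallel>y\<parallel>\<close>.
\<close>

lemma bounded_op_adjm:
  assumes "bounded_op n m A K"
  shows "bounded_op m n (adjm A) K"
  unfolding bounded_op_def
proof (intro conjI allI)
  show K: "0 \<le> K"
    using assms by (simp add: bounded_op_def)
  fix y
  let ?z = "mapply n (adjm A) y"
  have "(vlen m ?z)\<^sup>2 = cmod (dotp m ?z ?z)"
    unfolding dotp_self norm_of_real by simp
  also have "\<dots> = cmod (dotp n (mapply m A ?z) y)"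
    by (simp add: mapply_adjm)
  also have "\<dots> \<le> vlen n (mapply m A ?z) * vlen n y"
    by (rule Cauchy_Schwarz_dotp)
  also have "\<dots> \<le> K * vlen m ?z * vlen n y"
    by (intro mult_right_mono bounded_opD[OF assms]) simp
  finally have *: "vlen m ?z * vlen m ?z \<le> vlen m ?z * (K * vlen n y)"
    by (simp add: power2_eq_square algebra_simps)
  show "vlen m ?z \<le> K * vlen n y"
  proof (cases "vlen m ?z = 0")
    case False
    then have "0 < vlen m ?z" using vlen_nonneg[of m ?z] by linarith
    then show ?thesis using * by simp
  qed (use K in simp)
qed

lemma bounded_op_mono: "bounded_op n m A K \<Longrightarrow> K \<le> K' \<Longrightarrow> bounded_op n m A K'"
  by (fastforce simp: bounded_op_def intro: order_trans[OF _ mult_right_mono])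

text \<open>
  The Frobenius norm serves as a bound.
\<close>

lemma bounded_op_exists: "\<exists>K. bounded_op n m A K"
proof -
  let ?K = "L2_set (\<lambda>i. vlen m (\<lambda>j. cnj (A i j))) {..<n}"
  have "vlen n (mapply m A x) \<le> ?K * vlen m x" for x
  proof -
    have "vlen n (mapply m A x) \<le> L2_set (\<lambda>i. vlen m (\<lambda>j. cnj (A i j)) * vlen m x) {..<n}"
      unfolding vlen_def[of n]
    proof (rule L2_set_mono)
      fix i
      have "mapply m A x i = dotp m x (\<lambda>j. cnj (A i j))"
        by (simp add: mapply_def dotp_def mult.commute)
      then show "cmod (mapply m A x i) \<le> vlen m (\<lambda>j. cnj (A i j)) * vlen m x"
        using Cauchy_Schwarz_dotp[of m x "\<lambda>j. cnj (A i j)"] by (simp add: mult.commute)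
    qed auto
    also have "\<dots> = ?K * vlen m x"
      by (simp add: L2_set_left_distrib)
    finally show ?thesis .
  qed
  then show ?thesis
    by (intro exI[of _ ?K]) (simp add: bounded_op_def)
qed

lemma bounded_op_cong:
  "(\<And>i j. i < n \<Longrightarrow> j < m \<Longrightarrow> A i j = B i j) \<Longrightarrow> bounded_op n m A K = bounded_op n m B K"
  unfolding bounded_op_def by (simp add: mapply_def cong: vlen_cong)

lemma bounded_op_add:
  assumes "bounded_op n m A K" "bounded_op n m B K'"
  shows "bounded_op n m (\<lambda>i j. A i j + B i j) (K + K')"
  unfolding bounded_op_def
proof (intro conjI allI)
  show "0 \<le> K + K'" using assms by (simp add: bounded_op_def)
  fix x
  have "mapply m (\<lambda>i j. A i j + B i j) x = (\<lambda>i. mapply m A x i + mapply m B x i)"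
    by (simp add: mapply_def algebra_simps sum.distrib)
  then have "vlen n (mapply m (\<lambda>i j. A i j + B i j) x) \<le> vlen n (mapply m A x)
      + vlen n (mapply m B x)"
    by (simp add: vlen_triangle)
  also have "\<dots> \<le> K * vlen m x + K' * vlen m x"
    using assms by (intro add_mono bounded_opD)
  finally show "vlen n (mapply m (\<lambda>i j. A i j + B i j) x) \<le> (K + K') * vlen m x"
    by (simp add: algebra_simps)
qed

lemma bounded_op_scalar:
  assumes "bounded_op n m A K"
  shows "bounded_op n m (\<lambda>i j. c * A i j) (cmod c * K)"
  unfolding bounded_op_def
proof (intro conjI allI)
  show "0 \<le> cmod c * K" using assms by (simp add: bounded_op_def)
  fix x
  have "mapply m (\<lambda>i j. c * A i j) x = (\<lambda>i. c * mapply m A x i)"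
    by (simp add: mapply_def sum_distrib_left algebra_simps)
  then have "vlen n (mapply m (\<lambda>i j. c * A i j) x) = cmod c * vlen n (mapply m A x)"
    by (simp add: vlen_scale)
  also have "\<dots> \<le> cmod c * (K * vlen m x)"
    using assms by (intro mult_left_mono bounded_opD) auto
  finally show "vlen n (mapply m (\<lambda>i j. c * A i j) x) \<le> cmod c * K * vlen m x"
    by (simp add: algebra_simps)
qed

lemma mapply_compose:
  "mapply p (\<lambda>i j. \<Sum>k<m. A i k * B k j) x = mapply m A (mapply p B x)"
proof
  fix i
  have "mapply p (\<lambda>i j. \<Sum>k<m. A i k * B k j) x i = (\<Sum>j<p. \<Sum>k<m. A i k * B k j * x j)"
    by (simp add: mapply_def sum_distrib_right)
  also have "\<dots> = (\<Sum>k<m. \<Sum>j<p. A i k * B k j * x j)"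
    by (rule sum.swap)
  finally show "mapply p (\<lambda>i j. \<Sum>k<m. A i k * B k j) x i = mapply m A (mapply p B x) i"
    by (simp add: mapply_def sum_distrib_left algebra_simps)
qed

lemma bounded_op_compose:
  assumes "bounded_op n m A K" "bounded_op m p B K'"
  shows "bounded_op n p (\<lambda>i j. \<Sum>k<m. A i k * B k j) (K * K')"
  unfolding bounded_op_def mapply_compose
proof (intro conjI allI)
  show "0 \<le> K * K'" using assms by (simp add: bounded_op_def)
  fix x
  have "vlen n (mapply m A (mapply p B x)) \<le> K * vlen m (mapply p B x)"
    by (rule bounded_opD[OF assms(1)])
  also have "\<dots> \<le> K * (K' * vlen p x)"
    using assms by (intro mult_left_mono bounded_opD) (auto simp: bounded_op_def)
  finally show "vlen n (mapply m A (mapply p B x)) \<le> K * K' * vlen p x"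
    by (simp add: algebra_simps)
qed

definition gram :: "nat \<Rightarrow> (nat \<Rightarrow> nat \<Rightarrow> complex) \<Rightarrow> nat \<Rightarrow> nat \<Rightarrow> complex" where
  "gram q L i j = (\<Sum>l<q. L i l * cnj (L j l))"

lemma dotp_gram: "dotp n (mapply n (gram q L) x) x = complex_of_real ((vlen q (mapply n (adjm L)
    x))\<^sup>2)"
proof -
  have "mapply n (gram q L) x = mapply q L (mapply n (adjm L) x)"
    using mapply_compose[where p = n and m = q and A = L and B = "adjm L" and x = x] by
        (simp add: gram_def[abs_def] adjm_def[abs_def])
  then show ?thesis
    by (simp only: mapply_adjm dotp_self)
qed

lemma bounded_op_gram_diff:
  assumes L: "bounded_op n q L K" and L': "bounded_op n q L' K"
    and D: "bounded_op n q (\<lambda>i l. L i l - L' i l) D"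
  shows "bounded_op n n (\<lambda>i j. gram q L i j - gram q L' i j) (2 * (D * K))"
proof -
  have "bounded_op n n (\<lambda>i j. (\<Sum>l<q. (L i l - L' i l) * adjm L l j)
      + (\<Sum>l<q. L' i l * adjm (\<lambda>i l. L i l - L' i l) l j)) (D * K + K * D)"
    by (intro bounded_op_add bounded_op_compose bounded_op_adjm assms)
  moreover have "(\<Sum>l<q. (L i l - L' i l) * adjm L l j) + (\<Sum>l<q. L' i l * adjm (\<lambda>i l. L i l
      - L' i l) l j)
      = gram q L i j - gram q L' i j" for i j
    unfolding gram_def adjm_def sum.distrib[symmetric] sum_subtractf[symmetric]
    by (intro sum.cong refl) (simp add: algebra_simps)
  ultimately show ?thesis by (simp add: mult.commute)
qed

text \<open>
  This covers exponents that depend only on the factor and exponents that depend only on the row.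
  The entrywise product with such a matrix is multiplication by a diagonal matrix from one side;
  unlike general entrywise products it therefore respects bounds of the operator norm and, from
  below, coercivity.
\<close>

definition single_index :: "nat \<Rightarrow> nat \<Rightarrow> (nat \<Rightarrow> nat \<Rightarrow> 'a) \<Rightarrow> bool" where
  "single_index n q s \<longleftrightarrow> (\<exists>\<phi>. \<forall>i<n. \<forall>l<q. s i l = \<phi> i) \<or> (\<exists>\<phi>. \<forall>i<n. \<forall>l<q. s i l = \<phi> l)"

lemma single_index_map: "single_index n q s \<Longrightarrow> single_index n q (\<lambda>i l. f (s i l))"
proof -
  assume "single_index n q s"
  then consider \<phi> where "\<forall>i<n. \<forall>l<q. s i l = \<phi> i" | \<phi> where "\<forall>i<n. \<forall>l<q. s i l = \<phi> l"
    unfolding single_index_def by blast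
  then show ?thesis
  proof cases
    case (1 \<phi>)
    then have "\<forall>i<n. \<forall>l<q. f (s i l) = f (\<phi> i)" by simp
    then show ?thesis unfolding single_index_def by (intro disjI1 exI[of _ "\<lambda>i. f (\<phi> i)"])
  next
    case (2 \<phi>)
    then have "\<forall>i<n. \<forall>l<q. f (s i l) = f (\<phi> l)" by simp
    then show ?thesis unfolding single_index_def by (intro disjI2 exI[of _ "\<lambda>l. f (\<phi> l)"])
  qed
qed

lemma vlen_diag_le:
  assumes "\<And>i. i < n \<Longrightarrow> cmod (f i) \<le> M"
  shows "vlen n (\<lambda>i. f i * x i) \<le> \<bar>M\<bar> * vlen n x"
proof -
  have "vlen n (\<lambda>i. f i * x i) \<le> L2_set (\<lambda>i. \<bar>M\<bar> * cmod (x i)) {..<n}"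
    unfolding vlen_def
    by (rule L2_set_mono) (use assms in \<open>force simp: norm_mult intro!: mult_right_mono\<close>)+
  then show ?thesis by (simp add: vlen_def L2_set_right_distrib)
qed

lemma vlen_diag_ge:
  assumes "0 \<le> m" "\<And>i. i < n \<Longrightarrow> m \<le> cmod (f i)"
  shows "m * vlen n x \<le> vlen n (\<lambda>i. f i * x i)"
proof -
  have "L2_set (\<lambda>i. m * cmod (x i)) {..<n} \<le> vlen n (\<lambda>i. f i * x i)"
    unfolding vlen_def
    by (rule L2_set_mono) (use assms in \<open>auto simp: norm_mult intro!: mult_right_mono\<close>)
  then show ?thesis using assms by (simp add: vlen_def L2_set_right_distrib)
qed

lemma single_index_cases:
  assumes "single_index n q s"
  obtains \<phi> where "\<And>x i. i < n \<Longrightarrow> mapply q (\<lambda>i l. s i l * A i l) x i = \<phi> i * mapply q A x i"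
      "\<And>i l. i < n \<Longrightarrow> l < q \<Longrightarrow> s i l = \<phi> i"
    | \<phi> where "\<And>x i. i < n \<Longrightarrow> mapply q (\<lambda>i l. s i l * A i l) x i = mapply q A (\<lambda>l. \<phi> l * x l) i"
      "\<And>i l. i < n \<Longrightarrow> l < q \<Longrightarrow> s i l = \<phi> l"
  using assms unfolding single_index_def
proof (elim disjE exE)
  fix \<phi> assume *: "\<forall>i<n. \<forall>l<q. s i l = \<phi> i"
  show thesis
    by (rule that(1)[of \<phi>]) (use * in \<open>simp_all add: mapply_def sum_distrib_left algebra_simps\<close>)
next
  fix \<phi> assume *: "\<forall>i<n. \<forall>l<q. s i l = \<phi> l"
  show thesis
    by (rule that(2)[of \<phi>]) (use * in \<open>simp_all add: mapply_def algebra_simps\<close>)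
qed

lemma bounded_op_single_index:
  assumes s: "single_index n q s" and nq: "0 < n" "0 < q"
    and M: "\<And>i l. i < n \<Longrightarrow> l < q \<Longrightarrow> cmod (s i l) \<le> M" and A: "bounded_op n q A K"
  shows "bounded_op n q (\<lambda>i l. s i l * A i l) (M * K)"
proof -
  have M0: "0 \<le> M" using M[OF nq] norm_ge_zero order_trans by blast
  have K0: "0 \<le> K" using A by (simp add: bounded_op_def)
  have "vlen n (mapply q (\<lambda>i l. s i l * A i l) x) \<le> M * K * vlen q x" for x
  proof (rule single_index_cases[OF s, of A])
    fix \<phi> assume \<phi>: "\<And>x i. i < n \<Longrightarrow> mapply q (\<lambda>i l. s i l * A i l) x i = \<phi> i * mapply q A x i"
      "\<And>i l. i < n \<Longrightarrow> l < q \<Longrightarrow> s i l = \<phi> i"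
    have "vlen n (mapply q (\<lambda>i l. s i l * A i l) x) = vlen n (\<lambda>i. \<phi> i * mapply q A x i)"
      by (rule vlen_cong) (rule \<phi>(1))
    also have "\<dots> \<le> \<bar>M\<bar> * vlen n (mapply q A x)"
      by (rule vlen_diag_le) (metis M \<phi>(2) nq(2))
    also have "\<dots> \<le> \<bar>M\<bar> * (K * vlen q x)"
      by (intro mult_left_mono bounded_opD[OF A]) simp
    finally show ?thesis using M0 by (simp add: mult.assoc)
  next
    fix \<phi> assume \<phi>: "\<And>x i. i < n \<Longrightarrow> mapply q (\<lambda>i l. s i l * A i l) x i
        = mapply q A (\<lambda>l. \<phi> l * x l) i"
      "\<And>i l. i < n \<Longrightarrow> l < q \<Longrightarrow> s i l = \<phi> l"
    have "vlen n (mapply q (\<lambda>i l. s i l * A i l) x) = vlen n (mapply q A (\<lambda>l. \<phi> l * x l))"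
      by (rule vlen_cong) (rule \<phi>(1))
    also have "\<dots> \<le> K * vlen q (\<lambda>l. \<phi> l * x l)"
      by (rule bounded_opD[OF A])
    also have "\<dots> \<le> K * (\<bar>M\<bar> * vlen q x)"
      by (intro mult_left_mono vlen_diag_le K0) (metis M \<phi>(2) nq(1))
    finally show ?thesis using M0 by (simp add: algebra_simps)
  qed
  then show ?thesis using M0 K0 by (simp add: bounded_op_def)
qed

lemma coercive_single_index:
  assumes s: "single_index n q s" and nq: "0 < n" "0 < q" and m: "0 \<le> m"
    and M: "\<And>i l. i < n \<Longrightarrow> l < q \<Longrightarrow> m \<le> cmod (s i l)"
    and c: "0 \<le> c" and A: "\<And>w. c * (vlen q w)\<^sup>2 \<le> (vlen n (mapply q A w))\<^sup>2"
  shows "m\<^sup>2 * c * (vlen q w)\<^sup>2 \<le> (vlen n (mapply q (\<lambda>i l. s i l * A i l) w))\<^sup>2"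
proof (rule single_index_cases[OF s, of A])
  fix \<phi> assume \<phi>: "\<And>x i. i < n \<Longrightarrow> mapply q (\<lambda>i l. s i l * A i l) x i = \<phi> i * mapply q A x i"
    "\<And>i l. i < n \<Longrightarrow> l < q \<Longrightarrow> s i l = \<phi> i"
  have "m\<^sup>2 * (c * (vlen q w)\<^sup>2) \<le> m\<^sup>2 * (vlen n (mapply q A w))\<^sup>2"
    by (intro mult_left_mono A) simp
  also have "\<dots> = (m * vlen n (mapply q A w))\<^sup>2" by (simp add: power_mult_distrib)
  also have "\<dots> \<le> (vlen n (\<lambda>i. \<phi> i * mapply q A w i))\<^sup>2"
  proof (rule power_mono)
    show "m * vlen n (mapply q A w) \<le> vlen n (\<lambda>i. \<phi> i * mapply q A w i)"
      by (rule vlen_diag_ge[OF m]) (metis M \<phi>(2) nq(2))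
  qed (use m in simp)
  also have "vlen n (\<lambda>i. \<phi> i * mapply q A w i) = vlen n (mapply q (\<lambda>i l. s i l * A i l) w)"
    by (rule vlen_cong) (rule \<phi>(1)[symmetric])
  finally show ?thesis by (simp add: mult.assoc)
next
  fix \<phi> assume \<phi>: "\<And>x i. i < n \<Longrightarrow> mapply q (\<lambda>i l. s i l * A i l) x i = mapply q A (\<lambda>l. \<phi> l * x l) i"
    "\<And>i l. i < n \<Longrightarrow> l < q \<Longrightarrow> s i l = \<phi> l"
  have "m * vlen q w \<le> vlen q (\<lambda>l. \<phi> l * w l)"
    by (rule vlen_diag_ge[OF m]) (metis M \<phi>(2) nq(1))
  then have "c * (m * vlen q w)\<^sup>2 \<le> c * (vlen q (\<lambda>l. \<phi> l * w l))\<^sup>2"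
    using m c by (intro mult_left_mono power_mono) auto
  also have "\<dots> \<le> (vlen n (mapply q A (\<lambda>l. \<phi> l * w l)))\<^sup>2" by (rule A)
  also have "vlen n (mapply q A (\<lambda>l. \<phi> l * w l)) = vlen n (mapply q (\<lambda>i l. s i l * A i l) w)"
    by (rule vlen_cong) (rule \<phi>(1)[symmetric])
  finally show ?thesis by (simp add: power_mult_distrib algebra_simps)
qed

lemma mapply_mat: "x \<in> carrier_vec m \<Longrightarrow> A \<in> carrier_mat n m \<Longrightarrow> i < n \<Longrightarrow>
    (A *\<^sub>v x) $ i = mapply m (\<lambda>i j. A $$ (i, j)) (\<lambda>j. x $ j) i"
  by (auto simp: mapply_def scalar_prod_def atLeast0LessThan intro!: sum.cong)

section \<open>Rayleigh quotients of Hermitian matrices\<close>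

text \<open>
  The form is nonnegative at \<open>x - T x / K\<close>; expanding it there gives the claim.
\<close>

lemma psd_image_bound:
  assumes herm: "herm n T" and K: "0 < K"
    and psd: "\<And>x. 0 \<le> Re (dotp n (mapply n T x) x)"
    and le: "\<And>x. Re (dotp n (mapply n T x) x) \<le> K * (vlen n x)\<^sup>2"
  shows "(vlen n (mapply n T x))\<^sup>2 \<le> K * Re (dotp n (mapply n T x) x)"
proof -
  define y where "y = mapply n T x"
  define c where "c = complex_of_real (1 / K)"
  have "dotp n (mapply n T y) x = dotp n y y"
    by (simp add: herm_dotp[OF herm] y_def)
  moreover have "dotp n (mapply n T x) y = dotp n y y"
    by (simp add: y_def)
  moreover have "cnj c = c"
    by (simp add: c_def)
  ultimately have "dotp n (mapply n T (\<lambda>i. x i - c * y i)) (\<lambda>i. x i - c * y i) =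
      dotp n y x - 2 * c * dotp n y y + c\<^sup>2 * dotp n (mapply n T y) y"
    by (simp add: mapply_diff mapply_scale dotp_diff_left dotp_diff_right dotp_scale_left
        dotp_scale_right y_def[symmetric] power2_eq_square algebra_simps)
  then have "Re (dotp n (mapply n T (\<lambda>i. x i - c * y i)) (\<lambda>i. x i - c * y i)) =
      Re (dotp n y x) - 2 / K * (vlen n y)\<^sup>2 + (1 / K)\<^sup>2 * Re (dotp n (mapply n T y) y)"
    by (simp add: dotp_self c_def power2_eq_square flip: of_real_power of_real_mult)
  also have "\<dots> \<le> Re (dotp n y x) - 2 / K * (vlen n y)\<^sup>2 + (1 / K)\<^sup>2 * (K * (vlen n y)\<^sup>2)"
    by (intro add_left_mono mult_left_mono le) simp
  also have "\<dots> = Re (dotp n y x) - (vlen n y)\<^sup>2 / K"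
    using K by (simp add: power2_eq_square field_simps)
  finally have "(vlen n y)\<^sup>2 / K \<le> Re (dotp n y x)"
    using psd[of "\<lambda>i. x i - c * y i"] by linarith
  then show ?thesis
    using K by (simp add: y_def field_simps)
qed

text \<open>
  The constant is a norm bound of the inverse matrix.
\<close>

lemma injective_bounded_below:
  assumes inj: "\<And>x. \<forall>i<n. mapply n T x i = 0 \<Longrightarrow> \<forall>i<n. x i = 0"
  shows "\<exists>\<kappa>>0. \<forall>x. vlen n x \<le> \<kappa> * vlen n (mapply n T x)"
proof -
  define TT where "TT = mat n n (\<lambda>(i, j). T i j)"
  have TT: "TT \<in> carrier_mat n n" by (simp add: TT_def)
  have TTx: "(TT *\<^sub>v x) $ i = mapply n T (\<lambda>j. x $ j) i" if "x \<in> carrier_vec n" "i < n" for x i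
    using mapply_mat[OF that(1) TT that(2)] that(2) by (simp add: TT_def mapply_def)
  have "det TT \<noteq> 0"
  proof
    assume "det TT = 0"
    then obtain v where v: "v \<in> carrier_vec n" "v \<noteq> 0\<^sub>v n" "TT *\<^sub>v v = 0\<^sub>v n"
      using TT det_0_iff_vec_prod_zero[of TT n] by auto
    have "\<forall>i<n. mapply n T (\<lambda>j. v $ j) i = 0"
      using TTx[OF v(1)] v(3) by simp
    from inj[OF this] have "v = 0\<^sub>v n"
      using v(1) by (intro eq_vecI) auto
    with v(2) show False by simp
  qed
  then have "TT \<in> Units (ring_mat TYPE(complex) n ())"
    by (rule det_non_zero_imp_unit[OF TT])
  then obtain N where N: "N \<in> carrier_mat n n" "N * TT = 1\<^sub>m n"
    by (auto simp: Units_def ring_mat_def)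
  define F where "F = (\<lambda>i j. N $$ (i, j))"
  obtain K where K: "bounded_op n n F K"
    using bounded_op_exists by blast
  have "vlen n x \<le> (K + 1) * vlen n (mapply n T x)" for x
  proof -
    let ?x = "vec n x"
    have y: "TT *\<^sub>v ?x \<in> carrier_vec n" using TT by simp
    have "N *\<^sub>v (TT *\<^sub>v ?x) = ?x"
      using assoc_mult_mat_vec[OF N(1) TT, of ?x] N(2) by simp
    then have "x i = mapply n F (mapply n T x) i" if "i < n" for i
    proof -
      have "x i = (N *\<^sub>v (TT *\<^sub>v ?x)) $ i"
        using \<open>N *\<^sub>v (TT *\<^sub>v ?x) = ?x\<close> that by simp
      also have "\<dots> = mapply n F (\<lambda>j. (TT *\<^sub>v ?x) $ j) i"
        unfolding F_def by (rule mapply_mat[OF y N(1) that])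
      also have "\<dots> = mapply n F (mapply n T x) i"
        unfolding mapply_def[of n F]
        by (intro sum.cong refl) (simp add: TTx, simp add: mapply_def)
      finally show ?thesis .
    qed
    then have "vlen n x = vlen n (mapply n F (mapply n T x))"
      by (rule vlen_cong)
    also have "\<dots> \<le> K * vlen n (mapply n T x)"
      by (rule bounded_opD[OF K])
    finally show ?thesis
      using vlen_nonneg[of n "mapply n T x"] unfolding distrib_right by linarith
  qed
  moreover have "0 < K + 1"
    using K by (simp add: bounded_op_def add_nonneg_pos)
  ultimately show ?thesis by blast
qed

text \<open>
  The spectral theorem and compactness are avoided as follows.  Let \<open>M\<close> be the supremum of the
  Rayleigh quotients.  If \<open>M\<close> exceeds \<open>\<Lambda>\<close>, it is not an eigenvalue, so the positive semidefinite matrix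
  \<open>T = M - H\<close> is bounded below.  By \<open>psd_image_bound\<close> its quadratic form is then bounded below on the
  unit sphere by a positive constant, and no Rayleigh quotient of \<open>H\<close> comes close to \<open>M\<close>.
\<close>

lemma Rayleigh_le_of_eigenvalues_le:
  assumes herm: "herm n H"
    and ev: "\<And>\<mu> x. \<Lambda> < \<mu> \<Longrightarrow> \<forall>i<n. mapply n H x i = complex_of_real \<mu> * x i \<Longrightarrow> \<forall>i<n. x i = 0"
  shows "Re (dotp n (mapply n H x) x) \<le> \<Lambda> * (vlen n x)\<^sup>2"
proof (rule ccontr)
  define R where "R = (\<lambda>x. Re (dotp n (mapply n H x) x))"
  define S where "S = {R x |x. vlen n x = 1}"
  assume "\<not> Re (dotp n (mapply n H x) x) \<le> \<Lambda> * (vlen n x)\<^sup>2"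
  then have x: "\<Lambda> * (vlen n x)\<^sup>2 < R x" by (simp add: R_def)
  have scale: "R (\<lambda>i. complex_of_real c * y i) = c\<^sup>2 * R y" for c y
    by (simp add: R_def mapply_scale dotp_scale_left dotp_scale_right power2_eq_square)
  have null: "R y = 0" if "vlen n y = 0" for y
    using that by (simp add: R_def vlen_eq_0_iff dotp_def)
  obtain K where K: "bounded_op n n H K" using bounded_op_exists by blast
  have R_le: "\<bar>R y\<bar> \<le> K * (vlen n y)\<^sup>2" for y
  proof -
    have "\<bar>R y\<bar> \<le> vlen n (mapply n H y) * vlen n y"
      unfolding R_def by (rule order_trans[OF abs_Re_le_cmod Cauchy_Schwarz_dotp])
    also have "\<dots> \<le> K * vlen n y * vlen n y"
      by (intro mult_right_mono bounded_opD[OF K]) simp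
    finally show ?thesis by (simp add: power2_eq_square)
  qed
  have bdd: "bdd_above S"
  proof (rule bdd_aboveI[of _ K])
    fix r assume "r \<in> S"
    then obtain y where "r = R y" "vlen n y = 1" by (auto simp: S_def)
    with R_le[of y] show "r \<le> K" by simp
  qed
  define M where "M = Sup S"
  have R_le_M: "R y \<le> M * (vlen n y)\<^sup>2" for y
  proof (cases "vlen n y = 0")
    case False
    define c where "c = 1 / vlen n y"
    have "vlen n (\<lambda>i. complex_of_real c * y i) = 1"
      unfolding vlen_scale c_def norm_of_real using False by simp
    then have "c\<^sup>2 * R y \<in> S"
      unfolding S_def scale[symmetric] by blast
    then have "c\<^sup>2 * R y \<le> M"
      unfolding M_def by (rule cSup_upper[OF _ bdd])
    moreover have "0 < (vlen n y)\<^sup>2" using False by simp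
    ultimately show ?thesis
      by (simp add: c_def power_divide pos_divide_le_eq)
  qed (simp add: null)
  have "\<Lambda> < M"
  proof -
    have "\<Lambda> * (vlen n x)\<^sup>2 < M * (vlen n x)\<^sup>2"
      using x R_le_M[of x] by linarith
    then show ?thesis
      by (simp add: mult_less_cancel_right)
  qed
  define T where "T = (\<lambda>i j. (if i = j then complex_of_real M else 0) - H i j)"
  have Tx: "mapply n T y i = complex_of_real M * y i - mapply n H y i" if "i < n" for y i
  proof -
    have "mapply n T y i = (\<Sum>j<n. (if i = j then complex_of_real M * y j else 0) - H i j * y j)"
      unfolding mapply_def by (intro sum.cong refl) (simp add: T_def algebra_simps)
    then show ?thesis
      using that by (simp add: sum_subtractf mapply_def)
  qed
  have hermT: "herm n T"
    using herm by (auto simp: herm_def T_def)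
  have quadT: "Re (dotp n (mapply n T y) y) = M * (vlen n y)\<^sup>2 - R y" for y
  proof -
    have "dotp n (mapply n T y) y = dotp n (\<lambda>i. complex_of_real M * y i - mapply n H y i) y"
      by (rule dotp_cong) (simp_all add: Tx)
    then show ?thesis
      by (simp add: dotp_diff_left dotp_scale_left dotp_self R_def flip: of_real_power of_real_mult)
  qed
  have "\<exists>\<kappa>>0. \<forall>x. vlen n x \<le> \<kappa> * vlen n (mapply n T x)"
  proof (rule injective_bounded_below)
    fix y assume "\<forall>i<n. mapply n T y i = 0"
    then have "\<forall>i<n. mapply n H y i = complex_of_real M * y i"
      by (simp add: Tx)
    then show "\<forall>i<n. y i = 0"
      by (rule ev[OF \<open>\<Lambda> < M\<close>])
  qed
  then obtain \<kappa> where \<kappa>: "0 < \<kappa>" "\<And>y. vlen n y \<le> \<kappa> * vlen n (mapply n T y)" by blast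
  define K' where "K' = \<bar>M\<bar> + K + 1"
  have K'0: "0 < K'" using K by (simp add: K'_def bounded_op_def add_nonneg_pos)
  have T_le: "(vlen n (mapply n T y))\<^sup>2 \<le> K' * Re (dotp n (mapply n T y) y)" for y
  proof (rule psd_image_bound[OF hermT K'0])
    fix y
    show "0 \<le> Re (dotp n (mapply n T y) y)"
      using R_le_M[of y] by (simp add: quadT)
    have "M * (vlen n y)\<^sup>2 \<le> \<bar>M\<bar> * (vlen n y)\<^sup>2"
      by (intro mult_right_mono) auto
    then show "Re (dotp n (mapply n T y) y) \<le> K' * (vlen n y)\<^sup>2"
      using R_le[of y] zero_le_power2[of "vlen n y"] unfolding quadT K'_def distrib_right
          by linarith
  qed
  have "Sup S \<le> M - 1 / (\<kappa>\<^sup>2 * K')"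
  proof (rule cSup_least)
    have "vlen n x \<noteq> 0" using x null[of x] by auto
    then have "vlen n (\<lambda>i. complex_of_real (1 / vlen n x) * x i) = 1"
      by (simp add: vlen_scale del: of_real_divide)
    then show "S \<noteq> {}" unfolding S_def by blast
    fix r assume "r \<in> S"
    then obtain y where y: "r = R y" "vlen n y = 1" by (auto simp: S_def)
    \<comment> \<open>The lower bound of \<open>T\<close> on the unit vector \<open>y\<close> is squared and combined with \<open>psd_image_bound\<close>.\<close>
    have "1 \<le> (\<kappa> * vlen n (mapply n T y))\<^sup>2"
      using \<kappa>(2)[of y] y(2) by (simp add: one_le_power)
    also have "\<dots> \<le> \<kappa>\<^sup>2 * (K' * (M - r))"
      unfolding power_mult_distrib using T_le[of y] y
      by (intro mult_left_mono) (simp_all add: quadT)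
    finally show "r \<le> M - 1 / (\<kappa>\<^sup>2 * K')"
      using \<kappa>(1) K'0 by (simp add: field_simps)
  qed
  moreover have "0 < 1 / (\<kappa>\<^sup>2 * K')" using \<kappa>(1) K'0 by simp
  ultimately show False unfolding M_def by linarith
qed

text \<open>
  The bound \<open>psd_image_bound\<close> for \<open>H + r\<close> gives \<open>\<parallel>H + r\<parallel> \<le> 2 * r\<close>; the loss of a factor \<open>3\<close> is
  harmless.
\<close>

lemma bounded_op_of_Rayleigh:
  assumes herm: "herm n H" and r: "0 < r"
    and R: "\<And>x. \<bar>Re (dotp n (mapply n H x) x)\<bar> \<le> r * (vlen n x)\<^sup>2"
  shows "bounded_op n n H (3 * r)"
proof -
  define T where "T = (\<lambda>i j. (if i = j then complex_of_real r else 0) + H i j)"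
  have Tx: "mapply n T y i = complex_of_real r * y i + mapply n H y i" if "i < n" for y i
  proof -
    have "mapply n T y i = (\<Sum>j<n. (if i = j then complex_of_real r * y j else 0) + H i j * y j)"
      unfolding mapply_def by (intro sum.cong refl) (simp add: T_def algebra_simps)
    then show ?thesis
      using that by (simp add: sum.distrib mapply_def)
  qed
  have hermT: "herm n T"
    using herm by (auto simp: herm_def T_def)
  have quadT: "Re (dotp n (mapply n T y) y) = r * (vlen n y)\<^sup>2 + Re (dotp n (mapply n H y) y)" for y
  proof -
    have "dotp n (mapply n T y) y = dotp n (\<lambda>i. complex_of_real r * y i + mapply n H y i) y"
      by (rule dotp_cong) (simp_all add: Tx)
    then show ?thesis
      by (simp add: dotp_add_left dotp_scale_left dotp_self flip: of_real_power of_real_mult)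
  qed
  have le: "Re (dotp n (mapply n T y) y) \<le> 2 * r * (vlen n y)\<^sup>2" for y
    using R[of y] by (simp add: quadT)
  have "vlen n (mapply n H y) \<le> 3 * r * vlen n y" for y
  proof -
    have "(vlen n (mapply n T y))\<^sup>2 \<le> 2 * r * Re (dotp n (mapply n T y) y)"
    proof (rule psd_image_bound[OF hermT _ _ le])
      show "0 \<le> Re (dotp n (mapply n T y) y)" for y
        using R[of y] by (simp add: quadT)
    qed (use r in simp)
    also have "\<dots> \<le> 2 * r * (2 * r * (vlen n y)\<^sup>2)"
      using r by (intro mult_left_mono le) simp
    also have "\<dots> = (2 * r * vlen n y)\<^sup>2" by (simp add: power2_eq_square)
    finally have T: "vlen n (mapply n T y) \<le> 2 * r * vlen n y"
      by (rule power2_le_imp_le) (use r in simp)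
    have "vlen n (mapply n H y) = vlen n (\<lambda>i. mapply n T y i - complex_of_real r * y i)"
      by (rule vlen_cong) (simp add: Tx)
    also have "\<dots> \<le> vlen n (mapply n T y) + r * vlen n y"
      using vlen_triangle_diff[of n "mapply n T y" "\<lambda>i. complex_of_real r * y i"] r
      by (simp add: vlen_scale)
    finally show ?thesis using T by simp
  qed
  then show ?thesis using r by (simp add: bounded_op_def)
qed

section \<open>Perturbation of eigenprojections\<close>

definition orthonormal :: "nat \<Rightarrow> (nat \<Rightarrow> nat \<Rightarrow> complex) \<Rightarrow> bool" where
  "orthonormal n v \<longleftrightarrow> (\<forall>j<n. \<forall>k<n. dotp n (v j) (v k) = (if j = k then 1 else 0))"

text \<open>
  The matrix with columns \<open>v k\<close> has its adjoint as a left inverse, hence also as a right inverse.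
\<close>

lemma orthonormal_complete:
  assumes v: "orthonormal n v" and "i < n" "m < n"
  shows "(\<Sum>k<n. v k i * cnj (v k m)) = (if i = m then 1 else 0)"
proof -
  define U where "U = mat n n (\<lambda>(i, k). v k i)"
  define W where "W = mat n n (\<lambda>(k, i). cnj (v k i))"
  have carr: "U \<in> carrier_mat n n" "W \<in> carrier_mat n n" by (simp_all add: U_def W_def)
  have "W * U = 1\<^sub>m n"
  proof (intro eq_matI)
    fix k j assume "k < dim_row (1\<^sub>m n)" "j < dim_col (1\<^sub>m n)"
    then have kj: "k < n" "j < n" by auto
    have "(W * U) $$ (k, j) = dotp n (v j) (v k)"
      using kj by (simp add: U_def W_def scalar_prod_def dotp_def atLeast0LessThan mult.commute)
    then show "(W * U) $$ (k, j) = 1\<^sub>m n $$ (k, j)"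
      using v kj by (simp add: orthonormal_def)
  qed (use carr in auto)
  then have "U * W = 1\<^sub>m n"
    using mat_mult_left_right_inverse[OF carr(2,1)] by simp
  then have "(U * W) $$ (i, m) = 1\<^sub>m n $$ (i, m)" by simp
  then show ?thesis
    using assms(2,3) by (simp add: U_def W_def scalar_prod_def atLeast0LessThan)
qed

lemma orthonormal_expansion:
  assumes v: "orthonormal n v" and i: "i < n"
  shows "x i = (\<Sum>k<n. dotp n x (v k) * v k i)"
proof -
  have "(\<Sum>k<n. dotp n x (v k) * v k i) = (\<Sum>k<n. \<Sum>m<n. x m * (v k i * cnj (v k m)))"
    by (simp add: dotp_def sum_distrib_right sum_distrib_left algebra_simps)
  also have "\<dots> = (\<Sum>m<n. x m * (\<Sum>k<n. v k i * cnj (v k m)))"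
    unfolding sum_distrib_left by (rule sum.swap)
  also have "\<dots> = (\<Sum>m<n. x m * (if i = m then 1 else 0))"
    using orthonormal_complete[OF v i] by simp
  also have "\<dots> = x i" using i by (simp add: if_distrib cong: if_cong)
  finally show ?thesis by simp
qed

lemma dotp_orthonormal:
  assumes "orthonormal n v"
  shows "dotp n x y = (\<Sum>k<n. dotp n x (v k) * dotp n (v k) y)"
proof -
  have "dotp n x y = dotp n (\<lambda>i. \<Sum>k<n. dotp n x (v k) * v k i) y"
    using orthonormal_expansion[OF assms] by (intro dotp_cong) auto
  then show ?thesis by (simp add: dotp_sum_left dotp_scale_left)
qed

lemma Parseval:
  assumes "orthonormal n v"
  shows "(vlen n x)\<^sup>2 = (\<Sum>k<n. (cmod (dotp n x (v k)))\<^sup>2)"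
proof -
  have "complex_of_real ((vlen n x)\<^sup>2) = (\<Sum>k<n. dotp n x (v k) * cnj (dotp n x (v k)))"
    unfolding dotp_self[symmetric] dotp_orthonormal[OF assms, of x x] by (simp add: dotp_cnj)
  also have "\<dots> = complex_of_real (\<Sum>k<n. (cmod (dotp n x (v k)))\<^sup>2)"
    unfolding of_real_sum complex_norm_square ..
  finally show ?thesis by (simp only: of_real_eq_iff)
qed

definition eigenbasis :: "nat \<Rightarrow> (nat \<Rightarrow> nat \<Rightarrow> complex) \<Rightarrow> (nat \<Rightarrow> real) \<Rightarrow> (nat \<Rightarrow> nat \<Rightarrow> complex) \<Rightarrow>
    bool" where
  "eigenbasis n A lam v \<longleftrightarrow> herm n A \<and> orthonormal n v \<and>
     (\<forall>j<n. \<forall>i<n. mapply n A (v j) i = complex_of_real (lam j) * v j i) \<and>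
     (\<forall>j k. j \<le> k \<and> k < n \<longrightarrow> lam k \<le> lam j)"

lemma dotp_eigenvector:
  assumes "eigenbasis n A lam v" "k < n"
  shows "dotp n (mapply n A x) (v k) = complex_of_real (lam k) * dotp n x (v k)"
proof -
  have "dotp n (mapply n A x) (v k) = dotp n x (mapply n A (v k))"
    using assms by (simp add: herm_dotp eigenbasis_def)
  also have "\<dots> = dotp n x (\<lambda>i. complex_of_real (lam k) * v k i)"
    using assms by (intro dotp_cong) (auto simp: eigenbasis_def)
  finally show ?thesis by (simp add: dotp_scale_right)
qed

lemma quadratic_form_eigenbasis:
  assumes "eigenbasis n A lam v"
  shows "Re (dotp n (mapply n A x) x) = (\<Sum>k<n. lam k * (cmod (dotp n x (v k)))\<^sup>2)"
proof -
  have on: "orthonormal n v" using assms by (simp add: eigenbasis_def)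
  have "dotp n (mapply n A x) x = (\<Sum>k<n. complex_of_real (lam k) * (dotp n x (v k) * cnj (dotp n x
      (v k))))"
    unfolding dotp_orthonormal[OF on, of "mapply n A x" x]
    by (simp add: dotp_eigenvector[OF assms] dotp_cnj algebra_simps)
  also have "\<dots> = complex_of_real (\<Sum>k<n. lam k * (cmod (dotp n x (v k)))\<^sup>2)"
    unfolding of_real_sum of_real_mult complex_norm_square ..
  finally show ?thesis by simp
qed

lemma eigenbasis_scale:
  assumes "eigenbasis n A lam v" "0 \<le> c"
  shows "eigenbasis n (\<lambda>i j. complex_of_real c * A i j) (\<lambda>j. c * lam j) v"
proof -
  have "mapply n (\<lambda>i j. complex_of_real c * A i j) x i = complex_of_real c * mapply n A x i" for x i
    by (simp add: mapply_def sum_distrib_left algebra_simps)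
  then show ?thesis
    using assms by (auto simp: eigenbasis_def herm_def mult_left_mono)
qed

text \<open>
  Zero rows complete the system to a square one with vanishing determinant.
\<close>

lemma homogeneous_system_nontrivial:
  fixes A :: "nat \<Rightarrow> nat \<Rightarrow> complex"
  assumes "k < m"
  shows "\<exists>x. (\<exists>l<m. x l \<noteq> 0) \<and> (\<forall>i<k. mapply m A x i = 0)"
proof -
  define T where "T = mat m m (\<lambda>(i, j). if i < k then A i j else 0)"
  have T: "T \<in> carrier_mat m m" by (simp add: T_def)
  have "transpose_mat T *\<^sub>v unit_vec m k = 0\<^sub>v m"
    using assms by (intro eq_vecI) (auto simp: T_def)
  moreover have "unit_vec m k \<noteq> (0\<^sub>v m :: complex vec)"
    using assms by (metis index_unit_vec(1) index_zero_vec(1) zero_neq_one)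
  ultimately have "det (transpose_mat T) = 0"
    using det_0_iff_vec_prod_zero[of "transpose_mat T" m] T unit_vec_carrier[of m k]
    by (metis transpose_carrier_mat)
  then have "det T = 0"
    using det_transpose[OF T] by simp
  then obtain v where v: "v \<in> carrier_vec m" "v \<noteq> 0\<^sub>v m" "T *\<^sub>v v = 0\<^sub>v m"
    using T det_0_iff_vec_prod_zero[of T m] by auto
  have "\<exists>l<m. v $ l \<noteq> 0"
    using v(1,2) by (metis carrier_vecD eq_vecI index_zero_vec)
  moreover have "mapply m A (\<lambda>j. v $ j) i = 0" if "i < k" for i
  proof -
    have "mapply m A (\<lambda>j. v $ j) i = mapply m (\<lambda>i j. T $$ (i, j)) (\<lambda>j. v $ j) i"
      using that assms by (simp add: mapply_def T_def)
    also have "\<dots> = (T *\<^sub>v v) $ i"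
      using mapply_mat[OF v(1) T] that assms by simp
    finally show ?thesis
      using v(3) that assms by simp
  qed
  ultimately show ?thesis by auto
qed

text \<open>
  One half of the Courant-Fischer principle.  The range of \<open>L\<close> has dimension \<open>q\<close> and so contains a
  nonzero vector \<open>x\<close> orthogonal to the first \<open>q - 1\<close> eigenvectors, on which the form is at most
  \<open>lam (q - 1) * \<parallel>x\<parallel>\<^sup>2\<close>.  On the range of \<open>L\<close>, coercivity of \<open>L\<close> gives \<open>\<parallel>L\<^sup>* x\<parallel>\<^sup>2 \<ge> c \<parallel>x\<parallel>\<^sup>2\<close>.
\<close>

lemma eigenvalue_lower_bound:
  assumes eb: "eigenbasis n A lam v" and q: "0 < q" "q \<le> n" and c: "0 < c"
    and L: "\<And>w. c * (vlen q w)\<^sup>2 \<le> (vlen n (mapply q L w))\<^sup>2"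
    and A: "\<And>x. (vlen q (mapply n (adjm L) x))\<^sup>2 - r * (vlen n x)\<^sup>2 \<le> Re (dotp n (mapply n A x) x)"
  shows "c - r \<le> lam (q - 1)"
proof -
  have on: "orthonormal n v" using eb by (simp add: eigenbasis_def)
  obtain w where w: "\<exists>l<q. w l \<noteq> 0"
    "\<And>k. k < q - 1 \<Longrightarrow> mapply q (\<lambda>k l. dotp n (\<lambda>m. L m l) (v k)) w k = 0"
    using homogeneous_system_nontrivial[of "q - 1" q "\<lambda>k l. dotp n (\<lambda>m. L m l) (v k)"] q
    by (auto simp del: One_nat_def)
  define x where "x = mapply q L w"
  have x0: "dotp n x (v k) = 0" if "k < q - 1" for k
  proof -
    have "dotp n x (v k) = (\<Sum>l<q. dotp n (\<lambda>m. w l * L m l) (v k))"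
      unfolding x_def mapply_def dotp_sum_left[symmetric] by (simp add: mult.commute)
    also have "\<dots> = mapply q (\<lambda>k l. dotp n (\<lambda>m. L m l) (v k)) w k"
      by (simp add: mapply_def dotp_scale_left mult.commute)
    finally show ?thesis using w(2)[OF that] by simp
  qed
  have wpos: "0 < (vlen q w)\<^sup>2"
    using w(1) vlen_eq_0_iff[of q w] by auto
  then have xpos: "0 < (vlen n x)\<^sup>2"
    using L[of w] c unfolding x_def by (metis mult_pos_pos order_less_le_trans)
  have Lx: "c * (vlen n x)\<^sup>2 \<le> (vlen q (mapply n (adjm L) x))\<^sup>2"
  proof -
    let ?a = "(vlen q (mapply n (adjm L) x))\<^sup>2"
    have "(vlen n x)\<^sup>2 = cmod (dotp n (mapply q L w) x)"
      unfolding x_def[symmetric] dotp_self norm_of_real by simp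
    also have "\<dots> \<le> vlen q w * vlen q (mapply n (adjm L) x)"
      unfolding mapply_adjm by (rule Cauchy_Schwarz_dotp)
    finally have "((vlen n x)\<^sup>2)\<^sup>2 \<le> (vlen q w * vlen q (mapply n (adjm L) x))\<^sup>2"
      by (intro power_mono) simp_all
    then have "c * ((vlen n x)\<^sup>2 * (vlen n x)\<^sup>2) \<le> (c * (vlen q w)\<^sup>2) * ?a"
      using c by (simp add: power_mult_distrib power2_eq_square[of "(vlen n x)\<^sup>2"])
    also have "\<dots> \<le> (vlen n x)\<^sup>2 * ?a"
      using L[of w] unfolding x_def by (rule mult_right_mono) simp
    finally have "(vlen n x)\<^sup>2 * (c * (vlen n x)\<^sup>2) \<le> (vlen n x)\<^sup>2 * ?a"
      by (simp add: algebra_simps)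
    then show ?thesis using xpos by (simp only: mult_le_cancel_left_pos)
  qed
  have "(c - r) * (vlen n x)\<^sup>2 \<le> Re (dotp n (mapply n A x) x)"
    using Lx A[of x] unfolding left_diff_distrib by linarith
  also have "\<dots> \<le> (\<Sum>k<n. lam (q - 1) * (cmod (dotp n x (v k)))\<^sup>2)"
    unfolding quadratic_form_eigenbasis[OF eb]
  proof (rule sum_mono)
    fix k assume k: "k \<in> {..<n}"
    show "lam k * (cmod (dotp n x (v k)))\<^sup>2 \<le> lam (q - 1) * (cmod (dotp n x (v k)))\<^sup>2"
    proof (cases "k < q - 1")
      case False
      then have "lam k \<le> lam (q - 1)" using eb k by (auto simp: eigenbasis_def)
      then show ?thesis by (intro mult_right_mono) auto
    qed (simp add: x0)
  qed
  also have "\<dots> = lam (q - 1) * (vlen n x)\<^sup>2"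
    unfolding Parseval[OF on, of x] sum_distrib_left ..
  finally show ?thesis using xpos by (simp only: mult_le_cancel_right_pos)
qed

text \<open>
  The other half: some nonzero combination of the first \<open>q + 1\<close> eigenvectors is annihilated by the
  \<open>q\<close> rows of \<open>L\<^sup>*\<close>.
\<close>

lemma eigenvalue_upper_bound:
  assumes eb: "eigenbasis n A lam v" and q: "q < n"
    and A: "\<And>x. \<forall>l<q. mapply n (adjm L) x l = 0 \<Longrightarrow> Re (dotp n (mapply n A x) x) \<le> r * (vlen n x)\<^sup>2"
  shows "lam q \<le> r"
proof -
  have on: "orthonormal n v" using eb by (simp add: eigenbasis_def)
  obtain a where a: "\<exists>j<Suc q. a j \<noteq> 0"
    "\<And>l. l < q \<Longrightarrow> mapply (Suc q) (\<lambda>l j. mapply n (adjm L) (v j) l) a l = 0"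
    using homogeneous_system_nontrivial[of q "Suc q" "\<lambda>l j. mapply n (adjm L) (v j) l"] by blast
  define x where "x = (\<lambda>i. \<Sum>j<Suc q. a j * v j i)"
  have Lx: "mapply n (adjm L) x l = mapply (Suc q) (\<lambda>l j. mapply n (adjm L) (v j) l) a l" for l
    unfolding x_def mapply_def sum_distrib_left sum_distrib_right
    by (subst sum.swap) (simp add: algebra_simps)
  have xv: "dotp n x (v k) = (if k < Suc q then a k else 0)" if "k < n" for k
  proof -
    have "dotp n x (v k) = (\<Sum>j<Suc q. a j * dotp n (v j) (v k))"
      unfolding x_def dotp_sum_left dotp_scale_left ..
    also have "\<dots> = (\<Sum>j<Suc q. if j = k then a j else 0)"
      using on q that by (intro sum.cong refl) (auto simp: orthonormal_def)
    also have "\<dots> = (if k < Suc q then a k else 0)"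
      by (subst sum.delta) auto
    finally show ?thesis .
  qed
  have "vlen n x \<noteq> 0"
  proof
    assume "vlen n x = 0"
    then have "dotp n x (v k) = 0" for k by (simp add: vlen_eq_0_iff dotp_def)
    with xv a(1) q show False by (metis less_le_trans Suc_leI)
  qed
  then have xpos: "0 < (vlen n x)\<^sup>2" by simp
  have "lam q * (vlen n x)\<^sup>2 = (\<Sum>k<n. lam q * (cmod (dotp n x (v k)))\<^sup>2)"
    unfolding Parseval[OF on, of x] sum_distrib_left ..
  also have "\<dots> \<le> Re (dotp n (mapply n A x) x)"
    unfolding quadratic_form_eigenbasis[OF eb]
  proof (rule sum_mono)
    fix k assume k: "k \<in> {..<n}"
    show "lam q * (cmod (dotp n x (v k)))\<^sup>2 \<le> lam k * (cmod (dotp n x (v k)))\<^sup>2"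
    proof (cases "k < Suc q")
      case True
      then have "lam q \<le> lam k" using eb q by (auto simp: eigenbasis_def)
      then show ?thesis by (intro mult_right_mono) auto
    qed (use k xv in simp)
  qed
  also have "\<dots> \<le> r * (vlen n x)\<^sup>2"
    using a(2) by (intro A) (simp add: Lx)
  finally show ?thesis using xpos by (simp only: mult_le_cancel_right_pos)
qed

text \<open>
  For orthonormal \<open>v\<close>, the matrix of the orthogonal projection on the span of the first \<open>q\<close> vectors.
\<close>

definition eigenproj :: "nat \<Rightarrow> (nat \<Rightarrow> nat \<Rightarrow> complex) \<Rightarrow> nat \<Rightarrow> nat \<Rightarrow> complex" where
  "eigenproj q v i m = (\<Sum>j<q. v j i * cnj (v j m))"

text \<open>
  The Frobenius inner product of two projections is the trace of their product.
\<close>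

lemma Frobenius_eigenproj:
  "(\<Sum>i<n. dotp n (eigenproj q v i) (eigenproj q w i)) =
     complex_of_real (\<Sum>j<q. \<Sum>k<q. (cmod (dotp n (v j) (w k)))\<^sup>2)"
proof -
  have "dotp n (eigenproj q v i) (eigenproj q w i) =
      (\<Sum>j<q. \<Sum>k<q. v j i * cnj (w k i) * cnj (dotp n (v j) (w k)))" for i
  proof -
    have "dotp n (eigenproj q v i) (eigenproj q w i) =
      dotp n (\<lambda>m. \<Sum>j<q. v j i * cnj (v j m)) (\<lambda>m. \<Sum>k<q. w k i * cnj (w k m))"
      by (rule dotp_cong) (simp_all add: eigenproj_def)
    also have "\<dots> = (\<Sum>j<q. \<Sum>k<q. v j i * cnj (w k i) * dotp n (\<lambda>m. cnj (v j m)) (\<lambda>m. cnj (w k m)))"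
      by (simp add: dotp_sum_left dotp_sum_right dotp_scale_left dotp_scale_right sum_distrib_left
          algebra_simps)
    finally show ?thesis by (simp add: dotp_def)
  qed
  then have "(\<Sum>i<n. dotp n (eigenproj q v i) (eigenproj q w i)) =
      (\<Sum>i<n. \<Sum>j<q. \<Sum>k<q. v j i * cnj (w k i) * cnj (dotp n (v j) (w k)))"
    by simp
  also have "\<dots> = (\<Sum>j<q. \<Sum>i<n. \<Sum>k<q. v j i * cnj (w k i) * cnj (dotp n (v j) (w k)))"
    by (rule sum.swap)
  also have "\<dots> = (\<Sum>j<q. \<Sum>k<q. \<Sum>i<n. v j i * cnj (w k i) * cnj (dotp n (v j) (w k)))"
    by (intro sum.cong refl sum.swap)
  also have "\<dots> = (\<Sum>j<q. \<Sum>k<q. dotp n (v j) (w k) * cnj (dotp n (v j) (w k)))"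
    by (simp add: dotp_def[of n "v _"] sum_distrib_right)
  also have "\<dots> = complex_of_real (\<Sum>j<q. \<Sum>k<q. (cmod (dotp n (v j) (w k)))\<^sup>2)"
    unfolding of_real_sum complex_norm_square ..
  finally show ?thesis .
qed

text \<open>
  The conjugate of the \<open>i\<close>-th row is the projection of the \<open>i\<close>-th standard basis vector.
\<close>

lemma vlen_eigenproj_le_1:
  assumes on: "orthonormal n v" and q: "q \<le> n" and i: "i < n"
  shows "vlen n (eigenproj q v i) \<le> 1"
proof -
  have sq: "(vlen n (eigenproj q v i))\<^sup>2 = (\<Sum>j<q. (cmod (v j i))\<^sup>2)"
  proof -
    have "complex_of_real ((vlen n (eigenproj q v i))\<^sup>2) =
      dotp n (\<lambda>m. \<Sum>j<q. v j i * cnj (v j m)) (\<lambda>m. \<Sum>k<q. v k i * cnj (v k m))"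
      unfolding dotp_self[symmetric] by (rule dotp_cong) (simp_all add: eigenproj_def)
    also have "\<dots> = (\<Sum>j<q. \<Sum>k<q. v j i * cnj (v k i) * cnj (dotp n (v j) (v k)))"
      by (simp add: dotp_sum_left dotp_sum_right dotp_scale_left dotp_scale_right sum_distrib_left
          algebra_simps)
         (simp add: dotp_def)
    also have "\<dots> = (\<Sum>j<q. \<Sum>k<q. v j i * cnj (v k i) * (if j = k then 1 else 0))"
      using on q by (intro sum.cong refl) (auto simp: orthonormal_def)
    also have "\<dots> = (\<Sum>j<q. v j i * cnj (v j i))"
      by (simp add: if_distrib cong: if_cong)
    also have "\<dots> = complex_of_real (\<Sum>j<q. (cmod (v j i))\<^sup>2)"
      unfolding of_real_sum complex_norm_square ..
    finally show ?thesis by (simp only: of_real_eq_iff)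
  qed
  also have "\<dots> \<le> (\<Sum>j<n. (cmod (v j i))\<^sup>2)"
    using q by (intro sum_mono2) auto
  also have "\<dots> = 1"
  proof -
    have "complex_of_real (\<Sum>j<n. (cmod (v j i))\<^sup>2) = (\<Sum>j<n. v j i * cnj (v j i))"
      unfolding of_real_sum complex_norm_square ..
    also have "\<dots> = 1" using orthonormal_complete[OF on i i] by simp
    finally show ?thesis by (simp only: of_real_eq_1_iff)
  qed
  finally show ?thesis using power2_le_imp_le[of "vlen n (eigenproj q v i)" 1] by simp
qed

text \<open>
  The sin theta theorem of Davis and Kahan, in the Frobenius norm.  Since \<open>P\<close> and \<open>Q\<close> have the same rank,
  \<open>\<parallel>P - Q\<parallel>\<^sup>2\<close> is twice the sum of \<open>\<bar>\<langle>v j, w k\<rangle>\<bar>\<^sup>2\<close> over \<open>j < q \<le> k\<close>, and these inner products are small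
  because \<open>(lam j - mu k) * \<langle>v j, w k\<rangle> = \<langle>(A - B) (v j), w k\<rangle>\<close>.  The Frobenius norm costs only a
  factor \<open>sqrt q\<close>, which does not depend on \<open>n\<close>.
\<close>

lemma eigenproj_perturbation:
  assumes v: "eigenbasis n A lam v" and w: "eigenbasis n B mu w" and q: "q \<le> n"
    and \<gamma>: "0 < \<gamma>" "\<And>j k. j < q \<Longrightarrow> q \<le> k \<Longrightarrow> k < n \<Longrightarrow> \<gamma> \<le> lam j - mu k"
    and E: "bounded_op n n (\<lambda>i j. A i j - B i j) E" and i: "i < n"
  shows "(vlen n (\<lambda>m. eigenproj q v i m - eigenproj q w i m))\<^sup>2 \<le> 2 * real q * (E / \<gamma>)\<^sup>2"
proof -
  have onv: "orthonormal n v" and onw: "orthonormal n w"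
    using v w by (auto simp: eigenbasis_def)
  have v1: "vlen n (v j) = 1" if "j < n" for j
  proof -
    have "complex_of_real ((vlen n (v j))\<^sup>2) = 1"
      unfolding dotp_self[symmetric] using onv that by (simp add: orthonormal_def)
    then have "(vlen n (v j))\<^sup>2 = 1" by (simp only: of_real_eq_1_iff)
    then show ?thesis using vlen_nonneg[of n "v j"] by (simp add: power2_eq_1_iff)
  qed
  let ?s = "\<lambda>j k. (cmod (dotp n (v j) (w k)))\<^sup>2"
  have off: "(\<Sum>k=q..<n. ?s j k) \<le> (E / \<gamma>)\<^sup>2" if j: "j < q" for j
  proof -
    define y where "y = mapply n (\<lambda>i j. A i j - B i j) (v j)"
    have y: "y i = complex_of_real (lam j) * v j i - mapply n B (v j) i" if "i < n" for i
      using v that j q by (simp add: y_def mapply_def algebra_simps sum_subtractf eigenbasis_def)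
    have yw: "dotp n y (w k) = complex_of_real (lam j - mu k) * dotp n (v j) (w k)" if "k < n" for k
    proof -
      have "dotp n y (w k) = dotp n (\<lambda>i. complex_of_real (lam j) * v j i
          - mapply n B (v j) i) (w k)"
        by (rule dotp_cong) (simp_all add: y)
      then show ?thesis
        using dotp_eigenvector[OF w that, of "v j"] by
            (simp add: dotp_diff_left dotp_scale_left algebra_simps)
    qed
    have "\<gamma>\<^sup>2 * (\<Sum>k=q..<n. ?s j k) \<le> (\<Sum>k=q..<n. (cmod (dotp n y (w k)))\<^sup>2)"
      unfolding sum_distrib_left
    proof (rule sum_mono)
      fix k assume k: "k \<in> {q..<n}"
      have "\<gamma>\<^sup>2 \<le> (lam j - mu k)\<^sup>2"
        using \<gamma>(2)[OF j] \<gamma>(1) k by (intro power_mono) auto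
      then have "\<gamma>\<^sup>2 * ?s j k \<le> (lam j - mu k)\<^sup>2 * ?s j k" by (intro mult_right_mono) auto
      also have "\<dots> = (cmod (dotp n y (w k)))\<^sup>2"
        using k by (simp add: yw norm_mult power_mult_distrib del: of_real_diff)
      finally show "\<gamma>\<^sup>2 * ?s j k \<le> (cmod (dotp n y (w k)))\<^sup>2" .
    qed
    also have "\<dots> \<le> (\<Sum>k<n. (cmod (dotp n y (w k)))\<^sup>2)"
      by (intro sum_mono2) auto
    also have "\<dots> = (vlen n y)\<^sup>2" by (rule Parseval[OF onw, symmetric])
    also have "\<dots> \<le> E\<^sup>2"
      using bounded_opD[OF E, of "v j"] v1[of j] j q unfolding y_def[symmetric]
      by (intro power_mono) auto
    finally show ?thesis using \<gamma>(1) by (simp add: power_divide field_simps)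
  qed
  have split: "(\<Sum>k<q. ?s j k) + (\<Sum>k=q..<n. ?s j k) = 1" if "j < q" for j
  proof -
    have "{..<n} = {..<q} \<union> {q..<n}" using q by auto
    then have "(\<Sum>k<n. ?s j k) = (\<Sum>k<q. ?s j k) + (\<Sum>k=q..<n. ?s j k)"
      by (simp add: sum.union_disjoint ivl_disj_int)
    then show ?thesis using Parseval[OF onw, of "v j"] v1[of j] that q by simp
  qed
  have self: "(\<Sum>j<q. \<Sum>k<q. (cmod (dotp n (u j) (u k)))\<^sup>2) = real q" if "orthonormal n u" for u
  proof -
    have "(\<Sum>j<q. \<Sum>k<q. (cmod (dotp n (u j) (u k)))\<^sup>2) = (\<Sum>j<q. \<Sum>k<q. if j = k then 1 else 0)"
      using that q by (intro sum.cong refl) (auto simp: orthonormal_def)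
    then show ?thesis by simp
  qed
  let ?P = "eigenproj q v" and ?Q = "eigenproj q w"
  have "complex_of_real (\<Sum>i<n. (vlen n (\<lambda>m. ?P i m - ?Q i m))\<^sup>2) =
      (\<Sum>i<n. dotp n (?P i) (?P i)) - (\<Sum>i<n. dotp n (?P i) (?Q i)) - (\<Sum>i<n. dotp n (?Q i) (?P i))
        + (\<Sum>i<n. dotp n (?Q i) (?Q i))"
    unfolding of_real_sum dotp_self[symmetric]
    by (simp add: dotp_diff_left dotp_diff_right sum_subtractf sum.distrib algebra_simps)
  also have "\<dots> = complex_of_real (2 * real q - 2 * (\<Sum>j<q. \<Sum>k<q. ?s j k))"
  proof -
    have "(\<Sum>j<q. \<Sum>k<q. (cmod (dotp n (w j) (v k)))\<^sup>2) = (\<Sum>j<q. \<Sum>k<q. ?s j k)"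
    proof -
      have "cmod (dotp n (w j) (v k)) = cmod (dotp n (v k) (w j))" for j k
        using complex_mod_cnj[of "dotp n (v k) (w j)"] by (simp add: dotp_cnj)
      then show ?thesis
        by (subst sum.swap) simp
    qed
    then show ?thesis
      unfolding Frobenius_eigenproj self[OF onv] self[OF onw] by simp
  qed
  finally have "(\<Sum>i<n. (vlen n (\<lambda>m. ?P i m - ?Q i m))\<^sup>2) = 2 * real q - 2 * (\<Sum>j<q. \<Sum>k<q. ?s j k)"
    by (simp only: of_real_eq_iff)
  also have "\<dots> = 2 * (\<Sum>j<q. \<Sum>k=q..<n. ?s j k)"
  proof -
    have "(\<Sum>j<q. \<Sum>k<q. ?s j k) + (\<Sum>j<q. \<Sum>k=q..<n. ?s j k) = real q"
      unfolding sum.distrib[symmetric] using split by simp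
    then show ?thesis by simp
  qed
  also have "\<dots> \<le> 2 * (\<Sum>j<q. (E / \<gamma>)\<^sup>2)"
    by (intro mult_left_mono sum_mono off) auto
  also have "\<dots> = 2 * real q * (E / \<gamma>)\<^sup>2" by simp
  finally have "(\<Sum>i<n. (vlen n (\<lambda>m. ?P i m - ?Q i m))\<^sup>2) \<le> 2 * real q * (E / \<gamma>)\<^sup>2" .
  moreover have "(vlen n (\<lambda>m. ?P i m - ?Q i m))\<^sup>2 \<le> (\<Sum>i<n. (vlen n (\<lambda>m. ?P i m - ?Q i m))\<^sup>2)"
    using i by (intro member_le_sum[where f = "\<lambda>i. (vlen n (\<lambda>m. ?P i m - ?Q i m))\<^sup>2"]) auto
  ultimately show ?thesis by linarith
qed

section \<open>The transfer function of the difference operator\<close>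

abbreviation lag_symbol :: "real \<Rightarrow> complex" where
  "lag_symbol \<theta> \<equiv> 1 - cis (- \<theta>)"

text \<open>
  Concavity of the sine: the graph lies above its chord.
\<close>

lemma sin_ge_chord:
  assumes "0 \<le> x" "x \<le> pi / 2"
  shows "2 / pi * x \<le> sin x"
proof -
  have "convex_on {0..pi / 2} (\<lambda>x. - sin x)"
  proof (rule f''_ge0_imp_convex[where f' = "\<lambda>x. - cos x" and f'' = sin])
    show "0 \<le> sin x" if "x \<in> {0..pi / 2}" for x
      using that by (intro sin_ge_zero) auto
  qed (auto intro!: derivative_eq_intros)
  from convex_onD[OF this, of "2 / pi * x" 0 "pi / 2"] show ?thesis
    using assms by (simp add: field_simps)
qed

lemma norm_lag_symbol: "norm (lag_symbol \<theta>) = 2 * \<bar>sin (\<theta> / 2)\<bar>"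
proof -
  have "(norm (lag_symbol \<theta>))\<^sup>2 = (1 - cos \<theta>)\<^sup>2 + (sin \<theta>)\<^sup>2"
    by (simp add: cmod_power2)
  also have "\<dots> = 2 - 2 * cos (2 * (\<theta> / 2))"
    using sin_cos_squared_add[of \<theta>] by (simp add: power2_eq_square algebra_simps)
  also have "\<dots> = (2 * \<bar>sin (\<theta> / 2)\<bar>)\<^sup>2"
    unfolding cos_double_sin by (simp add: power_mult_distrib)
  finally show ?thesis
    by (rule power2_eq_imp_eq) auto
qed

lemma norm_lag_symbol_le_2: "norm (lag_symbol \<theta>) \<le> 2"
  by (simp add: norm_lag_symbol)

lemma norm_lag_symbol_abs: "\<theta> \<in> Freq \<Longrightarrow> norm (lag_symbol \<theta>) = 2 * sin (\<bar>\<theta>\<bar> / 2)"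
proof -
  assume "\<theta> \<in> Freq"
  then have "0 \<le> sin (\<bar>\<theta>\<bar> / 2)" by (intro sin_ge_zero) auto
  then show ?thesis by (cases "0 \<le> \<theta>") (auto simp: norm_lag_symbol)
qed

lemma norm_lag_symbol_ge:
  assumes "\<theta> \<in> Freq"
  shows "2 / pi * \<bar>\<theta>\<bar> \<le> norm (lag_symbol \<theta>)"
proof -
  have "2 / pi * (\<bar>\<theta>\<bar> / 2) \<le> sin (\<bar>\<theta>\<bar> / 2)"
    using assms by (intro sin_ge_chord) auto
  then show ?thesis
    unfolding norm_lag_symbol_abs[OF assms] by (simp add: field_simps)
qed

lemma norm_lag_symbol_mono:
  "\<theta> \<in> Freq \<Longrightarrow> \<theta>' \<in> Freq \<Longrightarrow> \<bar>\<theta>'\<bar> \<le> \<bar>\<theta>\<bar> \<Longrightarrow> norm (lag_symbol \<theta>') \<le> norm (lag_symbol \<theta>)"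
  using sin_monotone_2pi_le[of "\<bar>\<theta>'\<bar> / 2" "\<bar>\<theta>\<bar> / 2"] by (auto simp: norm_lag_symbol_abs)

lemma lag_symbol_neq_0: "\<theta> \<in> Freq \<Longrightarrow> \<theta> \<noteq> 0 \<Longrightarrow> lag_symbol \<theta> \<noteq> 0"
proof -
  assume "\<theta> \<in> Freq" "\<theta> \<noteq> 0"
  then have "0 < 2 / pi * \<bar>\<theta>\<bar>" by simp
  also have "\<dots> \<le> norm (lag_symbol \<theta>)"
    using \<open>\<theta> \<in> Freq\<close> by (rule norm_lag_symbol_ge)
  finally show ?thesis by (rule zero_less_norm_iff[THEN iffD1])
qed

lemma norm_lag_symbol_powr:
  "norm (lag_symbol \<theta> powr complex_of_real a) = norm (lag_symbol \<theta>) powr a"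
  by (simp add: norm_powr_real_powr')

lemma lag_symbol_not_nonpos: "\<theta> \<in> Freq \<Longrightarrow> \<theta> \<noteq> 0 \<Longrightarrow> lag_symbol \<theta> \<notin> \<real>\<^sub>\<le>\<^sub>0"
proof
  assume \<theta>: "\<theta> \<in> Freq" "\<theta> \<noteq> 0" and neg: "lag_symbol \<theta> \<in> \<real>\<^sub>\<le>\<^sub>0"
  have "Re (lag_symbol \<theta>) \<le> 0" "Im (lag_symbol \<theta>) = 0"
    using neg by (auto simp: complex_nonpos_Reals_iff)
  then have "cos \<theta> = 1" "sin \<theta> = 0"
    using cos_le_one[of \<theta>] by auto
  then have "lag_symbol \<theta> = 0"
    by (simp add: complex_eq_iff)
  with lag_symbol_neq_0[OF \<theta>] show False by simp
qed

text \<open>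
  The mean value inequality along the segment from \<open>\<theta>\<close> to \<open>\<theta>'\<close>, on which the symbol stays in the
  right half plane and has modulus at least \<open>2 / pi * t\<close>.  The factor \<open>a\<close> makes the bound vanish for
  \<open>a = 0\<close>; this is what keeps the case of equal memory parameters free of the singularity \<open>1 / t\<close>.
\<close>

lemma lag_symbol_powr_diff:
  assumes a: "0 \<le> a" "a \<le> 1" and t: "0 < t" "t \<le> \<bar>\<theta>\<bar>" "t \<le> \<bar>\<theta>'\<bar>"
    and \<theta>: "\<theta> \<in> Freq" "\<theta>' \<in> Freq" "0 < \<theta> * \<theta>'"
  shows "norm (lag_symbol \<theta> powr complex_of_real a - lag_symbol \<theta>' powr complex_of_real a)
    \<le> a * (2 / pi * t) powr (a - 1) * \<bar>\<theta> - \<theta>'\<bar>"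
proof -
  define F where "F = (\<lambda>w. (1 - exp (- (\<i> * w))) powr complex_of_real a)"
  define F' where "F' = (\<lambda>w. complex_of_real a * (1 - exp (- (\<i> * w))) powr (complex_of_real a
      - 1) * (\<i> * exp (- (\<i> * w))))"
  define S where "S = complex_of_real ` closed_segment \<theta> \<theta>'"
  have F: "F (complex_of_real s) = lag_symbol s powr complex_of_real a" for s
    by (simp add: F_def cis_conv_exp)
  have seg: "s \<in> Freq \<and> t \<le> \<bar>s\<bar>" if "s \<in> closed_segment \<theta> \<theta>'" for s
    using that \<theta> t by (auto simp: closed_segment_eq_real_ivl zero_less_mult_iff split: if_splits)
  have "norm (F (complex_of_real \<theta>) - F (complex_of_real \<theta>')) \<le>
      a * (2 / pi * t) powr (a - 1) * norm (complex_of_real \<theta> - complex_of_real \<theta>')"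
  proof (rule field_differentiable_bound[where S = S and f' = F'])
    show "convex S"
      unfolding S_def by (intro convex_linear_image convex_closed_segment bounded_linear.linear
          bounded_linear_of_real)
    fix w assume "w \<in> S"
    then obtain s where s: "w = complex_of_real s" "s \<in> closed_segment \<theta> \<theta>'" by (auto simp: S_def)
    have s': "s \<in> Freq" "s \<noteq> 0" "t \<le> \<bar>s\<bar>" using seg[OF s(2)] t by auto
    have z: "1 - exp (- (\<i> * w)) = lag_symbol s"
      by (simp add: s cis_conv_exp)
    have "((\<lambda>x. 1 - exp (- (\<i> * x))) has_field_derivative \<i> * exp (- (\<i> * w))) (at w)"
      by (auto intro!: derivative_eq_intros)
    moreover have "1 - exp (- (\<i> * w)) \<notin> \<real>\<^sub>\<le>\<^sub>0"
      unfolding z using lag_symbol_not_nonpos[OF s'(1,2)] .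
    ultimately have "(F has_field_derivative F' w) (at w)"
      unfolding F_def F'_def by (intro DERIV_chain2[OF has_field_derivative_powr])
    then show "(F has_field_derivative F' w) (at w within S)"
      by (rule DERIV_subset) simp
    have "norm (lag_symbol s) powr (a - 1) \<le> (2 / pi * t) powr (a - 1)"
    proof (rule powr_mono2')
      show "2 / pi * t \<le> norm (lag_symbol s)"
        by (rule order_trans[OF _ norm_lag_symbol_ge[OF s'(1)]])
            (use s'(3) in \<open>simp add: field_simps\<close>)
    qed (use a t in auto)
    moreover have "norm (exp (- (\<i> * w))) = 1"
      by (simp add: s(1))
    then have "norm (F' w) = a * norm (lag_symbol s) powr (a - 1)"
      using a norm_lag_symbol_powr[of s "a - 1"]
      by (simp add: F'_def z norm_mult)
    ultimately show "norm (F' w) \<le> a * (2 / pi * t) powr (a - 1)"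
      using a by (simp add: mult_left_mono)
  qed (auto simp: S_def)
  then show ?thesis
    unfolding F by (simp add: norm_of_real flip: of_real_diff)
qed

section \<open>The modulus of continuity of the eigenprojection\<close>

lemma powr_le_2:
  assumes "0 \<le> x" "x \<le> 2" "0 \<le> a" "a \<le> (1::real)"
  shows "x powr a \<le> 2"
proof -
  have "x powr a \<le> 2 powr a" using assms by (intro powr_mono2) auto
  also have "\<dots> \<le> 2 powr 1" using assms by (intro powr_mono) auto
  finally show ?thesis by simp
qed

text \<open>
  The matrix \<open>S \<theta>\<close> is replaced by its multiple \<open>A \<theta>\<close> by \<open>\<bar>1 - exp (- \<i> \<theta>)\<bar> powr (2 * d)\<close>, a bounded
  matrix with the same eigenvectors; \<open>d\<close> stands for the largest memory parameter.  The numerator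
  and the gap both have a factor \<open>n\<close>, and all other constants are explicit, so that the bound does
  not depend on \<open>n\<close>.

  In the gap, the leading eigenvalues are taken at the frequency of larger modulus and the
  remaining ones at the frequency of smaller modulus.  Then the idiosyncratic part at both
  frequencies is controlled by the larger of the two scalar factors, however different they are.
\<close>

lemma eigenprojection_modulus_ordered:
  fixes G X S :: "real \<Rightarrow> nat \<Rightarrow> nat \<Rightarrow> complex" and a :: "nat \<Rightarrow> nat \<Rightarrow> real"
    and lam :: "real \<Rightarrow> nat \<Rightarrow> real" and v :: "real \<Rightarrow> nat \<Rightarrow> nat \<Rightarrow> complex"
  assumes q: "0 < q" "q \<le> n"
    and idx: "single_index n q a" and a: "\<And>i l. i < n \<Longrightarrow> l < q \<Longrightarrow> 0 \<le> a i l \<and> a i l \<le> \<Delta>"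
    and \<Delta>: "0 \<le> \<Delta>" "\<Delta> \<le> d" "2 * d \<le> 1"
    and s: "0 < s" and G_lo: "\<And>\<theta> w. \<theta> \<in> Freq \<Longrightarrow> real n * s * (vlen q w)\<^sup>2
        \<le> (vlen n (mapply q (G \<theta>) w))\<^sup>2"
    and K: "0 \<le> K1" "0 \<le> K2" "0 \<le> K3"
    and G_hi: "\<And>\<theta>. \<theta> \<in> Freq \<Longrightarrow> bounded_op n q (G \<theta>) (sqrt (real n) * K1)"
    and G_Lip: "\<And>\<theta> \<theta>'. \<theta> \<in> Freq \<Longrightarrow> \<theta>' \<in> Freq \<Longrightarrow>
        bounded_op n q (\<lambda>i l. G \<theta> i l - G \<theta>' i l) (sqrt (real n) * K2 * \<bar>\<theta> - \<theta>'\<bar>)"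
    and r: "0 < r" and X_herm: "\<And>\<theta>. \<theta> \<in> Freq \<Longrightarrow> herm n (X \<theta>)"
    and X_R: "\<And>\<theta> x. \<theta> \<in> Freq \<Longrightarrow> \<bar>Re (dotp n (mapply n (X \<theta>) x) x)\<bar> \<le> r * (vlen n x)\<^sup>2"
    and X_Lip: "\<And>\<theta> \<theta>'. \<theta> \<in> Freq \<Longrightarrow> \<theta>' \<in> Freq \<Longrightarrow>
        bounded_op n n (\<lambda>i j. X \<theta> i j - X \<theta>' i j) (K3 * \<bar>\<theta> - \<theta>'\<bar>)"
    and S: "\<And>\<theta> i j. \<theta> \<in> Freq \<Longrightarrow> \<theta> \<noteq> 0 \<Longrightarrow> i < n \<Longrightarrow> j < n \<Longrightarrow>
        complex_of_real (norm (lag_symbol \<theta>) powr (2 * d)) * S \<theta> i j =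
          gram q (\<lambda>i l. lag_symbol \<theta> powr complex_of_real (a i l) * G \<theta> i l) i j
          + complex_of_real (norm (lag_symbol \<theta>) powr (2 * d)) * X \<theta> i j"
    and eb: "\<And>\<theta>. \<theta> \<in> Freq \<Longrightarrow> \<theta> \<noteq> 0 \<Longrightarrow> eigenbasis n (S \<theta>) (lam \<theta>) (v \<theta>)"
    and big: "32 * r \<le> real n * s"
    and \<theta>: "\<theta> \<in> Freq" "\<theta>' \<in> Freq" "0 < \<theta> * \<theta>'" "\<bar>\<theta>'\<bar> \<le> \<bar>\<theta>\<bar>" and i: "i < n"
    and u: "u = 2 / pi * \<bar>\<theta>'\<bar>"
  shows "vlen n (\<lambda>m. eigenproj q (v \<theta>) i m - eigenproj q (v \<theta>') i m) \<le>
    sqrt (2 * real q) * (8 / s * ((8 * K1 * K2 + 2 * K3 + 8 * K1\<^sup>2 * \<Delta> / u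
        + 6 * r * d * u powr (2 * d - 1)) * u powr (- 2 * \<Delta>)) * \<bar>\<theta> - \<theta>'\<bar>)"
proof -
  define z where "z = norm (lag_symbol \<theta>)"
  define z' where "z' = norm (lag_symbol \<theta>')"
  define \<delta> where "\<delta> = \<bar>\<theta> - \<theta>'\<bar>"
  define f where "f = (\<lambda>\<theta> i l. lag_symbol \<theta> powr complex_of_real (a i l))"
  define L where "L = (\<lambda>\<theta> i l. f \<theta> i l * G \<theta> i l)"
  define A where "A = (\<lambda>\<theta> i j. complex_of_real (norm (lag_symbol \<theta>) powr (2 * d)) * S \<theta> i j)"
  define M where "M = 8 * K1 * K2 + 2 * K3 + 8 * K1\<^sup>2 * \<Delta> / u + 6 * r * d * u powr (2 * d - 1)"
  have n0: "0 < n" using q by simp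
  have nz: "\<theta> \<noteq> 0" "\<theta>' \<noteq> 0" using \<theta>(3) by auto
  have u0: "0 < u" using nz by (simp add: u)
  have uz': "u \<le> z'" unfolding u z'_def by (rule norm_lag_symbol_ge[OF \<theta>(2)])
  have z'z: "z' \<le> z" unfolding z_def z'_def using \<theta> by (intro norm_lag_symbol_mono)
  have z2: "z \<le> 2" unfolding z_def by (rule norm_lag_symbol_le_2)
  have z_pos: "0 < z" "0 < z'" using u0 uz' z'z by auto
  have \<delta>0: "0 \<le> \<delta>" by (simp add: \<delta>_def)
  have a1: "0 \<le> a i l" "a i l \<le> \<Delta>" "a i l \<le> 1" if "i < n" "l < q" for i l
    using a[OF that] \<Delta> by auto
  have fn: "norm (f \<phi> i l) = norm (lag_symbol \<phi>) powr a i l" for \<phi> i l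
    by (simp add: f_def norm_lag_symbol_powr)
  have f2: "norm (f \<phi> i l) \<le> 2" if "i < n" "l < q" for \<phi> i l
    unfolding fn using a1[OF that] by (intro powr_le_2 norm_lag_symbol_le_2) auto
  have f_idx: "single_index n q (f \<phi>)" for \<phi>
    unfolding f_def by (rule single_index_map[OF idx])
  have fd_idx: "single_index n q (\<lambda>i l. f \<theta> i l - f \<theta>' i l)"
    unfolding f_def by (rule single_index_map[OF idx, of "\<lambda>c. lag_symbol \<theta> powr complex_of_real c
        - lag_symbol \<theta>' powr complex_of_real c"])
  have pd: "norm (lag_symbol \<theta> powr complex_of_real c - lag_symbol \<theta>' powr complex_of_real c)
      \<le> c * u powr (c - 1) * \<delta>"
    if "0 \<le> c" "c \<le> 1" for c
    unfolding u \<delta>_def using that \<theta> nz by (intro lag_symbol_powr_diff) auto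
  have fd: "norm (f \<theta> i l - f \<theta>' i l) \<le> 2 * \<Delta> / u * \<delta>" if il: "i < n" "l < q" for i l
  proof -
    have "norm (f \<theta> i l - f \<theta>' i l) \<le> a i l * u powr (a i l - 1) * \<delta>"
      unfolding f_def using a1[OF il] by (intro pd) auto
    also have "\<dots> = a i l * u powr a i l / u * \<delta>"
      using u0 by (simp add: powr_diff)
    also have "\<dots> \<le> \<Delta> * 2 / u * \<delta>"
      using a1[OF il] u0 uz' z'z z2 \<delta>0 \<Delta>(1)
      by (intro mult_right_mono divide_right_mono mult_mono powr_le_2) auto
    finally show ?thesis by (simp add: mult.commute)
  qed
  have L_hi: "bounded_op n q (L \<phi>) (2 * (sqrt (real n) * K1))" if "\<phi> \<in> Freq" for \<phi>
    unfolding L_def by (rule bounded_op_single_index[OF f_idx n0 q(1) f2 G_hi[OF that]])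
  have L_Lip: "bounded_op n q (\<lambda>i l. L \<theta> i l - L \<theta>' i l) (sqrt (real n) * \<delta> * (2 * K2
      + 2 * \<Delta> / u * K1))"
  proof -
    have "bounded_op n q (\<lambda>i l. f \<theta> i l * (G \<theta> i l - G \<theta>' i l) + (f \<theta> i l - f \<theta>' i l) * G \<theta>' i l)
        (2 * (sqrt (real n) * K2 * \<delta>) + (2 * \<Delta> / u * \<delta>) * (sqrt (real n) * K1))"
      unfolding \<delta>_def
      by (intro bounded_op_add bounded_op_single_index f_idx fd_idx n0 q f2 fd[unfolded \<delta>_def]
          G_Lip G_hi \<theta>)
    moreover have "f \<theta> i l * (G \<theta> i l - G \<theta>' i l) + (f \<theta> i l - f \<theta>' i l) * G \<theta>' i l
        = L \<theta> i l - L \<theta>' i l" for i l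
      by (simp add: L_def algebra_simps)
    moreover have "2 * (sqrt (real n) * K2 * \<delta>) + (2 * \<Delta> / u * \<delta>) * (sqrt (real n) * K1)
        = sqrt (real n) * \<delta> * (2 * K2 + 2 * \<Delta> / u * K1)"
      by (simp add: algebra_simps)
    ultimately show ?thesis by simp
  qed
  have gram_Lip: "bounded_op n n (\<lambda>i j. gram q (L \<theta>) i j - gram q (L \<theta>') i j)
      (real n * \<delta> * (8 * K1 * K2 + 8 * K1\<^sup>2 * \<Delta> / u))"
  proof -
    have eq: "2 * (b * \<delta> * (2 * K2 + 2 * \<Delta> / u * K1) * (2 * (b * K1)))
        = b * b * \<delta> * (8 * K1 * K2 + 8 * K1\<^sup>2 * \<Delta> / u)" for b
      by (simp add: algebra_simps power2_eq_square)
    show ?thesis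
      using bounded_op_gram_diff[OF L_hi[OF \<theta>(1)] L_hi[OF \<theta>(2)] L_Lip] unfolding eq by simp
  qed
  define c where "c = z powr (2 * d)"
  define c' where "c' = z' powr (2 * d)"
  have c': "0 \<le> c'" "c' \<le> c" "c' \<le> 2"
    using z'z z2 z_pos \<Delta> by (auto simp: c_def c'_def intro!: powr_mono2 powr_le_2)
  have X_Lip': "bounded_op n n (\<lambda>i j. complex_of_real c * X \<theta> i j - complex_of_real c' * X \<theta>' i j)
      (real n * \<delta> * (6 * r * d * u powr (2 * d - 1) + 2 * K3))"
  proof -
    have cd: "\<bar>c - c'\<bar> \<le> 2 * d * u powr (2 * d - 1) * \<delta>"
    proof -
      have "\<bar>c - c'\<bar> \<le> norm (lag_symbol \<theta> powr complex_of_real (2 * d)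
          - lag_symbol \<theta>' powr complex_of_real (2 * d))"
        unfolding c_def c'_def z_def z'_def norm_lag_symbol_powr[symmetric]
            by (rule norm_triangle_ineq3)
      also have "\<dots> \<le> 2 * d * u powr (2 * d - 1) * \<delta>" using \<Delta> by (intro pd) auto
      finally show ?thesis .
    qed
    have "bounded_op n n (\<lambda>i j. complex_of_real (c - c') * X \<theta> i j + complex_of_real c' * (X \<theta> i j
        - X \<theta>' i j))
        (cmod (complex_of_real (c - c')) * (3 * r) + cmod (complex_of_real c') * (K3 * \<delta>))"
      unfolding \<delta>_def
      by (intro bounded_op_add bounded_op_scalar X_Lip bounded_op_of_Rayleigh X_herm X_R r \<theta>)
    then have *: "bounded_op n n (\<lambda>i j. complex_of_real c * X \<theta> i j - complex_of_real c' * X \<theta>' i j)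
        (cmod (complex_of_real (c - c')) * (3 * r) + cmod (complex_of_real c') * (K3 * \<delta>))"
      by (simp add: algebra_simps)
    have "cmod (complex_of_real (c - c')) * (3 * r) + cmod (complex_of_real c') * (K3 * \<delta>)
        \<le> (2 * d * u powr (2 * d - 1) * \<delta>) * (3 * r) + 2 * (K3 * \<delta>)"
      unfolding norm_of_real using cd c' r K \<delta>0 by (intro add_mono mult_right_mono) auto
    also have "\<dots> = 1 * (\<delta> * (6 * r * d * u powr (2 * d - 1) + 2 * K3))"
      by (simp add: algebra_simps)
    also have "\<dots> \<le> real n * (\<delta> * (6 * r * d * u powr (2 * d - 1) + 2 * K3))"
      using n0 \<delta>0 r \<Delta> K by (intro mult_right_mono) auto
    finally show ?thesis
      by (intro bounded_op_mono[OF *]) (simp add: mult.assoc)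
  qed
  have A_eq: "A \<theta> i j = gram q (L \<theta>) i j + complex_of_real c * X \<theta> i j"
    "A \<theta>' i j = gram q (L \<theta>') i j + complex_of_real c' * X \<theta>' i j" if "i < n" "j < n" for i j
    using S[OF \<theta>(1) nz(1) that] S[OF \<theta>(2) nz(2) that]
    by (simp_all add: A_def L_def f_def c_def c'_def z_def z'_def)
  have A_Lip: "bounded_op n n (\<lambda>i j. A \<theta> i j - A \<theta>' i j) (real n * \<delta> * M)"
  proof -
    have "bounded_op n n (\<lambda>i j. (gram q (L \<theta>) i j - gram q (L \<theta>') i j)
        + (complex_of_real c * X \<theta> i j - complex_of_real c' * X \<theta>' i j))
      (real n * \<delta> * (8 * K1 * K2 + 8 * K1\<^sup>2 * \<Delta> / u) + real n * \<delta> * (6 * r * d * u powr (2 * d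
          - 1) + 2 * K3))"
      by (intro bounded_op_add gram_Lip X_Lip')
    moreover have "real n * \<delta> * (8 * K1 * K2 + 8 * K1\<^sup>2 * \<Delta> / u) + real n * \<delta> * (6 * r * d * u
        powr (2 * d - 1) + 2 * K3) = real n * \<delta> * M"
      by (simp add: M_def algebra_simps)
    moreover have "bounded_op n n (\<lambda>i j. (gram q (L \<theta>) i j - gram q (L \<theta>') i j)
        + (complex_of_real c * X \<theta> i j - complex_of_real c' * X \<theta>' i j)) k
            = bounded_op n n (\<lambda>i j. A \<theta> i j - A \<theta>' i j) k" for k
      by (rule bounded_op_cong) (simp add: A_eq)
    ultimately show ?thesis by simp
  qed
  have ebA: "eigenbasis n (A \<theta>) (\<lambda>j. c * lam \<theta> j) (v \<theta>)" "eigenbasis n (A \<theta>') (\<lambda>j. c' * lam \<theta>' j)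
      (v \<theta>')"
    unfolding A_def c_def c'_def z_def z'_def using \<theta> nz by (auto intro!: eigenbasis_scale eb)
  \<comment> \<open>The common part of the form is a square that vanishes on the kernel of \<open>L\<^sup>*\<close>.\<close>
  have quad: "Re (dotp n (mapply n (A \<theta>) x) x) = (vlen q (mapply n (adjm (L \<theta>)) x))\<^sup>2
      + c * Re (dotp n (mapply n (X \<theta>) x) x)"
    "Re (dotp n (mapply n (A \<theta>') x) x) = (vlen q (mapply n (adjm (L \<theta>')) x))\<^sup>2
        + c' * Re (dotp n (mapply n (X \<theta>') x) x)" for x
  proof -
    have *: "Re (dotp n (mapply n B x) x) = (vlen q (mapply n (adjm P) x))\<^sup>2
        + k * Re (dotp n (mapply n Y x) x)"
      if B: "\<And>i j. i < n \<Longrightarrow> j < n \<Longrightarrow> B i j = gram q P i j + complex_of_real k * Y i j" for B P k Y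
    proof -
      have "mapply n B x i = mapply n (gram q P) x i + complex_of_real k * mapply n Y x i"
          if "i < n" for i
        unfolding mapply_def using B[OF that] by
            (simp add: algebra_simps sum.distrib sum_distrib_left)
      then have "dotp n (mapply n B x) x = dotp n (\<lambda>i. mapply n (gram q P) x i
          + complex_of_real k * mapply n Y x i) x"
        by (intro dotp_cong) auto
      then show ?thesis
        by (simp add: dotp_add_left dotp_scale_left dotp_gram flip: of_real_power)
    qed
    show "Re (dotp n (mapply n (A \<theta>) x) x) = (vlen q (mapply n (adjm (L \<theta>)) x))\<^sup>2
        + c * Re (dotp n (mapply n (X \<theta>) x) x)"
      by (rule *) (rule A_eq)
    show "Re (dotp n (mapply n (A \<theta>') x) x) = (vlen q (mapply n (adjm (L \<theta>')) x))\<^sup>2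
        + c' * Re (dotp n (mapply n (X \<theta>') x) x)"
      by (rule *) (rule A_eq)
  qed
  have lower: "(z powr \<Delta> / 2)\<^sup>2 * (real n * s) - c * r \<le> c * lam \<theta> (q - 1)"
  proof (rule eigenvalue_lower_bound[OF ebA(1) q])
    show "0 < (z powr \<Delta> / 2)\<^sup>2 * (real n * s)" using z_pos n0 s by simp
    show "(z powr \<Delta> / 2)\<^sup>2 * (real n * s) * (vlen q w)\<^sup>2 \<le> (vlen n (mapply q (L \<theta>) w))\<^sup>2" for w
      unfolding L_def
    proof (rule coercive_single_index[OF f_idx n0 q(1)])
      fix i l assume il: "i < n" "l < q"
      \<comment> \<open>The smallest of the weights \<open>z powr a\<close> with \<open>0 \<le> a \<le> \<Delta>\<close> is \<open>z powr \<Delta>\<close>, up to a factor \<open>2\<close> for \<open>z > 1\<close>.\<close>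
      have "z powr \<Delta> = z powr (\<Delta> - a i l) * z powr a i l"
        by (simp flip: powr_add)
      also have "\<dots> \<le> 2 * z powr a i l"
        using a1[OF il] \<Delta> z_pos z2 by (intro mult_right_mono powr_le_2) auto
      finally show "z powr \<Delta> / 2 \<le> cmod (f \<theta> i l)" by (simp add: fn z_def)
    qed (use s G_lo \<theta> in auto)
    show "(vlen q (mapply n (adjm (L \<theta>)) x))\<^sup>2 - c * r * (vlen n x)\<^sup>2
        \<le> Re (dotp n (mapply n (A \<theta>) x) x)" for x
    proof -
      have "- (r * (vlen n x)\<^sup>2) \<le> Re (dotp n (mapply n (X \<theta>) x) x)"
        using X_R[OF \<theta>(1), of x] by linarith
      then have "c * - (r * (vlen n x)\<^sup>2) \<le> c * Re (dotp n (mapply n (X \<theta>) x) x)"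
        using c' by (intro mult_left_mono) auto
      then show ?thesis unfolding quad by (simp add: mult.assoc)
    qed
  qed
  have upper: "c' * lam \<theta>' q \<le> c' * r" if "q < n"
  proof (rule eigenvalue_upper_bound[OF ebA(2) that])
    fix x assume "\<forall>l<q. mapply n (adjm (L \<theta>')) x l = 0"
    then have "vlen q (mapply n (adjm (L \<theta>')) x) = 0" by (simp add: vlen_eq_0_iff)
    moreover have "c' * Re (dotp n (mapply n (X \<theta>') x) x) \<le> c' * (r * (vlen n x)\<^sup>2)"
      using c' X_R[OF \<theta>(2), of x] by (intro mult_left_mono) auto
    ultimately show "Re (dotp n (mapply n (A \<theta>') x) x) \<le> c' * r * (vlen n x)\<^sup>2"
      unfolding quad by (simp add: mult.assoc)
  qed
  define \<gamma> where "\<gamma> = u powr (2 * \<Delta>) * (real n * s / 8)"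
  have \<gamma>0: "0 < \<gamma>" using u0 n0 s by (simp add: \<gamma>_def)
  have gap: "\<gamma> \<le> c * lam \<theta> j - c' * lam \<theta>' k" if jk: "j < q" "q \<le> k" "k < n" for j k
  proof -
    have mono: "\<mu> k \<le> \<mu> j" if "eigenbasis n B \<mu> w" "j \<le> k" "k < n" for B \<mu> w j k
      using that unfolding eigenbasis_def by blast
    have "c * lam \<theta> (q - 1) \<le> c * lam \<theta> j"
      by (rule mono[OF ebA(1)]) (use jk q in auto)
    moreover have "c' * lam \<theta>' k \<le> c' * lam \<theta>' q"
      by (rule mono[OF ebA(2)]) (use jk q in auto)
    moreover have "c' * lam \<theta>' q \<le> c * r"
      using upper jk c' r by (intro order_trans[OF upper] mult_right_mono) auto
    moreover have "\<gamma> \<le> (z powr \<Delta> / 2)\<^sup>2 * (real n * s) - 2 * (c * r)"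
    proof -
      have sq: "(z powr \<Delta> / 2)\<^sup>2 = z powr (2 * \<Delta>) / 4"
        using powr_power[of z \<Delta> 2] z_pos by (simp add: power_divide mult.commute)
      have "c = z powr (2 * \<Delta>) * z powr (2 * (d - \<Delta>))"
        by (simp add: c_def algebra_simps flip: powr_add)
      also have "\<dots> \<le> z powr (2 * \<Delta>) * 2"
        using z_pos z2 \<Delta> by (intro mult_left_mono powr_le_2) auto
      finally have "2 * (c * r) \<le> 2 * (z powr (2 * \<Delta>) * 2 * r)"
        using r by (intro mult_left_mono mult_right_mono) auto
      also have "\<dots> = z powr (2 * \<Delta>) * (32 * r) / 8" by simp
      also have "\<dots> \<le> z powr (2 * \<Delta>) * (real n * s) / 8"
        using big by (intro divide_right_mono mult_left_mono) auto
      finally have "z powr (2 * \<Delta>) * (real n * s / 8) \<le> (z powr \<Delta> / 2)\<^sup>2 * (real n * s)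
          - 2 * (c * r)"
        unfolding sq by (simp add: field_simps)
      moreover have "\<gamma> \<le> z powr (2 * \<Delta>) * (real n * s / 8)"
        unfolding \<gamma>_def using u0 uz' z'z \<Delta> s by (intro mult_right_mono powr_mono2) auto
      ultimately show ?thesis by linarith
    qed
    ultimately show ?thesis using lower by linarith
  qed
  let ?y = "8 / s * (M * u powr (- 2 * \<Delta>)) * \<delta>"
  have M0: "0 \<le> M" using K r \<Delta> u0 by (simp add: M_def)
  have Ey: "real n * \<delta> * M / \<gamma> = ?y"
    using n0 s u0 by (simp add: \<gamma>_def powr_minus field_simps)
  have "(vlen n (\<lambda>m. eigenproj q (v \<theta>) i m - eigenproj q (v \<theta>') i m))\<^sup>2
      \<le> 2 * real q * (real n * \<delta> * M / \<gamma>)\<^sup>2"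
    by (rule eigenproj_perturbation[OF ebA q(2) \<gamma>0 gap A_Lip i])
  also have "\<dots> = (sqrt (2 * real q) * ?y)\<^sup>2"
    unfolding Ey power_mult_distrib by simp
  finally have "vlen n (\<lambda>m. eigenproj q (v \<theta>) i m - eigenproj q (v \<theta>') i m)
      \<le> sqrt (2 * real q) * ?y"
    by (rule power2_le_imp_le) (use M0 s \<delta>0 in simp)
  then show ?thesis unfolding M_def \<delta>_def .
qed

section \<open>Fourier coefficients and the modulus of continuity\<close>

lemma cmod_le_vlen: "m < n \<Longrightarrow> cmod (x m) \<le> vlen n x"
  unfolding vlen_def by (rule member_le_L2_set) auto

lemma dotp_integral_left:
  assumes "\<And>m. m < n \<Longrightarrow> integrable lborel (\<lambda>\<theta>. f \<theta> m)"
  shows "dotp n (\<lambda>m. \<integral>\<theta>. f \<theta> m \<partial>lborel) y = (\<integral>\<theta>. dotp n (f \<theta>) y \<partial>lborel)"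
  unfolding dotp_def using assms by (subst Bochner_Integration.integral_sum) auto

text \<open>
  Minkowski's integral inequality.  It follows by pairing the integral \<open>I\<close> with itself: the inner
  product moves under the integral sign and is at most \<open>W \<theta> * \<parallel>I\<parallel>\<close> there.  In contrast to a bound
  for each component, this does not involve the dimension.
\<close>

lemma vlen_integral_le:
  fixes f :: "real \<Rightarrow> nat \<Rightarrow> complex"
  assumes f: "\<And>m. m < n \<Longrightarrow> integrable lborel (\<lambda>\<theta>. f \<theta> m)"
    and W: "integrable lborel W" "\<And>\<theta>. vlen n (f \<theta>) \<le> W \<theta>"
  shows "vlen n (\<lambda>m. \<integral>\<theta>. f \<theta> m \<partial>lborel) \<le> (\<integral>\<theta>. W \<theta> \<partial>lborel)"
proof -
  define I where "I = (\<lambda>m. \<integral>\<theta>. f \<theta> m \<partial>lborel)"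
  have W0: "0 \<le> W \<theta>" for \<theta> using W(2)[of \<theta>] vlen_nonneg order_trans by blast
  have int: "integrable lborel (\<lambda>\<theta>. dotp n (f \<theta>) I)"
    unfolding dotp_def using f by (intro Bochner_Integration.integrable_sum integrable_mult_left)
        auto
  have "(vlen n I)\<^sup>2 = cmod (dotp n I I)"
    unfolding dotp_self norm_of_real by simp
  also have "dotp n I I = (\<integral>\<theta>. dotp n (f \<theta>) I \<partial>lborel)"
    unfolding I_def by (rule dotp_integral_left[OF f])
  also have "cmod \<dots> \<le> (\<integral>\<theta>. cmod (dotp n (f \<theta>) I) \<partial>lborel)"
    by (rule integral_norm_bound)
  also have "\<dots> \<le> (\<integral>\<theta>. W \<theta> * vlen n I \<partial>lborel)"
  proof (rule integral_mono)
    fix \<theta>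
    show "cmod (dotp n (f \<theta>) I) \<le> W \<theta> * vlen n I"
      by (rule order_trans[OF Cauchy_Schwarz_dotp]) (intro mult_right_mono W vlen_nonneg)
  qed (use int W in auto)
  finally have *: "vlen n I * vlen n I \<le> (\<integral>\<theta>. W \<theta> \<partial>lborel) * vlen n I"
    by (simp add: power2_eq_square)
  show ?thesis
  proof (cases "vlen n I = 0")
    case True
    then show ?thesis using W0 unfolding I_def by (simp add: integral_nonneg)
  next
    case False
    then have "0 < vlen n I" using vlen_nonneg[of n I] by linarith
    with * show ?thesis unfolding I_def by (simp only: mult_le_cancel_right_pos)
  qed
qed

lemma continuous_on_of_modulus:
  fixes F :: "real \<Rightarrow> nat \<Rightarrow> complex"
  assumes mod: "\<And>\<theta> \<theta>'. \<theta> \<in> S \<Longrightarrow> \<theta>' \<in> S \<Longrightarrow>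
      vlen n (\<lambda>m. F \<theta> m - F \<theta>' m) \<le> C * \<bar>\<theta> - \<theta>'\<bar> * (min \<bar>\<theta>\<bar> \<bar>\<theta>'\<bar>) powr (- \<beta>)"
    and S: "0 \<notin> S" and m: "m < n"
  shows "continuous_on S (\<lambda>\<theta>. F \<theta> m)"
  unfolding continuous_on_def
proof
  fix x assume x: "x \<in> S"
  then have "x \<noteq> 0" using S by auto
  have lim: "((\<lambda>\<theta>. C * \<bar>\<theta> - x\<bar> * (min \<bar>\<theta>\<bar> \<bar>x\<bar>) powr (- \<beta>)) \<longlongrightarrow> C * \<bar>x - x\<bar> * (min \<bar>x\<bar> \<bar>x\<bar>) powr (-
      \<beta>)) (at x within S)"
    using \<open>x \<noteq> 0\<close> by (intro tendsto_intros) auto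
  have "((\<lambda>\<theta>. F \<theta> m - F x m) \<longlongrightarrow> 0) (at x within S)"
  proof (rule Lim_null_comparison)
    show "\<forall>\<^sub>F \<theta> in at x within S. cmod (F \<theta> m - F x m) \<le> C * \<bar>\<theta> - x\<bar> * (min \<bar>\<theta>\<bar> \<bar>x\<bar>) powr (- \<beta>)"
      unfolding eventually_at_filter
      by (rule always_eventually) (use x mod order_trans[OF cmod_le_vlen[OF m]] in blast)
  qed (use lim in simp)
  then show "((\<lambda>\<theta>. F \<theta> m) \<longlongrightarrow> F x m) (at x within S)"
    by (rule LIM_zero_cancel)
qed

text \<open>
  The value of \<open>F\<close> at \<open>0\<close> is arbitrary, and \<open>F\<close> may jump from \<open>pi\<close> to \<open>- pi\<close>.  Measurability is a
  consequence of the modulus of continuity, which makes \<open>F\<close> continuous on either side of \<open>0\<close>.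
\<close>

lemma Fourier_integral_decay:
  fixes F :: "real \<Rightarrow> nat \<Rightarrow> complex" and h :: int
  assumes F1: "\<And>\<theta>. \<theta> \<in> Freq \<Longrightarrow> \<theta> \<noteq> 0 \<Longrightarrow> vlen n (F \<theta>) \<le> 1"
    and C: "0 \<le> C"
    and mod: "\<And>\<theta> \<theta>'. \<theta> \<in> Freq \<Longrightarrow> \<theta>' \<in> Freq \<Longrightarrow> 0 < \<theta> * \<theta>' \<Longrightarrow>
      vlen n (\<lambda>m. F \<theta> m - F \<theta>' m) \<le> C * \<bar>\<theta> - \<theta>'\<bar> * (min \<bar>\<theta>\<bar> \<bar>\<theta>'\<bar>) powr (- \<beta>)"
    and h: "h \<noteq> 0" and \<eta>: "\<eta> = pi / of_int \<bar>h\<bar>"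
    and J: "has_bochner_integral lborel (\<lambda>x. x powr (- \<beta>) * indicator {\<eta>..pi} x) J"
  shows "vlen n (\<lambda>m. LINT \<theta>:Freq|lborel. F \<theta> m * cis (- (of_int h * \<theta>))) \<le> 5 * \<eta> + C * \<eta> * J"
proof -
  define e where "e = (\<lambda>\<theta>. cis (- (of_int h * \<theta>)))"
  have e_eq: "cis (- (of_int h * \<theta>)) = e \<theta>" for \<theta> by (simp add: e_def)
  define E where "E = (\<lambda>\<theta> m. if \<theta> \<in> Freq - {0} then F \<theta> m else 0)"
  have \<eta>0: "0 < \<eta>" using h by (simp add: \<eta>)
  have e_meas [measurable]: "e \<in> borel_measurable borel"
    unfolding e_def cis_conv_exp by measurable
  have cmod_e [simp]: "cmod (e \<theta>) = 1" for \<theta> by (simp add: e_def)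
  have e_shift: "e (\<eta> + \<theta>) = - e \<theta>" for \<theta>
  proof -
    have "of_int h * \<eta> = pi \<or> of_int h * \<eta> = - pi"
      using h by (cases "0 < h") (auto simp: \<eta> abs_if)
    then have "cis (- (of_int h * \<eta>)) = -1"
      by (elim disjE) (simp_all add: complex_eq_iff)
    moreover have "e (\<eta> + \<theta>) = cis (- (of_int h * \<eta>)) * e \<theta>"
      by (simp add: e_def cis_mult algebra_simps)
    ultimately show ?thesis by simp
  qed
  have E_meas [measurable]: "(\<lambda>\<theta>. E \<theta> m) \<in> borel_measurable borel" if m: "m < n" for m
  proof -
    have "(\<lambda>\<theta>. E \<theta> m) = (\<lambda>\<theta>. indicator {0<..pi} \<theta> *\<^sub>R F \<theta> m + indicator {-pi<..<0} \<theta> *\<^sub>R F \<theta> m)"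
      by (auto simp: E_def indicator_def)
    moreover have "continuous_on {0<..pi} (\<lambda>\<theta>. F \<theta> m)"
      by (rule continuous_on_of_modulus[OF mod _ m]) (auto intro: mult_pos_pos)
    moreover have "continuous_on {-pi<..<0} (\<lambda>\<theta>. F \<theta> m)"
      by (rule continuous_on_of_modulus[OF mod _ m]) (auto intro: mult_neg_neg)
    ultimately show ?thesis
      by (auto intro!: borel_measurable_add borel_measurable_continuous_on_indicator)
  qed
  have E1: "vlen n (E \<theta>) \<le> 1" for \<theta>
  proof (cases "\<theta> \<in> Freq - {0}")
    case True
    then have "E \<theta> = F \<theta>" by (simp add: E_def)
    then show ?thesis using True F1 by simp
  next
    case False
    then have "vlen n (E \<theta>) = 0" by (auto simp: vlen_eq_0_iff E_def)
    then show ?thesis by simp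
  qed
  have Ee_int: "integrable lborel (\<lambda>\<theta>. E \<theta> m * e \<theta>)" if m: "m < n" for m
  proof (rule Bochner_Integration.integrable_bound)
    show "integrable lborel (indicator {-pi..pi} :: real \<Rightarrow> real)" by simp
    have "cmod (E \<theta> m) \<le> indicator {-pi..pi} \<theta>" for \<theta>
    proof (cases "\<theta> \<in> {-pi..pi}")
      case True
      then show ?thesis using order_trans[OF cmod_le_vlen[OF m] E1[of \<theta>]] by simp
    qed (auto simp: E_def)
    then show "AE \<theta> in lborel. norm (E \<theta> m * e \<theta>) \<le> norm (indicator {-pi..pi} \<theta> :: real)"
      by (intro AE_I2) (simp add: norm_mult)
  qed (use m in measurable)
  define I where "I = (\<lambda>m. \<integral>\<theta>. E \<theta> m * e \<theta> \<partial>lborel)"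
  have I: "(LINT \<theta>:Freq|lborel. F \<theta> m * cis (- (of_int h * \<theta>))) = I m" if m: "m < n" for m
    unfolding I_def set_lebesgue_integral_def e_eq
  proof (rule integral_cong_AE)
    have "(\<lambda>\<theta>. indicator Freq \<theta> *\<^sub>R (F \<theta> m * e \<theta>)) = (\<lambda>\<theta>. E \<theta> m * e \<theta> + indicator {0} \<theta> *\<^sub>R (F 0 m
        * e \<theta>))"
      by (auto simp: E_def indicator_def)
    also have "\<dots> \<in> borel_measurable lborel" using m by measurable
    finally show "(\<lambda>\<theta>. indicator Freq \<theta> *\<^sub>R (F \<theta> m * e \<theta>)) \<in> borel_measurable lborel" .
    show "(\<lambda>\<theta>. E \<theta> m * e \<theta>) \<in> borel_measurable lborel" using m by measurable
    show "AE \<theta> in lborel. indicator Freq \<theta> *\<^sub>R (F \<theta> m * e \<theta>) = E \<theta> m * e \<theta>"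
      using AE_lborel_singleton[of 0] by eventually_elim (auto simp: E_def indicator_def)
  qed
  define D where "D = (\<lambda>\<theta> m. (E \<theta> m - E (\<eta> + \<theta>) m) * e \<theta>)"
  have shifted_int: "integrable lborel (\<lambda>\<theta>. E (\<eta> + \<theta>) m * e \<theta>)"
    and shifted: "(\<integral>\<theta>. E (\<eta> + \<theta>) m * e \<theta> \<partial>lborel) = - I m" if m: "m < n" for m
  proof -
    have eq: "E (\<eta> + 1 * \<theta>) m * e (\<eta> + 1 * \<theta>) = - (E (\<eta> + \<theta>) m * e \<theta>)" for \<theta>
      by (simp add: e_shift)
    show "integrable lborel (\<lambda>\<theta>. E (\<eta> + \<theta>) m * e \<theta>)"
      using lborel_integrable_real_affine[OF Ee_int[OF m], of 1 \<eta>] unfolding eq by simp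
    show "(\<integral>\<theta>. E (\<eta> + \<theta>) m * e \<theta> \<partial>lborel) = - I m"
      using lborel_integral_real_affine[of 1 "\<lambda>\<theta>. E \<theta> m * e \<theta>" \<eta>] unfolding eq I_def by simp
  qed
  have D_int: "integrable lborel (\<lambda>\<theta>. D \<theta> m)" if "m < n" for m
    unfolding D_def left_diff_distrib using Ee_int shifted_int that by auto
  have D_eq: "(\<integral>\<theta>. D \<theta> m \<partial>lborel) = 2 * I m" if "m < n" for m
    unfolding D_def left_diff_distrib using Ee_int shifted_int shifted that by (simp add: I_def)
  \<comment> \<open>The majorant is \<open>2\<close> where a frequency or its shift is close to \<open>0\<close> or to an end of the interval,
    and comes from the modulus of continuity otherwise: the nearer of \<open>\<theta>\<close> and \<open>\<eta> + \<theta>\<close> to \<open>0\<close> is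
    \<open>\<theta>\<close> on the right of \<open>0\<close> and \<open>\<eta> + \<theta>\<close> on the left.\<close>
  define G where "G = (\<lambda>x. x powr (- \<beta>) * indicator {\<eta>..pi} x :: real)"
  define W where "W = (\<lambda>\<theta>. 2 * indicator {-pi-\<eta>..-pi} \<theta> + 2 * indicator {pi-\<eta>..pi} \<theta>
      + 2 * indicator {-2*\<eta>..\<eta>} \<theta>
      + C * \<eta> * G \<theta> + C * \<eta> * G (-\<eta> + (-1) * \<theta>) :: real)"
  have G: "has_bochner_integral lborel G J" using J by (simp add: G_def)
  then have G_int: "integrable lborel G" and G_eq: "(\<integral>\<theta>. G \<theta> \<partial>lborel) = J"
    by (auto simp: has_bochner_integral_iff)
  have G'_int: "integrable lborel (\<lambda>\<theta>. G (-\<eta> + (-1) * \<theta>))"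
    by (rule lborel_integrable_real_affine[OF G_int]) simp
  have G'_eq: "(\<integral>\<theta>. G (-\<eta> + (-1) * \<theta>) \<partial>lborel) = J"
    using lborel_integral_real_affine[of "-1" G "-\<eta>"] G_eq by simp
  have ind_int: "integrable lborel (indicator {a..b} :: real \<Rightarrow> real)" for a b
    by (rule integrable_real_indicator) (auto simp: emeasure_lborel_Icc_eq)
  have W_int: "integrable lborel W"
    unfolding W_def by (intro Bochner_Integration.integrable_add integrable_mult_right G_int
        G'_int ind_int)
  have W_eq: "(\<integral>\<theta>. W \<theta> \<partial>lborel) = 10 * \<eta> + 2 * (C * \<eta> * J)"
    unfolding W_def using \<eta>0 G_int G'_int ind_int
    by (simp add: G_eq G'_eq[simplified])
  have W_ge: "vlen n (D \<theta>) \<le> W \<theta>" for \<theta>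
  proof -
    have vD: "vlen n (D \<theta>) = vlen n (\<lambda>m. E \<theta> m - E (\<eta> + \<theta>) m)"
      unfolding D_def by (simp add: vlen_def norm_mult)
    have G0: "0 \<le> G x" for x by (simp add: G_def)
    have ind0: "0 \<le> (indicator {-pi-\<eta>..-pi} \<theta> :: real)" "0 \<le> (indicator {pi-\<eta>..pi} \<theta> :: real)"
      "0 \<le> (indicator {-2*\<eta>..\<eta>} \<theta> :: real)"
      by auto
    have CG0: "0 \<le> C * \<eta> * G x" for x using C \<eta>0 G0 by simp
    consider "\<theta> \<in> {-pi-\<eta>..-pi} \<union> {pi-\<eta>..pi} \<union> {-2*\<eta>..\<eta>}" | "\<theta> < -pi-\<eta> \<or> pi < \<theta>"
      | "-pi < \<theta>" "\<theta> < -2*\<eta>" | "\<eta> < \<theta>" "\<theta> < pi - \<eta>"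
      by fastforce
    then show ?thesis
    proof cases
      case 1
      have "vlen n (D \<theta>) \<le> 2"
        unfolding vD using vlen_triangle_diff[of n "E \<theta>" "E (\<eta> + \<theta>)"] E1[of \<theta>] E1[of "\<eta> + \<theta>"]
            by linarith
      also have "2 \<le> 2 * indicator {-pi-\<eta>..-pi} \<theta> + 2 * indicator {pi-\<eta>..pi} \<theta>
          + (2 * indicator {-2*\<eta>..\<eta>} \<theta> :: real)"
        using 1 by (auto simp: indicator_def)
      finally show ?thesis
        unfolding W_def using CG0[of \<theta>] CG0[of "-\<eta> + (-1) * \<theta>"] by linarith
    next
      case 2
      then have "E \<theta> = (\<lambda>_. 0)" "E (\<eta> + \<theta>) = (\<lambda>_. 0)"
        using \<eta>0 by (auto simp: E_def)
      then have "vlen n (D \<theta>) = 0" by (simp add: D_def vlen_eq_0_iff)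
      then show ?thesis
        unfolding W_def using CG0[of \<theta>] CG0[of "-\<eta> + (-1) * \<theta>"] by simp
    next
      case 3
      have "vlen n (D \<theta>) = vlen n (\<lambda>m. F \<theta> m - F (\<eta> + \<theta>) m)"
        unfolding vD using 3 \<eta>0 pi_gt_zero by (intro vlen_cong) (auto simp: E_def)
      also have "\<dots> \<le> C * \<bar>\<theta> - (\<eta> + \<theta>)\<bar> * (min \<bar>\<theta>\<bar> \<bar>\<eta> + \<theta>\<bar>) powr (- \<beta>)"
        using 3 \<eta>0 pi_gt_zero by (intro mod mult_neg_neg) auto
      also have "\<dots> = C * \<eta> * G (-\<eta> + (-1) * \<theta>)"
        using 3 \<eta>0 by (simp add: G_def min_def)
      finally show ?thesis
        unfolding W_def using CG0[of \<theta>] ind0 by linarith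
    next
      case 4
      have "vlen n (D \<theta>) = vlen n (\<lambda>m. F \<theta> m - F (\<eta> + \<theta>) m)"
        unfolding vD using 4 \<eta>0 pi_gt_zero by (intro vlen_cong) (auto simp: E_def)
      also have "\<dots> \<le> C * \<bar>\<theta> - (\<eta> + \<theta>)\<bar> * (min \<bar>\<theta>\<bar> \<bar>\<eta> + \<theta>\<bar>) powr (- \<beta>)"
        using 4 \<eta>0 pi_gt_zero by (intro mod mult_pos_pos) auto
      also have "\<dots> = C * \<eta> * G \<theta>"
        using 4 \<eta>0 by (simp add: G_def min_def)
      finally show ?thesis
        unfolding W_def using CG0[of "-\<eta> + (-1) * \<theta>"] ind0 by linarith
    qed
  qed
  have "2 * vlen n I = vlen n (\<lambda>m. 2 * I m)"
    using vlen_scale[of n 2 I] by simp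
  also have "\<dots> = vlen n (\<lambda>m. \<integral>\<theta>. D \<theta> m \<partial>lborel)"
    by (rule vlen_cong) (simp add: D_eq)
  also have "\<dots> \<le> (\<integral>\<theta>. W \<theta> \<partial>lborel)"
    by (rule vlen_integral_le[OF D_int W_int W_ge])
  finally have "vlen n I \<le> 5 * \<eta> + C * \<eta> * J"
    unfolding W_eq by simp
  moreover have "vlen n (\<lambda>m. LINT \<theta>:Freq|lborel. F \<theta> m * cis (- (of_int h * \<theta>))) = vlen n I"
    by (rule vlen_cong) (rule I)
  ultimately show ?thesis by simp
qed

section \<open>From the modulus of continuity to the rate\<close>

text \<open>
  For \<open>\<Delta> > 0\<close> the term with \<open>\<Delta> / u\<close> dominates.  For \<open>\<Delta> = 0\<close> that term is absent and the
  exponent \<open>2 * d - 1\<close> of the last one, if present, is integrable at \<open>0\<close>.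
\<close>

lemma modulus_power_bound:
  fixes A0 A1 A2 d \<Delta> :: real
  assumes A: "0 \<le> A0" "0 \<le> A1" "0 \<le> A2" and d: "0 \<le> \<Delta>" "\<Delta> \<le> d" "2 * d \<le> 1"
  shows "\<exists>K \<beta>. 0 \<le> K \<and> (0 < \<Delta> \<longrightarrow> \<beta> = 1 + 2 * \<Delta>) \<and> (\<Delta> = 0 \<longrightarrow> \<beta> < 1) \<and>
    (\<forall>u. 0 < u \<and> u \<le> 2 \<longrightarrow>
      (A0 + A1 * \<Delta> / u + A2 * d * u powr (2 * d - 1)) * u powr (- 2 * \<Delta>) \<le> K * u powr (- \<beta>))"
proof -
  consider "0 < \<Delta>" | "\<Delta> = 0" "0 < d" | "\<Delta> = 0" "d = 0" using d by fastforce
  then show ?thesis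
  proof cases
    case 1
    define K where "K = 2 * A0 + A1 * \<Delta> + 2 * A2 * d"
    have "(A0 + A1 * \<Delta> / u + A2 * d * u powr (2 * d - 1)) * u powr (- 2 * \<Delta>)
        \<le> K * u powr (- (1 + 2 * \<Delta>))"
      if u: "0 < u" "u \<le> 2" for u
    proof -
      define w where "w = u powr (- (1 + 2 * \<Delta>))"
      have w: "u powr (- 2 * \<Delta>) = u * w"
      proof -
        have "u powr 1 * u powr (- (1 + 2 * \<Delta>)) = u powr (- 2 * \<Delta>)"
          unfolding powr_add[symmetric] by simp
        then show ?thesis using u by (simp add: w_def)
      qed
      have "u powr (2 * d - 1) * (u * w) = u powr (2 * d) * w"
        using u by (simp add: powr_diff)
      then have "(A0 + A1 * \<Delta> / u + A2 * d * u powr (2 * d - 1)) * (u * w)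
          = (A0 * u + A1 * \<Delta> + A2 * d * u powr (2 * d)) * w"
        using u by (simp add: algebra_simps)
      also have "\<dots> \<le> (A0 * 2 + A1 * \<Delta> + A2 * d * 2) * w"
        using A d u by (intro mult_right_mono add_mono mult_left_mono powr_le_2) (auto simp: w_def)
      finally show ?thesis unfolding w w_def[symmetric] by (simp add: K_def algebra_simps)
    qed
    moreover have "0 \<le> K" using A d by (simp add: K_def)
    ultimately show ?thesis using 1 by (intro exI[of _ K] exI[of _ "1 + 2 * \<Delta>"]) simp
  next
    case 2
    define K where "K = 2 * A0 + A2 * d"
    have "(A0 + A1 * \<Delta> / u + A2 * d * u powr (2 * d - 1)) * u powr (- 2 * \<Delta>)
        \<le> K * u powr (- (1 - 2 * d))"
      if u: "0 < u" "u \<le> 2" for u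
    proof -
      have "A0 = A0 * (u powr (1 - 2 * d) * u powr (2 * d - 1))"
        using u by (simp flip: powr_add)
      also have "\<dots> \<le> A0 * (2 * u powr (2 * d - 1))"
        using A d u by (intro mult_left_mono mult_right_mono powr_le_2) auto
      finally show ?thesis using 2 u by (simp add: K_def algebra_simps)
    qed
    moreover have "0 \<le> K" using A d by (simp add: K_def)
    ultimately show ?thesis using 2 by (intro exI[of _ K] exI[of _ "1 - 2 * d"]) simp
  next
    case 3
    then show ?thesis using A by (intro exI[of _ A0] exI[of _ 0]) simp
  qed
qed

lemma has_bochner_integral_powr:
  fixes \<eta> b \<beta> :: real
  assumes "0 < \<eta>" "\<eta> \<le> b" "\<beta> \<noteq> 1"
  shows "has_bochner_integral lborel (\<lambda>x. x powr (- \<beta>) * indicator {\<eta>..b} x)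
    ((b powr (1 - \<beta>) - \<eta> powr (1 - \<beta>)) / (1 - \<beta>))"
proof -
  have "has_bochner_integral lborel (\<lambda>x. x powr (- \<beta>) * indicator {\<eta>..b} x)
    (b powr (1 - \<beta>) / (1 - \<beta>) - \<eta> powr (1 - \<beta>) / (1 - \<beta>))"
  proof (rule has_bochner_integral_FTC_Icc_real[where F = "\<lambda>x. x powr (1 - \<beta>) / (1 - \<beta>)"])
    fix x assume "\<eta> \<le> x" "x \<le> b"
    then have x: "0 < x" using assms by simp
    show "((\<lambda>x. x powr (1 - \<beta>) / (1 - \<beta>)) has_real_derivative x powr (- \<beta>)) (at x)"
      using x assms(3) by (auto intro!: derivative_eq_intros)
    show "isCont (\<lambda>x. x powr (- \<beta>)) x"
      using x by (intro continuous_intros) auto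
  qed (use assms in simp)
  then show ?thesis by (simp add: diff_divide_distrib)
qed

text \<open>
  With \<open>\<eta> = pi / \<bar>h\<bar>\<close>, the integral \<open>J\<close> of \<open>x powr (- \<beta>)\<close> over \<open>{\<eta>..pi}\<close> is
  \<open>O(\<eta> powr (- 2 * \<Delta>))\<close> if \<open>\<Delta> > 0\<close> and bounded if \<open>\<Delta> = 0\<close>.
\<close>

lemma decay_rate:
  fixes \<beta> \<Delta> C :: real
  assumes \<Delta>: "0 \<le> \<Delta>" and \<beta>: "0 < \<Delta> \<longrightarrow> \<beta> = 1 + 2 * \<Delta>" "\<Delta> = 0 \<longrightarrow> \<beta> < 1" and C: "0 \<le> C"
  shows "\<exists>C'. \<forall>h::int. h \<noteq> 0 \<longrightarrow> (\<exists>J.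
    has_bochner_integral lborel (\<lambda>x. x powr (- \<beta>) * indicator {pi / of_int \<bar>h\<bar>..pi} x) J \<and>
    5 * (pi / of_int \<bar>h\<bar>) + C * (pi / of_int \<bar>h\<bar>) * J \<le> C' * of_int \<bar>h\<bar> powr (2 * \<Delta> - 1))"
proof -
  define J where "J = (\<lambda>\<eta>. (pi powr (1 - \<beta>) - \<eta> powr (1 - \<beta>)) / (1 - \<beta>))"
  define K where "K = (if \<Delta> = 0 then pi * pi powr (1 - \<beta>) / (1 - \<beta>) else pi powr (1
      - 2 * \<Delta>) / (2 * \<Delta>))"
  have \<beta>1: "\<beta> \<noteq> 1" using \<Delta> \<beta> by auto
  have main: "5 * \<eta> + C * \<eta> * J \<eta> \<le> (5 * pi + C * K) * x powr (2 * \<Delta> - 1)" "\<eta> \<le> pi" "0 < \<eta>"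
    if x: "1 \<le> x" and \<eta>: "\<eta> = pi / x" for x \<eta>
  proof -
    show \<eta>0: "0 < \<eta>" "\<eta> \<le> pi" using x by (simp_all add: \<eta> field_simps)
    have "1 / x = x powr (- 1)" using x by (simp add: powr_minus field_simps)
    also have "\<dots> \<le> x powr (2 * \<Delta> - 1)" using x \<Delta> by (intro powr_mono) auto
    finally have "1 / x \<le> x powr (2 * \<Delta> - 1)" .
    then have "5 * pi * (1 / x) \<le> 5 * pi * x powr (2 * \<Delta> - 1)" by (intro mult_left_mono) auto
    then have 1: "5 * \<eta> \<le> 5 * pi * x powr (2 * \<Delta> - 1)" by (simp add: \<eta>)
    have "\<eta> * J \<eta> \<le> K * x powr (2 * \<Delta> - 1)"
    proof (cases "\<Delta> = 0")
      case True
      then have b: "0 < 1 - \<beta>" using \<beta> by simp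
      have "\<eta> * J \<eta> \<le> \<eta> * (pi powr (1 - \<beta>) / (1 - \<beta>))"
        unfolding J_def using \<eta>0 b by (intro mult_left_mono divide_right_mono) auto
      also have "\<dots> = K * x powr (2 * \<Delta> - 1)"
        using True x by (simp add: K_def \<eta> powr_minus divide_inverse)
      finally show ?thesis .
    next
      case False
      then have D: "0 < \<Delta>" "\<beta> = 1 + 2 * \<Delta>" using \<Delta> \<beta> by auto
      have "J \<eta> = (\<eta> powr (- 2 * \<Delta>) - pi powr (- 2 * \<Delta>)) / (2 * \<Delta>)"
        using D by (simp add: J_def field_simps)
      also have "\<dots> \<le> \<eta> powr (- 2 * \<Delta>) / (2 * \<Delta>)"
        using D by (intro divide_right_mono) auto
      finally have "\<eta> * J \<eta> \<le> \<eta> * (\<eta> powr (- 2 * \<Delta>) / (2 * \<Delta>))"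
        using \<eta>0 by (intro mult_left_mono) auto
      also have "\<eta> * (\<eta> powr (- 2 * \<Delta>) / (2 * \<Delta>)) = \<eta> powr (1 - 2 * \<Delta>) / (2 * \<Delta>)"
        using \<eta>0 by (simp add: powr_diff powr_minus field_simps)
      also have "\<eta> powr (1 - 2 * \<Delta>) = pi powr (1 - 2 * \<Delta>) * x powr (2 * \<Delta> - 1)"
        using x by (simp add: \<eta> powr_divide powr_diff field_simps)
      finally show ?thesis using D by (simp add: K_def)
    qed
    then have "C * (\<eta> * J \<eta>) \<le> C * (K * x powr (2 * \<Delta> - 1))" using C by (intro mult_left_mono)
    with 1 show "5 * \<eta> + C * \<eta> * J \<eta> \<le> (5 * pi + C * K) * x powr (2 * \<Delta> - 1)"
      by (simp add: algebra_simps)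
  qed
  show ?thesis
  proof (rule exI[of _ "5 * pi + C * K"], intro allI impI)
    fix h :: int assume "h \<noteq> 0"
    then have "1 \<le> \<bar>h\<bar>" by simp
    then have x: "1 \<le> real_of_int \<bar>h\<bar>" by (metis of_int_1_le_iff)
    note m = main[OF x refl]
    show "\<exists>J. has_bochner_integral lborel (\<lambda>x. x powr (- \<beta>) * indicator {pi / of_int \<bar>h\<bar>..pi} x) J \<and>
      5 * (pi / of_int \<bar>h\<bar>) + C * (pi / of_int \<bar>h\<bar>) * J
          \<le> (5 * pi + C * K) * of_int \<bar>h\<bar> powr (2 * \<Delta> - 1)"
      using has_bochner_integral_powr[OF m(3,2) \<beta>1] m(1) unfolding J_def by blast
  qed
qed

section \<open>The conditions of the factor model as norm bounds\<close>

lemma eucl_norm_eq_vlen: "eucl_norm v = vlen (dim_vec v) (\<lambda>i. v $ i)"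
  by (simp add: eucl_norm_def vlen_def)

lemma eucl_norm_mult_mat_vec:
  assumes "A \<in> carrier_mat n m" "x \<in> carrier_vec m"
  shows "eucl_norm (A *\<^sub>v x) = vlen n (mapply m (\<lambda>i j. A $$ (i, j)) (\<lambda>j. x $ j))"
proof -
  have "vlen n (\<lambda>i. (A *\<^sub>v x) $ i) = vlen n (mapply m (\<lambda>i j. A $$ (i, j)) (\<lambda>j. x $ j))"
    by (rule vlen_cong) (rule mapply_mat[OF assms(2,1)])
  then show ?thesis
    using assms(1) by (simp add: eucl_norm_eq_vlen)
qed

text \<open>
  The supremum in the definition of \<open>op_norm\<close> is over a bounded set, because the Frobenius norm is
  finite; the general vector is reduced to the unit ball by scaling.
\<close>

lemma bounded_op_op_norm:
  assumes A: "A \<in> carrier_mat n m"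
  shows "bounded_op n m (\<lambda>i j. A $$ (i, j)) (op_norm A)"
proof -
  let ?A = "\<lambda>i j. A $$ (i, j)"
  let ?B = "{v :: complex vec. v \<in> carrier_vec (dim_col A) \<and> eucl_norm v \<le> 1}"
  obtain K where K: "bounded_op n m ?A K" using bounded_op_exists by blast
  have bdd: "bdd_above ((\<lambda>v. eucl_norm (A *\<^sub>v v)) ` ?B)"
  proof (rule bdd_aboveI2)
    fix v assume v: "v \<in> ?B"
    then have vm: "v \<in> carrier_vec m" using A by auto
    have "eucl_norm (A *\<^sub>v v) \<le> K * vlen m (\<lambda>j. v $ j)"
      unfolding eucl_norm_mult_mat_vec[OF A vm] by (rule bounded_opD[OF K])
    also have "\<dots> \<le> K * 1"
      using v vm K by (intro mult_left_mono) (auto simp: eucl_norm_eq_vlen bounded_op_def)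
    finally show "eucl_norm (A *\<^sub>v v) \<le> K" by simp
  qed
  have upper: "vlen n (mapply m ?A x) \<le> op_norm A" if "vlen m x \<le> 1" for x
  proof -
    have "vlen m (\<lambda>i. vec m x $ i) = vlen m x" by (rule vlen_cong) simp
    then have v: "vec m x \<in> ?B" using that A by (simp add: eucl_norm_eq_vlen)
    have "vlen n (mapply m ?A x) = eucl_norm (A *\<^sub>v vec m x)"
      by (subst eucl_norm_mult_mat_vec[OF A]) (simp_all add: mapply_def cong: vlen_cong)
    also have "\<dots> \<le> op_norm A"
      unfolding op_norm_def by (rule cSUP_upper[OF v bdd])
    finally show ?thesis .
  qed
  have nonneg: "0 \<le> op_norm A"
  proof -
    have "vlen m (\<lambda>_. 0) \<le> 1" by (simp add: vlen_def L2_set_def)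
    from order_trans[OF vlen_nonneg upper[OF this]] show ?thesis .
  qed
  have "vlen n (mapply m ?A x) \<le> op_norm A * vlen m x" for x
  proof (cases "vlen m x = 0")
    case True
    then show ?thesis using bounded_opD[OF K, of x] by simp
  next
    case False
    then have pos: "0 < vlen m x" using vlen_nonneg[of m x] by linarith
    let ?c = "complex_of_real (1 / vlen m x)"
    have "cmod ?c * vlen m x = 1" unfolding norm_of_real using pos by simp
    then have "vlen n (mapply m ?A (\<lambda>j. ?c * x j)) \<le> op_norm A"
      by (intro upper) (simp only: vlen_scale order_refl)
    then have "1 / vlen m x * vlen n (mapply m ?A x) \<le> op_norm A"
      unfolding mapply_scale vlen_scale norm_of_real using pos by simp
    then show ?thesis using pos by (simp add: field_simps)
  qed
  then show ?thesis using nonneg by (simp add: bounded_op_def)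
qed

lemma mat_adjoint_dim [simp]:
  "dim_row (mat_adjoint A) = dim_col A" "dim_col (mat_adjoint A) = dim_row A"
  by (simp_all add: mat_adjoint_def)

lemma mat_adjoint_index [simp]:
  "i < dim_col A \<Longrightarrow> j < dim_row A \<Longrightarrow> mat_adjoint A $$ (i, j) = cnj (A $$ (j, i))"
  for A :: "complex mat"
  by (simp add: mat_adjoint_def mat_of_rows_index)

lemma herm_of_hermitian_mat:
  assumes "hermitian_mat A" "A \<in> carrier_mat n n"
  shows "herm n (\<lambda>i j. A $$ (i, j))"
  unfolding herm_def using assms mat_adjoint_index[of _ A] by (metis carrier_matD hermitian_mat_def)

lemma Rayleigh_bounds_of_eigenvalues:
  assumes H: "H \<in> carrier_mat n n" "hermitian_mat H"
    and ev: "\<And>k. eigenvalue H k \<Longrightarrow> k \<in> complex_of_real ` {\<Lambda>1..\<Lambda>2}"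
  shows "\<bar>Re (dotp n (mapply n (\<lambda>i j. H $$ (i, j)) x) x)\<bar> \<le> (\<bar>\<Lambda>1\<bar> + \<bar>\<Lambda>2\<bar> + 1) * (vlen n x)\<^sup>2"
proof -
  let ?H = "\<lambda>i j. H $$ (i, j)"
  have herm: "herm n ?H" by (rule herm_of_hermitian_mat[OF H(2,1)])
  have eigen: "(\<forall>i<n. y i = 0) \<or> \<Lambda>1 \<le> \<mu> \<and> \<mu> \<le> \<Lambda>2"
    if y: "\<forall>i<n. mapply n ?H y i = complex_of_real \<mu> * y i" for \<mu> y
  proof (cases "\<forall>i<n. y i = 0")
    case False
    have "H *\<^sub>v vec n y = complex_of_real \<mu> \<cdot>\<^sub>v vec n y"
    proof (rule eq_vecI)
      fix i assume "i < dim_vec (complex_of_real \<mu> \<cdot>\<^sub>v vec n y)"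
      then have i: "i < n" by simp
      then have "(H *\<^sub>v vec n y) $ i = mapply n ?H y i"
        by (subst mapply_mat[OF _ H(1)]) (simp_all add: mapply_def)
      then show "(H *\<^sub>v vec n y) $ i = (complex_of_real \<mu> \<cdot>\<^sub>v vec n y) $ i"
        using y i by simp
    qed (use H in auto)
    moreover have "vec n y \<noteq> 0\<^sub>v n" using False by (metis index_vec index_zero_vec(1))
    ultimately have "eigenvalue H (complex_of_real \<mu>)"
      using H(1) unfolding eigenvalue_def eigenvector_def by (intro exI[of _ "vec n y"]) auto
    from ev[OF this] show ?thesis by auto
  qed auto
  have up: "Re (dotp n (mapply n ?H x) x) \<le> \<Lambda>2 * (vlen n x)\<^sup>2"
  proof (rule Rayleigh_le_of_eigenvalues_le[OF herm])
    fix \<mu> y assume \<mu>: "\<Lambda>2 < \<mu>" and y: "\<forall>i<n. mapply n ?H y i = complex_of_real \<mu> * y i"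
    show "\<forall>i<n. y i = 0" using eigen[OF y] \<mu> by (metis leD)
  qed
  have "Re (dotp n (mapply n (\<lambda>i j. - ?H i j) x) x) \<le> - \<Lambda>1 * (vlen n x)\<^sup>2"
  proof (rule Rayleigh_le_of_eigenvalues_le)
    show "herm n (\<lambda>i j. - ?H i j)" using herm by (simp add: herm_def)
    fix \<mu> y assume \<mu>: "- \<Lambda>1 < \<mu>"
      and y: "\<forall>i<n. mapply n (\<lambda>i j. - ?H i j) y i = complex_of_real \<mu> * y i"
    have "mapply n ?H y i = complex_of_real (- \<mu>) * y i" if "i < n" for i
    proof -
      have "mapply n ?H y i = - mapply n (\<lambda>i j. - ?H i j) y i"
        by (simp add: mapply_def sum_negf)
      also have "\<dots> = - (complex_of_real \<mu> * y i)" using y that by simp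
      finally show ?thesis by simp
    qed
    then have "\<forall>i<n. mapply n ?H y i = complex_of_real (- \<mu>) * y i" by blast
    moreover have "\<not> \<Lambda>1 \<le> - \<mu>" using \<mu> by linarith
    ultimately show "\<forall>i<n. y i = 0" using eigen by blast
  qed
  moreover have "dotp n (mapply n (\<lambda>i j. - ?H i j) x) x = - dotp n (mapply n ?H x) x"
    by (simp add: dotp_def mapply_def sum_negf)
  ultimately have lo: "\<Lambda>1 * (vlen n x)\<^sup>2 \<le> Re (dotp n (mapply n ?H x) x)" by simp
  have "\<Lambda>2 * (vlen n x)\<^sup>2 \<le> \<bar>\<Lambda>2\<bar> * (vlen n x)\<^sup>2" "- \<bar>\<Lambda>1\<bar> * (vlen n x)\<^sup>2 \<le> \<Lambda>1 * (vlen n x)\<^sup>2"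
    by (intro mult_right_mono; simp)+
  moreover have "0 \<le> \<bar>\<Lambda>1\<bar> * (vlen n x)\<^sup>2" "0 \<le> \<bar>\<Lambda>2\<bar> * (vlen n x)\<^sup>2" "0 \<le> (vlen n x)\<^sup>2" by auto
  ultimately show ?thesis
    using up lo unfolding distrib_right mult_1_left mult_minus_left abs_le_iff
    by (intro conjI) linarith+
qed

text \<open>
  The quadratic form of \<open>G\<^sup>* G\<close> at \<open>w\<close> is \<open>\<parallel>G w\<parallel>\<^sup>2\<close>.
\<close>

lemma loewner_le_scaled_gram:
  fixes c s :: real
  assumes G: "G \<in> carrier_mat n q"
  defines "S \<equiv> complex_of_real c \<cdot>\<^sub>m (mat_adjoint G * G)"
  shows "complex_of_real s \<cdot>\<^sub>m 1\<^sub>m q \<preceq> S \<Longrightarrow>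
      s * (vlen q w)\<^sup>2 \<le> c * (vlen n (mapply q (\<lambda>i l. G $$ (i, l)) w))\<^sup>2"
    and "S \<preceq> complex_of_real s \<cdot>\<^sub>m 1\<^sub>m q \<Longrightarrow>
      c * (vlen n (mapply q (\<lambda>i l. G $$ (i, l)) w))\<^sup>2 \<le> s * (vlen q w)\<^sup>2"
proof -
  let ?G = "\<lambda>i l. G $$ (i, l)"
  let ?g = "mapply q ?G w"
  let ?I = "complex_of_real s \<cdot>\<^sub>m (1\<^sub>m q :: complex mat)"
  have S: "S \<in> carrier_mat q q" using G by (auto simp: S_def)
  have form: "(M *\<^sub>v vec q w) \<bullet>c vec q w = dotp q (mapply q (\<lambda>i j. M $$ (i, j)) w) w"
    if M: "M \<in> carrier_mat q q" for M
  proof -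
    have "(M *\<^sub>v vec q w) \<bullet>c vec q w = dotp q (\<lambda>i. (M *\<^sub>v vec q w) $ i) w"
      using M by (simp add: scalar_prod_def dotp_def atLeast0LessThan)
    also have "\<dots> = dotp q (mapply q (\<lambda>i j. M $$ (i, j)) w) w"
      by (rule dotp_cong) (simp_all add: mapply_mat[OF _ M], simp add: mapply_def)
    finally show ?thesis .
  qed
  have Sw: "mapply q (\<lambda>i j. S $$ (i, j)) w i = complex_of_real c * mapply n (adjm ?G) ?g i"
      if i: "i < q" for i
  proof -
    have "S $$ (i, j) = complex_of_real c * (\<Sum>k<n. adjm ?G i k * ?G k j)" if "j < q" for j
      using that i G by (simp add: S_def scalar_prod_def adjm_def atLeast0LessThan)
    then have "mapply q (\<lambda>i j. S $$ (i, j)) w i = complex_of_real c * mapply q (\<lambda>i j. \<Sum>k<n. adjm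
        ?G i k * ?G k j) w i"
      by (simp add: mapply_def sum_distrib_left[where A = "{..<q}"] mult.assoc)
    then show ?thesis unfolding mapply_compose .
  qed
  have adj2: "adjm (adjm ?G) = ?G" by (simp add: adjm_def)
  have dS: "dotp q (mapply q (\<lambda>i j. S $$ (i, j)) w) w = complex_of_real (c * (vlen n ?g)\<^sup>2)"
  proof -
    have "dotp q (mapply q (\<lambda>i j. S $$ (i, j)) w) w
        = dotp q (\<lambda>i. complex_of_real c * mapply n (adjm ?G) ?g i) w"
      by (rule dotp_cong) (simp_all add: Sw)
    also have "\<dots> = complex_of_real c * dotp n ?g ?g"
      unfolding dotp_scale_left mapply_adjm[of q n "adjm ?G"] adj2 ..
    finally show ?thesis by (simp add: dotp_self)
  qed
  have dI: "dotp q (mapply q (\<lambda>i j. ?I $$ (i, j)) w) w = complex_of_real (s * (vlen q w)\<^sup>2)"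
  proof -
    have "mapply q (\<lambda>i j. ?I $$ (i, j)) w i = complex_of_real s * w i" if "i < q" for i
    proof -
      have "mapply q (\<lambda>i j. ?I $$ (i, j)) w i = (\<Sum>j<q. if i
          = j then complex_of_real s * w j else 0)"
        unfolding mapply_def using that by (intro sum.cong refl) simp
      then show ?thesis using that by simp
    qed
    then have "dotp q (mapply q (\<lambda>i j. ?I $$ (i, j)) w) w = dotp q (\<lambda>i. complex_of_real s * w i) w"
      by (intro dotp_cong) auto
    then show ?thesis by (simp add: dotp_scale_left dotp_self)
  qed
  have diff: "dotp q (mapply q (\<lambda>i j. (A - B) $$ (i, j)) w) w =
      dotp q (mapply q (\<lambda>i j. A $$ (i, j)) w) w - dotp q (mapply q (\<lambda>i j. B $$ (i, j)) w) w"
    if "A \<in> carrier_mat q q" "B \<in> carrier_mat q q" for A B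
    unfolding dotp_diff_left[symmetric]
    by (rule dotp_cong) (use that in \<open>simp_all add: mapply_def left_diff_distrib sum_subtractf\<close>)
  have I: "?I \<in> carrier_mat q q" by simp
  show "s * (vlen q w)\<^sup>2 \<le> c * (vlen n ?g)\<^sup>2" if "?I \<preceq> S"
  proof -
    have "0 \<le> Re (((S - ?I) *\<^sub>v vec q w) \<bullet>c vec q w)"
      using that S unfolding loewner_le_def by auto
    moreover have "S - ?I \<in> carrier_mat q q" using S by auto
    ultimately show ?thesis
      by (simp only: form diff[OF S I] dS dI) simp
  qed
  show "c * (vlen n ?g)\<^sup>2 \<le> s * (vlen q w)\<^sup>2" if "S \<preceq> ?I"
  proof -
    have "0 \<le> Re (((?I - S) *\<^sub>v vec q w) \<bullet>c vec q w)"
      using that S unfolding loewner_le_def by auto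
    moreover have "?I - S \<in> carrier_mat q q" using S by auto
    ultimately show ?thesis
      by (simp only: form diff[OF I S] dS dI) simp
  qed
qed

text \<open>
  The conjugate of a row eigenvector of a Hermitian matrix is a column eigenvector.
\<close>

lemma eigenbasis_of_ordered_row_eigenbasis:
  assumes A: "A \<in> carrier_mat n n" "hermitian_mat A" and p: "ordered_row_eigenbasis n A lam p"
  shows "eigenbasis n (\<lambda>i j. A $$ (i, j)) lam (\<lambda>j i. cnj (p j $ i))"
  unfolding eigenbasis_def
proof (intro conjI allI impI)
  have carr: "p j \<in> carrier_vec n" if "j < n" for j
    using p that by (simp add: ordered_row_eigenbasis_def)
  show herm: "herm n (\<lambda>i j. A $$ (i, j))" by (rule herm_of_hermitian_mat[OF A(2,1)])
  show "orthonormal n (\<lambda>j i. cnj (p j $ i))"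
    unfolding orthonormal_def
  proof (intro allI impI)
    fix j k assume jk: "j < n" "k < n"
    have "p k \<bullet>c p j = dotp n (\<lambda>i. cnj (p j $ i)) (\<lambda>i. cnj (p k $ i))"
      using carr[OF jk(1)] carr[OF jk(2)]
      by (simp add: scalar_prod_def dotp_def atLeast0LessThan mult.commute)
    moreover have "p k \<bullet>c p j = (if k = j then 1 else 0)"
      using p jk by (simp add: ordered_row_eigenbasis_def)
    ultimately show "dotp n (\<lambda>i. cnj (p j $ i)) (\<lambda>i. cnj (p k $ i)) = (if j = k then 1 else 0)"
      by auto
  qed
  fix j i assume ji: "j < n" "i < n"
  have At: "transpose_mat A \<in> carrier_mat n n" using A by simp
  have "(transpose_mat A *\<^sub>v p j) $ i = (complex_of_real (lam j) \<cdot>\<^sub>v p j) $ i"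
    using p ji by (simp add: ordered_row_eigenbasis_def)
  then have "(\<Sum>k<n. A $$ (k, i) * p j $ k) = complex_of_real (lam j) * p j $ i"
    using mapply_mat[OF carr[OF ji(1)] At ji(2)] A ji carr[OF ji(1)] by (simp add: mapply_def)
  then have "cnj (\<Sum>k<n. A $$ (k, i) * p j $ k) = cnj (complex_of_real (lam j) * p j $ i)"
    by (rule arg_cong)
  then have "(\<Sum>k<n. cnj (A $$ (k, i)) * cnj (p j $ k)) = complex_of_real (lam j) * cnj (p j $ i)"
    by simp
  then show "mapply n (\<lambda>i j. A $$ (i, j)) (\<lambda>i. cnj (p j $ i)) i
      = complex_of_real (lam j) * cnj (p j $ i)"
    using herm ji by (simp add: mapply_def herm_def)
next
  fix j k assume "j \<le> k \<and> k < n"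
  then show "lam k \<le> lam j" using p unfolding ordered_row_eigenbasis_def by blast
qed

lemma bounded_op_op_norm_diff:
  assumes "A \<in> carrier_mat n m" "B \<in> carrier_mat n m" "op_norm (A - B) \<le> K"
  shows "bounded_op n m (\<lambda>i j. A $$ (i, j) - B $$ (i, j)) K"
proof -
  have "A - B \<in> carrier_mat n m" using assms(2) by (rule minus_carrier_mat)
  from bounded_op_mono[OF bounded_op_op_norm[OF this] assms(3)] show ?thesis
    by (rule bounded_op_cong[THEN iffD1, rotated]) (use assms(1,2) in auto)
qed

text \<open>
  Multiplication by \<open>\<bar>1 - exp (- \<i> \<theta>)\<bar> powr (2 * D)\<close> distributes over the two factors of the Gram
  matrix as \<open>(1 - exp (- \<i> \<theta>)) powr D\<close> and its conjugate.  In the factor structure the complex powers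
  occur only through their moduli, so the same expression describes both structures.
\<close>

lemma memory_structure_gram:
  assumes mem: "memory_structure q d g \<Sigma>\<chi>" and q: "0 < q"
  shows "single_index n q (\<lambda>i l. D - d i l)"
    and "\<lbrakk>\<theta> \<in> Freq; \<theta> \<noteq> 0; i < n; j < n\<rbrakk> \<Longrightarrow>
      complex_of_real (norm (lag_symbol \<theta>) powr (2 * D)) * \<Sigma>\<chi> n \<theta> $$ (i, j) =
      gram q (\<lambda>i l. lag_symbol \<theta> powr complex_of_real (D - d i l) * transfer_fun (g i l) \<theta>) i j"
proof -
  let ?G = "loading_mat q g"
  have G: "?G n \<theta> \<in> carrier_mat n q" for n \<theta> by (simp add: loading_mat_def)
  have Gi: "?G n \<theta> $$ (i, l) = transfer_fun (g i l) \<theta>" if "i < n" "l < q" for n \<theta> i l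
    using that by (simp add: loading_mat_def)
  consider (factor) \<delta> where "\<forall>i. \<forall>l<q. d i l = \<delta> l"
      "\<forall>n. \<forall>\<theta>\<in>Freq - {0}. \<Sigma>\<chi> n \<theta> = ?G n \<theta> *
        mat_diag q (\<lambda>l. complex_of_real (norm (lag_symbol \<theta>) powr (- 2 * \<delta> l))) * mat_adjoint (?G
            n \<theta>)"
    | (row) \<delta> where "\<forall>i. \<forall>l<q. d i l = \<delta> i"
      "\<forall>n. \<forall>\<theta>\<in>Freq - {0}. \<Sigma>\<chi> n \<theta> = mat_diag n (\<lambda>i. lag_symbol \<theta> powr complex_of_real (- \<delta> i)) * ?G
          n \<theta> *
        mat_adjoint (?G n \<theta>) * mat_adjoint (mat_diag n (\<lambda>i. lag_symbol \<theta> powr complex_of_real (- \<delta>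
            i)))"
    using mem unfolding memory_structure_def Let_def by blast
  note cases = this
  show "single_index n q (\<lambda>i l. D - d i l)"
    using cases
  proof cases
    case (factor \<delta>)
    then show ?thesis unfolding single_index_def by (intro disjI2 exI[of _ "\<lambda>l. D - \<delta> l"]) simp
  next
    case (row \<delta>)
    then show ?thesis unfolding single_index_def by (intro disjI1 exI[of _ "\<lambda>i. D - \<delta> i"]) simp
  qed
  assume \<theta>: "\<theta> \<in> Freq" "\<theta> \<noteq> 0" and ij: "i < n" "j < n"
  let ?z = "lag_symbol \<theta>"
  have z: "?z \<noteq> 0" by (rule lag_symbol_neq_0[OF \<theta>])
  have sq: "w powr complex_of_real c * cnj (w powr complex_of_real c)
      = complex_of_real (norm w powr (2 * c))" for w c
    unfolding complex_norm_square[symmetric] norm_powr_real_powr'[OF Reals_of_real]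
    using powr_power[of "norm w" c 2] by (cases "w = 0") (simp_all add: mult.commute)
  show "complex_of_real (norm ?z powr (2 * D)) * \<Sigma>\<chi> n \<theta> $$ (i, j) =
      gram q (\<lambda>i l. ?z powr complex_of_real (D - d i l) * transfer_fun (g i l) \<theta>) i j"
    using cases
  proof cases
    case (factor \<delta>)
    have entry: "\<Sigma>\<chi> n \<theta> $$ (i, j) = (\<Sum>l<q. transfer_fun (g i l) \<theta> *
        complex_of_real (norm ?z powr (- 2 * \<delta> l)) * cnj (transfer_fun (g j l) \<theta>))"
    proof -
      have "\<Sigma>\<chi> n \<theta> = ?G n \<theta> *
        mat_diag q (\<lambda>l. complex_of_real (norm ?z powr (- 2 * \<delta> l))) * mat_adjoint (?G n \<theta>)"
        using factor(2) \<theta> by blast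
      also have "\<dots> $$ (i, j) = (\<Sum>l<q. transfer_fun (g i l) \<theta> *
        complex_of_real (norm ?z powr (- 2 * \<delta> l)) * cnj (transfer_fun (g j l) \<theta>))"
        unfolding mat_diag_mult_right[OF G] using ij G[of n \<theta>] carrier_matD[OF G, of n \<theta>]
        by (simp add: scalar_prod_def atLeast0LessThan Gi)
      finally show ?thesis .
    qed
    have key: "complex_of_real (norm ?z powr (2 * D)) * complex_of_real (norm ?z powr (- 2 * \<delta> l)) =
      ?z powr complex_of_real (D - \<delta> l) * cnj (?z powr complex_of_real (D - \<delta> l))" for l
      unfolding sq of_real_mult[symmetric] powr_add[symmetric] by (simp add: algebra_simps)
    have "complex_of_real (norm ?z powr (2 * D)) * \<Sigma>\<chi> n \<theta> $$ (i, j) =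
      (\<Sum>l<q. complex_of_real (norm ?z powr (2 * D)) * complex_of_real (norm ?z powr (- 2 * \<delta> l)) *
        (transfer_fun (g i l) \<theta> * cnj (transfer_fun (g j l) \<theta>)))"
      by (simp only: entry sum_distrib_left ac_simps)
    also have "\<dots> = gram q (\<lambda>i l. ?z powr complex_of_real (D - d i l) * transfer_fun (g i l) \<theta>) i j"
      unfolding key gram_def
      by (intro sum.cong refl) (simp only: factor(1)[rule_format] lessThan_iff complex_cnj_mult
          ac_simps)
    finally show ?thesis .
  next
    case (row \<delta>)
    let ?D = "mat_diag n (\<lambda>i. ?z powr complex_of_real (- \<delta> i))"
    have entry: "\<Sigma>\<chi> n \<theta> $$ (i, j) = (\<Sum>l<q. ?z powr complex_of_real (- \<delta> i) * transfer_fun (g i l)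
        \<theta> *
        cnj (?z powr complex_of_real (- \<delta> j) * transfer_fun (g j l) \<theta>))"
    proof -
      have "mat_adjoint ?D = mat_diag n (\<lambda>i. cnj (?z powr complex_of_real (- \<delta> i)))"
        by (rule eq_matI) (auto simp: mat_diag_def)
      moreover have "\<Sigma>\<chi> n \<theta> = ?D * ?G n \<theta> * mat_adjoint (?G n \<theta>) * mat_adjoint ?D"
        using row(2) \<theta> by blast
      ultimately have eq: "\<Sigma>\<chi> n \<theta> = ?D * ?G n \<theta> * mat_adjoint (?G n \<theta>) * mat_diag n (\<lambda>i. cnj (?z
          powr complex_of_real (- \<delta> i)))"
        by simp
      have GA: "?D * ?G n \<theta> * mat_adjoint (?G n \<theta>) \<in> carrier_mat n n"
        by (rule carrier_matI) (simp_all add: mat_diag_def loading_mat_def)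
      show ?thesis
        unfolding eq mat_diag_mult_right[OF GA] unfolding mat_diag_mult_left[OF G]
        using ij G[of n \<theta>] carrier_matD[OF G, of n \<theta>]
        by (simp add: scalar_prod_def atLeast0LessThan Gi sum_distrib_right sum_distrib_left
            algebra_simps)
    qed
    have key: "complex_of_real (norm ?z powr (2 * D)) * (?z powr complex_of_real (- \<delta> i) * a * cnj
        (?z powr complex_of_real (- \<delta> j) * b)) =
      (?z powr complex_of_real (D - \<delta> i) * a) * cnj (?z powr complex_of_real (D - \<delta> j) * b)" for a b
    proof -
      have p: "?z powr complex_of_real (D - \<delta> k)
          = ?z powr complex_of_real D * ?z powr complex_of_real (- \<delta> k)" for k
        by (simp flip: powr_add)
      show ?thesis unfolding sq[symmetric] p complex_cnj_mult by (simp only: ac_simps)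
    qed
    have "complex_of_real (norm ?z powr (2 * D)) * \<Sigma>\<chi> n \<theta> $$ (i, j) =
      (\<Sum>l<q. complex_of_real (norm ?z powr (2 * D)) * (?z powr complex_of_real (- \<delta> i) *
          transfer_fun (g i l) \<theta> *
        cnj (?z powr complex_of_real (- \<delta> j) * transfer_fun (g j l) \<theta>)))"
      by (simp only: entry sum_distrib_left)
    also have "\<dots> = gram q (\<lambda>i l. ?z powr complex_of_real (D - d i l) * transfer_fun (g i l) \<theta>) i j"
      unfolding key gram_def
      by (intro sum.cong refl) (simp only: row(1)[rule_format] lessThan_iff)
    finally show ?thesis .
  qed
qed

section \<open>Decay of the eigenprojection rows\<close>

theorem lemmaD2:
  fixes M :: "'w measure" and q :: nat
    and b g :: "nat \<Rightarrow> nat \<Rightarrow> int \<Rightarrow> real" and d :: "nat \<Rightarrow> nat \<Rightarrow> real"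
    and dmax dmin \<Delta> :: real
    and u \<chi> \<xi> x :: "'w process" and \<epsilon> :: "nat \<Rightarrow> 'w process" and B :: "nat \<Rightarrow> int \<Rightarrow> real mat"
    and \<Sigma> \<Sigma>\<chi> \<Sigma>\<xi> :: "nat \<Rightarrow> real \<Rightarrow> complex mat"
    and lam :: "nat \<Rightarrow> real \<Rightarrow> nat \<Rightarrow> real" and p :: "nat \<Rightarrow> real \<Rightarrow> nat \<Rightarrow> complex vec"
  assumes model: "factor_model M q b u \<chi> \<xi> B \<epsilon>"
    and x: "\<forall>i t w. x i t w = \<chi> i t w + \<xi> i t w"
    and spec: "\<forall>n. is_spectral_density M n \<chi> (\<Sigma>\<chi> n) \<and> is_spectral_density M n \<xi> (\<Sigma>\<xi> n) \<and>
                   is_spectral_density M n x (\<Sigma> n)"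
    and spec_sum: "\<forall>n. \<forall>\<theta>\<in>Freq. \<Sigma> n \<theta> = \<Sigma>\<chi> n \<theta> + \<Sigma>\<xi> n \<theta>"
    and memory: "long_memory q b d g"
    and dmax: "(\<exists>i. \<exists>l<q. d i l = dmax) \<and> (\<forall>i. \<forall>l<q. d i l \<le> dmax)"
    and dmin: "(\<exists>i. \<exists>l<q. d i l = dmin) \<and> (\<forall>i. \<forall>l<q. dmin \<le> d i l)"
    and Delta: "\<Delta> = dmax - dmin"
    and loadings: "pervasive_loadings q g"
    and mem_struct: "memory_structure q d g \<Sigma>\<chi>"
    and idio: "idiosyncratic M \<epsilon> \<Sigma>\<xi>"
    and eigen: "\<forall>n. \<forall>\<theta>\<in>Freq - {0}. ordered_row_eigenbasis n (\<Sigma> n \<theta>) (lam n \<theta>) (p n \<theta>)"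
  shows "\<exists>C. \<forall>\<^sub>F n in sequentially. \<forall>i<n. \<forall>h::int. h \<noteq> 0 \<longrightarrow>
           eucl_norm (fourier_coeff_vec n (\<lambda>\<theta>. proj_row q n (p n \<theta>) i) h)
             \<le> C * of_int \<bar>h\<bar> powr (2 * \<Delta> - 1)"
proof -
  have q0: "0 < q" using model by (simp add: factor_model_def)
  have d: "0 \<le> d i l" "d i l < 1 / 2" "dmin \<le> d i l" "d i l \<le> dmax" if "l < q" for i l
    using memory dmax dmin that unfolding long_memory_def by blast+
  obtain i1 l1 i2 l2 where "l1 < q" "d i1 l1 = dmax" "l2 < q" "d i2 l2 = dmin"
    using dmax dmin by blast
  then have \<Delta>: "0 \<le> \<Delta>" "\<Delta> \<le> dmax" "2 * dmax \<le> 1"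
    using d[of l1 i1] d[of l2 i2] by (auto simp: Delta)
  have G: "loading_mat q g n \<theta> \<in> carrier_mat n q" for n \<theta> by (simp add: loading_mat_def)
  obtain s1 s2 where s: "0 < s1" "s1 \<le> s2" and S_bounds: "\<forall>\<^sub>F n in sequentially. \<forall>\<theta>\<in>Freq.
        complex_of_real s1 \<cdot>\<^sub>m 1\<^sub>m q \<preceq> complex_of_real (1 / real n) \<cdot>\<^sub>m (mat_adjoint (loading_mat
            q g n \<theta>) * loading_mat q g n \<theta>) \<and>
        complex_of_real (1 / real n) \<cdot>\<^sub>m (mat_adjoint (loading_mat q g n \<theta>) * loading_mat q g n \<theta>)
            \<preceq> complex_of_real s2 \<cdot>\<^sub>m 1\<^sub>m q"
    using loadings unfolding pervasive_loadings_def Let_def by blast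
  obtain L where G_Lip: "\<forall>\<^sub>F n in sequentially. \<forall>\<theta>1\<in>Freq. \<forall>\<theta>2\<in>Freq.
        op_norm (loading_mat q g n \<theta>2 - loading_mat q g n \<theta>1) \<le> sqrt (real n) * L * \<bar>\<theta>2 - \<theta>1\<bar>"
    using loadings unfolding pervasive_loadings_def Let_def by blast
  obtain \<Lambda>1 \<Lambda>2 where eig: "\<forall>\<^sub>F n in sequentially. \<forall>\<theta>\<in>Freq. \<forall>k. eigenvalue (\<Sigma>\<xi> n \<theta>) k \<longrightarrow>
        k \<in> complex_of_real ` {\<Lambda>1..\<Lambda>2}"
    using idio unfolding idiosyncratic_def by blast
  obtain Lx where X_Lip: "\<forall>\<^sub>F n in sequentially. \<forall>\<theta>1\<in>Freq. \<forall>\<theta>2\<in>Freq.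
        op_norm (\<Sigma>\<xi> n \<theta>2 - \<Sigma>\<xi> n \<theta>1) \<le> Lx * \<bar>\<theta>2 - \<theta>1\<bar>"
    using idio unfolding idiosyncratic_def by blast
  define r where "r = \<bar>\<Lambda>1\<bar> + \<bar>\<Lambda>2\<bar> + 1"
  have r: "0 < r" by (simp add: r_def)
  define K1 where "K1 = sqrt s2"
  obtain K \<beta> where K: "0 \<le> K" and \<beta>: "0 < \<Delta> \<longrightarrow> \<beta> = 1 + 2 * \<Delta>" "\<Delta> = 0 \<longrightarrow> \<beta> < 1"
    and power: "\<And>u. 0 < u \<Longrightarrow> u \<le> 2 \<Longrightarrow>
      (8 * K1 * \<bar>L\<bar> + 2 * \<bar>Lx\<bar> + 8 * K1\<^sup>2 * \<Delta> / u + 6 * r * dmax * u powr (2 * dmax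
          - 1)) * u powr (- 2 * \<Delta>)
        \<le> K * u powr (- \<beta>)"
    using modulus_power_bound[of "8 * K1 * \<bar>L\<bar> + 2 * \<bar>Lx\<bar>" "8 * K1\<^sup>2" "6 * r" \<Delta> dmax] \<Delta> r s
    by (auto simp: K1_def)
  \<comment> \<open>The last factor converts powers of \<open>u = 2 / pi * \<bar>\<theta>'\<bar>\<close> into powers of \<open>\<bar>\<theta>'\<bar>\<close>.\<close>
  define C where "C = sqrt (2 * real q) * (8 / s1 * K) * (2 / pi) powr (- \<beta>)"
  have C: "0 \<le> C" using K s by (simp add: C_def)
  obtain C' where C': "\<And>h::int. h \<noteq> 0 \<Longrightarrow> \<exists>J.
    has_bochner_integral lborel (\<lambda>x. x powr (- \<beta>) * indicator {pi / of_int \<bar>h\<bar>..pi} x) J \<and>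
    5 * (pi / of_int \<bar>h\<bar>) + C * (pi / of_int \<bar>h\<bar>) * J \<le> C' * of_int \<bar>h\<bar> powr (2 * \<Delta> - 1)"
    using decay_rate[OF \<Delta>(1) \<beta> C] by blast
  \<comment> \<open>From here on the leading eigenvalues dominate the idiosyncratic part.\<close>
  have large: "\<forall>\<^sub>F n in sequentially. q \<le> n \<and> 32 * r \<le> real n * s1"
  proof (rule eventually_conj[OF eventually_ge_at_top])
    have "\<forall>\<^sub>F n in sequentially. 32 * r / s1 \<le> real n"
      using filterlim_real_sequentially by (simp add: filterlim_at_top)
    then show "\<forall>\<^sub>F n in sequentially. 32 * r \<le> real n * s1"
      by eventually_elim (use s in \<open>simp add: pos_divide_le_eq\<close>)
  qed
  show ?thesis
  proof (rule exI[of _ C'], use S_bounds G_Lip eig X_Lip large in eventually_elim, intro allI impI)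
    fix n i and h :: int
    assume Sb: "\<forall>\<theta>\<in>Freq.
        complex_of_real s1 \<cdot>\<^sub>m 1\<^sub>m q \<preceq> complex_of_real (1 / real n) \<cdot>\<^sub>m (mat_adjoint (loading_mat
            q g n \<theta>) * loading_mat q g n \<theta>) \<and>
        complex_of_real (1 / real n) \<cdot>\<^sub>m (mat_adjoint (loading_mat q g n \<theta>) * loading_mat q g n \<theta>)
            \<preceq> complex_of_real s2 \<cdot>\<^sub>m 1\<^sub>m q"
      and GL: "\<forall>\<theta>1\<in>Freq. \<forall>\<theta>2\<in>Freq.
        op_norm (loading_mat q g n \<theta>2 - loading_mat q g n \<theta>1) \<le> sqrt (real n) * L * \<bar>\<theta>2 - \<theta>1\<bar>"
      and ev: "\<forall>\<theta>\<in>Freq. \<forall>k. eigenvalue (\<Sigma>\<xi> n \<theta>) k \<longrightarrow> k \<in> complex_of_real ` {\<Lambda>1..\<Lambda>2}"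
      and XL: "\<forall>\<theta>1\<in>Freq. \<forall>\<theta>2\<in>Freq. op_norm (\<Sigma>\<xi> n \<theta>2 - \<Sigma>\<xi> n \<theta>1) \<le> Lx * \<bar>\<theta>2 - \<theta>1\<bar>"
      and nl: "q \<le> n \<and> 32 * r \<le> real n * s1"
      and i: "i < n" and h: "h \<noteq> 0"
    have n0: "0 < n" using nl q0 by simp
    have X: "\<Sigma>\<xi> n \<theta> \<in> carrier_mat n n" "hermitian_mat (\<Sigma>\<xi> n \<theta>)"
      and Sg: "\<Sigma> n \<theta> \<in> carrier_mat n n" "hermitian_mat (\<Sigma> n \<theta>)"
      and Sc: "\<Sigma>\<chi> n \<theta> \<in> carrier_mat n n" if "\<theta> \<in> Freq" for \<theta>
    proof -
      have dens: "F \<theta> \<in> carrier_mat n n \<and> hermitian_mat (F \<theta>)" if "is_spectral_density M n Y F"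
          for Y F
        using that \<open>\<theta> \<in> Freq\<close> unfolding is_spectral_density_def by blast
      show "\<Sigma>\<xi> n \<theta> \<in> carrier_mat n n" "hermitian_mat (\<Sigma>\<xi> n \<theta>)" "\<Sigma> n \<theta> \<in> carrier_mat n n"
        "hermitian_mat (\<Sigma> n \<theta>)" "\<Sigma>\<chi> n \<theta> \<in> carrier_mat n n"
        using dens spec by blast+
    qed
    define Gf where "Gf = (\<lambda>\<theta> i l. transfer_fun (g i l) \<theta>)"
    define v where "v = (\<lambda>\<theta> j i. cnj (p n \<theta> j $ i))"
    have G_entry: "loading_mat q g n \<theta> $$ (i, l) = Gf \<theta> i l" if "i < n" "l < q" for \<theta> i l
      using that by (simp add: loading_mat_def Gf_def)
    have mG: "vlen n (mapply q (\<lambda>i l. loading_mat q g n \<theta> $$ (i, l)) w)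
        = vlen n (mapply q (Gf \<theta>) w)" for \<theta> w
      by (rule vlen_cong) (simp add: mapply_def G_entry)
    have G_lo: "real n * s1 * (vlen q w)\<^sup>2 \<le> (vlen n (mapply q (Gf \<theta>) w))\<^sup>2" if "\<theta> \<in> Freq" for \<theta> w
      using loewner_le_scaled_gram(1)[OF G, of s1 "1 / real n" n \<theta> w] Sb that n0 unfolding mG
      by (simp add: field_simps)
    have G_hi: "bounded_op n q (Gf \<theta>) (sqrt (real n) * K1)" if "\<theta> \<in> Freq" for \<theta>
    proof -
      have "vlen n (mapply q (Gf \<theta>) w) \<le> sqrt (real n) * K1 * vlen q w" for w
      proof (rule power2_le_imp_le)
        have "(vlen n (mapply q (Gf \<theta>) w))\<^sup>2 \<le> real n * s2 * (vlen q w)\<^sup>2"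
          using loewner_le_scaled_gram(2)[OF G, of "1 / real n" n \<theta> s2 w] Sb that n0 unfolding mG
          by (simp add: field_simps)
        then show "(vlen n (mapply q (Gf \<theta>) w))\<^sup>2 \<le> (sqrt (real n) * K1 * vlen q w)\<^sup>2"
          using s by (simp add: power_mult_distrib K1_def)
      qed (use s in \<open>simp add: K1_def\<close>)
      then show ?thesis using s by (simp add: bounded_op_def K1_def)
    qed
    have G_diff: "bounded_op n q (\<lambda>i l. Gf \<theta> i l - Gf \<theta>' i l) (sqrt (real n) * \<bar>L\<bar> * \<bar>\<theta> - \<theta>'\<bar>)"
      if "\<theta> \<in> Freq" "\<theta>' \<in> Freq" for \<theta> \<theta>'
    proof -
      have "op_norm (loading_mat q g n \<theta> - loading_mat q g n \<theta>') \<le> sqrt (real n) * L * \<bar>\<theta> - \<theta>'\<bar>"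
        using GL that by blast
      also have "\<dots> \<le> sqrt (real n) * \<bar>L\<bar> * \<bar>\<theta> - \<theta>'\<bar>"
        by (intro mult_right_mono mult_left_mono) auto
      finally show ?thesis
        by (rule bounded_op_cong[THEN iffD1, OF _ bounded_op_op_norm_diff[OF G G], rotated])
            (simp add: G_entry)
    qed
    have X_diff: "bounded_op n n (\<lambda>i j. \<Sigma>\<xi> n \<theta> $$ (i, j) - \<Sigma>\<xi> n \<theta>' $$ (i, j)) (\<bar>Lx\<bar> * \<bar>\<theta> - \<theta>'\<bar>)"
      if "\<theta> \<in> Freq" "\<theta>' \<in> Freq" for \<theta> \<theta>'
    proof (rule bounded_op_op_norm_diff[OF X(1)[OF that(1)] X(1)[OF that(2)]])
      have "op_norm (\<Sigma>\<xi> n \<theta> - \<Sigma>\<xi> n \<theta>') \<le> Lx * \<bar>\<theta> - \<theta>'\<bar>"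
        using XL that by blast
      also have "\<dots> \<le> \<bar>Lx\<bar> * \<bar>\<theta> - \<theta>'\<bar>" by (intro mult_right_mono) auto
      finally show "op_norm (\<Sigma>\<xi> n \<theta> - \<Sigma>\<xi> n \<theta>') \<le> \<bar>Lx\<bar> * \<bar>\<theta> - \<theta>'\<bar>" .
    qed
    have X_R: "\<bar>Re (dotp n (mapply n (\<lambda>i j. \<Sigma>\<xi> n \<theta> $$ (i, j)) y) y)\<bar> \<le> r * (vlen n y)\<^sup>2"
        if "\<theta> \<in> Freq" for \<theta> y
      unfolding r_def by (rule Rayleigh_bounds_of_eigenvalues[OF X[OF that]]) (use ev that in blast)
    have eb: "eigenbasis n (\<lambda>i j. \<Sigma> n \<theta> $$ (i, j)) (lam n \<theta>) (v \<theta>)" if "\<theta> \<in> Freq" "\<theta> \<noteq> 0" for \<theta>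
      unfolding v_def by (rule eigenbasis_of_ordered_row_eigenbasis[OF Sg[OF that(1)]])
          (use eigen that in blast)
    have normal: "complex_of_real (norm (lag_symbol \<theta>) powr (2 * dmax)) * \<Sigma> n \<theta> $$ (i, j) =
          gram q (\<lambda>i l. lag_symbol \<theta> powr complex_of_real (dmax - d i l) * Gf \<theta> i l) i j
          + complex_of_real (norm (lag_symbol \<theta>) powr (2 * dmax)) * \<Sigma>\<xi> n \<theta> $$ (i, j)"
      if \<theta>: "\<theta> \<in> Freq" "\<theta> \<noteq> 0" and ij: "i < n" "j < n" for \<theta> i j
    proof -
      have "\<Sigma> n \<theta> $$ (i, j) = \<Sigma>\<chi> n \<theta> $$ (i, j) + \<Sigma>\<xi> n \<theta> $$ (i, j)"
        using spec_sum \<theta> ij X(1)[OF \<theta>(1)] Sc[OF \<theta>(1)] by auto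
      then show ?thesis
        unfolding Gf_def memory_structure_gram(2)[OF mem_struct q0 \<theta> ij, symmetric]
        by (simp add: distrib_left)
    qed
    have mod1: "vlen n (\<lambda>m. eigenproj q (v \<theta>) i m - eigenproj q (v \<theta>') i m)
        \<le> C * \<bar>\<theta> - \<theta>'\<bar> * \<bar>\<theta>'\<bar> powr (- \<beta>)"
      if \<theta>: "\<theta> \<in> Freq" "\<theta>' \<in> Freq" "0 < \<theta> * \<theta>'" "\<bar>\<theta>'\<bar> \<le> \<bar>\<theta>\<bar>" for \<theta> \<theta>'
    proof -
      define u where "u = 2 / pi * \<bar>\<theta>'\<bar>"
      have "\<theta>' \<noteq> 0" "\<bar>\<theta>'\<bar> \<le> pi" using \<theta> by auto
      then have u: "0 < u" "u \<le> 2" by (simp_all add: u_def field_simps)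
      have "vlen n (\<lambda>m. eigenproj q (v \<theta>) i m - eigenproj q (v \<theta>') i m) \<le>
        sqrt (2 * real q) * (8 / s1 * ((8 * K1 * \<bar>L\<bar> + 2 * \<bar>Lx\<bar> + 8 * K1\<^sup>2 * \<Delta> / u
            + 6 * r * dmax * u powr (2 * dmax - 1)) * u powr (- 2 * \<Delta>)) * \<bar>\<theta> - \<theta>'\<bar>)"
      proof (rule eigenprojection_modulus_ordered[where G = Gf and X = "\<lambda>\<theta> i j. \<Sigma>\<xi> n \<theta> $$ (i, j)"
            and S = "\<lambda>\<theta> i j. \<Sigma> n \<theta> $$ (i, j)" and lam = "lam n" and v = v and a
                = "\<lambda>i l. dmax - d i l" and n = n])
        show "single_index n q (\<lambda>i l. dmax - d i l)"
          by (rule memory_structure_gram(1)[OF mem_struct q0])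
        show "0 \<le> dmax - d i l \<and> dmax - d i l \<le> \<Delta>" if "l < q" for i l
          using d[OF that, of i] by (simp add: Delta)
        show "0 \<le> K1" using s by (simp add: K1_def)
        show "herm n (\<lambda>i j. \<Sigma>\<xi> n \<theta> $$ (i, j))" if "\<theta> \<in> Freq" for \<theta>
          by (rule herm_of_hermitian_mat[OF X(2,1)[OF that]])
      qed (use q0 nl \<Delta> s r G_lo G_hi G_diff X_R X_diff normal eb \<theta> i in \<open>auto simp: u_def\<close>)
      also have "\<dots> \<le> sqrt (2 * real q) * (8 / s1 * (K * u powr (- \<beta>)) * \<bar>\<theta> - \<theta>'\<bar>)"
        using s u by (intro mult_left_mono mult_right_mono power) auto
      also have "u powr (- \<beta>) = (2 / pi) powr (- \<beta>) * \<bar>\<theta>'\<bar> powr (- \<beta>)"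
        unfolding u_def by (rule powr_mult)
      finally show ?thesis by (simp add: C_def algebra_simps)
    qed
    have mod: "vlen n (\<lambda>m. eigenproj q (v \<theta>) i m - eigenproj q (v \<theta>') i m) \<le>
        C * \<bar>\<theta> - \<theta>'\<bar> * (min \<bar>\<theta>\<bar> \<bar>\<theta>'\<bar>) powr (- \<beta>)"
      if \<theta>: "\<theta> \<in> Freq" "\<theta>' \<in> Freq" "0 < \<theta> * \<theta>'" for \<theta> \<theta>'
    proof (cases "\<bar>\<theta>'\<bar> \<le> \<bar>\<theta>\<bar>")
      case True
      then show ?thesis using mod1[OF \<theta>] by (simp add: min_def)
    next
      case False
      have "vlen n (\<lambda>m. eigenproj q (v \<theta>) i m - eigenproj q (v \<theta>') i m)
          = vlen n (\<lambda>m. eigenproj q (v \<theta>') i m - eigenproj q (v \<theta>) i m)"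
        using vlen_uminus[of n "\<lambda>m. eigenproj q (v \<theta>) i m - eigenproj q (v \<theta>') i m"] by simp
      then show ?thesis
        using mod1[OF \<theta>(2,1)] \<theta>(3) False by (simp add: min_def mult.commute abs_minus_commute)
    qed
    obtain J where J: "has_bochner_integral lborel (\<lambda>x. x powr (- \<beta>) * indicator {pi / of_int
        \<bar>h\<bar>..pi} x) J"
      "5 * (pi / of_int \<bar>h\<bar>) + C * (pi / of_int \<bar>h\<bar>) * J \<le> C' * of_int \<bar>h\<bar> powr (2 * \<Delta> - 1)"
      using C'[OF h] by blast
    let ?I = "\<lambda>m. LINT \<theta>:Freq|lborel. eigenproj q (v \<theta>) i m * cis (- (of_int h * \<theta>))"
    have "vlen n ?I \<le> 5 * (pi / of_int \<bar>h\<bar>) + C * (pi / of_int \<bar>h\<bar>) * J"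
    proof (rule Fourier_integral_decay[OF _ C mod h refl J(1)])
      fix \<theta> :: real assume "\<theta> \<in> Freq" "\<theta> \<noteq> 0"
      then have "orthonormal n (v \<theta>)" using eb[of \<theta>] by (simp add: eigenbasis_def)
      then show "vlen n (eigenproj q (v \<theta>) i) \<le> 1"
        by (rule vlen_eigenproj_le_1) (use nl i in auto)
    qed
    then have bound: "vlen n ?I \<le> C' * of_int \<bar>h\<bar> powr (2 * \<Delta> - 1)" using J(2) by linarith
    have "eucl_norm (fourier_coeff_vec n (\<lambda>\<theta>. proj_row q n (p n \<theta>) i) h) =
        vlen n (\<lambda>m. complex_of_real (1 / (2 * pi)) * ?I m)"
    proof -
      have "proj_row q n (p n \<theta>) i $ m = eigenproj q (v \<theta>) i m" if "m < n" for \<theta> m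
        using that by (simp add: proj_row_def eigenproj_def v_def)
      then show ?thesis
        unfolding eucl_norm_eq_vlen fourier_coeff_vec_def dim_vec by (intro vlen_cong) simp
    qed
    also have "\<dots> = 1 / (2 * pi) * vlen n ?I"
      unfolding vlen_scale norm_of_real by simp
    also have "\<dots> \<le> 1 * vlen n ?I"
      using pi_gt3 by (intro mult_right_mono) auto
    finally show "eucl_norm (fourier_coeff_vec n (\<lambda>\<theta>. proj_row q n (p n \<theta>) i) h)
             \<le> C' * of_int \<bar>h\<bar> powr (2 * \<Delta> - 1)"
      using bound by simp
  qed
qed

end
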